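(* Let $X$ and $Y$ be nontrivial real Banach spaces. Then the following statements are equivalent. (a) $Y$ has the Radon-Nikodým property. (b) $\mathrm{SNA}(X,Z)\subseteq \mathrm{Der}(X,Z)$ holds for every renorming $Z$ of $Y$.
   Context: A renorming of $Y$ is the vector space $Y$ equipped with a norm equivalent to the original one. For real Banach spaces $X,Z$, $\mathrm{Lip}_0(X,Z)$ denotes the space of Lipschitz maps $f:X\to Z$ with $f(0)=0$, equipped with the Lipschitz norm $\|f\| = \sup\{\|f(p)-f(q)\|/\|p-q\| : p,q\in X,\ p\neq q\}$. $S_X$ denotes the unit sphere of $X$. $f\in \mathrm{Lip}_0(X,Z)$ strongly attains its norm, written $f\in \mathrm{SNA}(X,Z)$, if there exist $p\neq q$ in $X$ with $\|f\| = \|f(p)-f(q)\|/\|p-q\|$. $f\in \mathrm{Lip}_0(X,Z)$ attains its maximal derivative, written $f\in \mathrm{Der}(X,Z)$, if there exist $x\in X$ and $e\in S_X$ such that the (two-sided, norm) limit $f'(x,e) := \lim_{t\to 0} \frac{f(x+te)-f(x)}{t}\in Z$ exists and $\|f'(x,e)\| = \|f\|$. A Banach space $Y$ has the Radon-Nikodým property (RNP) if for every finite measure space $(\Omega,\Sigma,\mu)$ and every $\mu$-continuous $Y$-valued measure $G:\Sigma\to Y$ of bounded variation there exists $g\in L_1(\mu,Y)$ with $G(E)=\int_E g\,d\mu$ for all $E\in\Sigma$. *)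

theory Defs
  imports "HOL-Analysis.Analysis"
begin

section \<open>Renormings and Lipschitz maps\<close>

(* A renorming of 'y is given by its norm function N; the vector space structure is that of
   the type 'y. *)
definition equivalent_norm :: "('y::real_normed_vector \<Rightarrow> real) \<Rightarrow> bool" where
  "equivalent_norm N \<longleftrightarrow>
     (\<forall>y. 0 \<le> N y) \<and> (\<forall>y. N y = 0 \<longleftrightarrow> y = 0) \<and>
     (\<forall>c y. N (c *\<^sub>R y) = \<bar>c\<bar> * N y) \<and>
     (\<forall>y z. N (y + z) \<le> N y + N z) \<and>
     (\<exists>a>0. \<exists>b>0. \<forall>y. a * norm y \<le> N y \<and> N y \<le> b * norm y)"

(* In the following four definitions N is the norm of the target space. *)
definition Lip0 :: "('y::real_vector \<Rightarrow> real) \<Rightarrow> ('x::real_normed_vector \<Rightarrow> 'y) set" where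
  "Lip0 N = {f. f 0 = 0 \<and> (\<exists>L. \<forall>p q. N (f p - f q) \<le> L * norm (p - q))}"

definition lip_norm :: "('y::real_vector \<Rightarrow> real) \<Rightarrow> ('x::real_normed_vector \<Rightarrow> 'y) \<Rightarrow> real" where
  "lip_norm N f = Sup {N (f p - f q) / norm (p - q) | p q. p \<noteq> q}"

definition SNA :: "('y::real_vector \<Rightarrow> real) \<Rightarrow> ('x::real_normed_vector \<Rightarrow> 'y) set" where
  "SNA N = {f \<in> Lip0 N. \<exists>p q. p \<noteq> q \<and> lip_norm N f = N (f p - f q) / norm (p - q)}"

definition Der :: "('y::real_vector \<Rightarrow> real) \<Rightarrow> ('x::real_normed_vector \<Rightarrow> 'y) set" where
  "Der N = {f \<in> Lip0 N. \<exists>x e z. norm e = 1 \<and>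
     ((\<lambda>t::real. N ((f (x + t *\<^sub>R e) - f x) /\<^sub>R t - z)) \<longlongrightarrow> 0) (at 0) \<and>
     N z = lip_norm N f}"

section \<open>The Radon-Nikodym property\<close>

(* The library's has_bochner_integral requires the target space to be second countable, i.e.
   separable. This is the same definition without that restriction. The approximation by
   simple functions in L1 makes f almost everywhere a limit of simple functions, hence
   strongly measurable; conversely every Bochner integrable function is almost everywhere
   equal to a Borel measurable one. *)
definition has_bochner_integral' ::
    "'w measure \<Rightarrow> ('w \<Rightarrow> 'y) \<Rightarrow> 'y::real_normed_vector \<Rightarrow> bool" where
  "has_bochner_integral' M f x \<longleftrightarrow>
     f \<in> borel_measurable M \<and>
     (\<exists>s. (\<forall>i. Bochner_Integration.simple_bochner_integrable M (s i)) \<and>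
          (\<lambda>i. \<integral>\<^sup>+w. ennreal (norm (f w - s i w)) \<partial>M) \<longlonglongrightarrow> 0 \<and>
          (\<lambda>i. Bochner_Integration.simple_bochner_integral M (s i)) \<longlonglongrightarrow> x)"

lemma has_bochner_integral'_eq:
  fixes f :: "'w \<Rightarrow> 'y::{real_normed_vector, second_countable_topology}"
  shows "has_bochner_integral' M f x \<longleftrightarrow> has_bochner_integral M f x"
  unfolding has_bochner_integral'_def has_bochner_integral.simps by blast

definition vector_measure :: "'w measure \<Rightarrow> ('w set \<Rightarrow> 'y::real_normed_vector) \<Rightarrow> bool" where
  "vector_measure M G \<longleftrightarrow>
     (\<forall>A :: nat \<Rightarrow> 'w set. range A \<subseteq> sets M \<longrightarrow> disjoint_family A \<longrightarrow>
        (\<lambda>n. G (A n)) sums G (\<Union>n. A n))"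

definition continuous_wrt :: "'w measure \<Rightarrow> ('w set \<Rightarrow> 'y::real_normed_vector) \<Rightarrow> bool" where
  "continuous_wrt M G \<longleftrightarrow>
     (\<forall>\<epsilon>>0. \<exists>\<delta>>0. \<forall>E\<in>sets M. measure M E < \<delta> \<longrightarrow> norm (G E) < \<epsilon>)"

definition bounded_variation :: "'w measure \<Rightarrow> ('w set \<Rightarrow> 'y::real_normed_vector) \<Rightarrow> bool" where
  "bounded_variation M G \<longleftrightarrow>
     (\<exists>C. \<forall>P. finite P \<longrightarrow> P \<subseteq> sets M \<longrightarrow> disjoint P \<longrightarrow> \<Union>P = space M \<longrightarrow>
        (\<Sum>E\<in>P. norm (G E)) \<le> C)"

(* A formula of HOL cannot quantify over types, so the type 'w from which the underlying sets
   of the measure spaces are taken is a parameter. The underlying set is space M, an arbitrary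
   subset of 'w. For a small type 'w (e.g. a countable one) every Banach space satisfies
   has_RNP; the universe therefore has to be at least as large as the real line. A universe
   'v + real with a type variable 'v achieves this, and it contains a copy of every measure
   space on 'v, so that with 'v universally quantified all measure spaces are covered. *)
definition has_RNP :: "'w itself \<Rightarrow> 'y::banach itself \<Rightarrow> bool" where
  "has_RNP _ _ \<longleftrightarrow>
     (\<forall>(M :: 'w measure) (G :: 'w set \<Rightarrow> 'y).
        finite_measure M \<longrightarrow> vector_measure M G \<longrightarrow> continuous_wrt M G \<longrightarrow>
        bounded_variation M G \<longrightarrow>
        (\<exists>g. (\<exists>I. has_bochner_integral' M g I) \<and>
             (\<forall>E\<in>sets M. has_bochner_integral' M (\<lambda>w. indicator E w *\<^sub>R g w) (G E))))"

end

theory Submission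
  imports Defs
begin

text \<open>
  If \<open>f\<close> attains its Lipschitz norm \<open>L\<close> at \<open>p\<close> and \<open>q\<close>, then by the triangle inequality all
  difference quotients of \<open>f\<close> along the segment from \<open>q\<close> to \<open>p\<close> have norm exactly \<open>L\<close>, so it
  suffices to find one point of the segment where \<open>f\<close> is differentiable along it. Such a point is
  a Lebesgue point of the density of the vector measure \<open>[a, b) \<mapsto> f b - f a\<close>, which exists by
  the Radon-Nikodym property.

  Conversely, let \<open>\<phi>\<close> be a functional with \<open>\<phi> y0 = 1\<close>. If all bounded subsets of the kernel of \<open>\<phi>\<close> are
  dentable, then the averages of a vector measure are almost constant on suitable subsets of every
  set of positive measure, and an exhaustion argument yields a density. If some bounded
  subset of the kernel is not dentable, it yields a bush: every point is a convex combination of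
  points of the bush far away from it. Replacing a segment with slope \<open>z\<close> by segments whose
  slopes are the points representing \<open>z\<close>, and iterating, gives a nowhere
  differentiable Lipschitz curve \<open>\<gamma>\<close> in the kernel. For a norming functional \<open>\<psi>\<close> on the domain and a renorming
  in which \<open>t \<mapsto> t *\<^sub>R y0\<close> dominates \<open>\<gamma>\<close>, the map \<open>x \<mapsto> \<psi> x *\<^sub>R y0 + \<gamma> (\<psi> x)\<close>
  strongly attains its norm but has no derivative of maximal norm.
\<close>

section \<open>Norming functionals\<close>

text \<open>The perturbation must leave the \<open>y0\<close>-coordinate of \<open>f\<close>
  untouched, so that this coordinate alone attains the norm; hence the bad curve has to live in the
  kernel of \<open>\<phi>\<close>, and so does the bad bounded set. Dentability in the kernel is
  enough for the Radon-Nikodym property because the complementary coordinate is real, and bounded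
  sets of reals are always dentable. The curve must fail to be differentiable at every point, since
  one derivative of maximal norm already puts a map into \<open>Der\<close>; failure on a set of
  positive measure would not do. Self-similarity carries one pair of incompatible slopes to every
  point and every scale. The target need not be separable, and then sums of Borel maps may fail to
  be Borel. Measurability therefore goes through maps with finitely or countably many values and
  through scalar functions \<open>norm (g w - y)\<close>. The density is constructed on arbitrary
  finite measure spaces over any type. The other implication applies the property to one measure
  space only, a copy of Lebesgue measure on the unit interval in the summand \<open>real\<close> of
  \<open>'v + real\<close>.\<close>

definition sublinear :: "('a::real_vector \<Rightarrow> real) \<Rightarrow> bool" where
  "sublinear q \<longleftrightarrow> (\<forall>x y. q (x + y) \<le> q x + q y) \<and> (\<forall>c x. 0 < c \<longrightarrow> q (c *\<^sub>R x) = c * q x)"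

lemma sublinear_0: "sublinear q \<Longrightarrow> q 0 = 0"
proof -
  assume "sublinear q"
  then have "q (2 *\<^sub>R 0) = 2 * q 0" unfolding sublinear_def by (metis zero_less_numeral)
  then show ?thesis by simp
qed

text \<open>The conditions \<open>scale\<close> and \<open>add\<close> let a change of index absorb
  scaling and addition. This covers both infima that occur: along a ray for the shift, and over a
  chain, where the smaller of two members is the common index.\<close>

lemma sublinear_INF:
  fixes F :: "'i \<Rightarrow> 'a::real_vector \<Rightarrow> real"
  assumes ne: "I \<noteq> {}" and bdd: "\<And>x. bdd_below ((\<lambda>i. F i x) ` I)"
    and scale: "\<And>c x i. 0 < c \<Longrightarrow> i \<in> I \<Longrightarrow> \<exists>j\<in>I. F j (c *\<^sub>R x) \<le> c * F i x"
    and add: "\<And>x y i j. i \<in> I \<Longrightarrow> j \<in> I \<Longrightarrow> \<exists>k\<in>I. F k (x + y) \<le> F i x + F j y"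
  shows "sublinear (\<lambda>x. INF i\<in>I. F i x)"
proof -
  let ?q = "\<lambda>x. INF i\<in>I. F i x"
  have low: "?q x \<le> F i x" if "i \<in> I" for i x
    by (rule cINF_lower[OF bdd that])
  have sub: "?q (x + y) \<le> ?q x + ?q y" for x y
  proof -
    have 1: "?q (x + y) \<le> F i x + F j y" if "i \<in> I" "j \<in> I" for i j
      using add[OF that, of x y] low order_trans by blast
    have "?q (x + y) - F j y \<le> ?q x" if "j \<in> I" for j
      by (rule cINF_greatest[OF ne]) (use 1 that in fastforce)
    then have "?q (x + y) - ?q x \<le> ?q y"
      by (intro cINF_greatest[OF ne]) fastforce
    then show ?thesis by simp
  qed
  have sc: "?q (c *\<^sub>R x) \<le> c * ?q x" if "0 < c" for c x
  proof -
    have "?q (c *\<^sub>R x) / c \<le> ?q x"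
    proof (rule cINF_greatest[OF ne])
      fix i assume "i \<in> I"
      then have "?q (c *\<^sub>R x) \<le> c * F i x"
        using scale[OF that, of i x] low order_trans by blast
      then show "?q (c *\<^sub>R x) / c \<le> F i x" using that by (simp add: field_simps)
    qed
    then show ?thesis using that by (simp add: field_simps)
  qed
  have "?q (c *\<^sub>R x) = c * ?q x" if "0 < c" for c x
  proof (rule antisym)
    have "?q (inverse c *\<^sub>R c *\<^sub>R x) \<le> inverse c * ?q (c *\<^sub>R x)"
      using that by (intro sc) simp
    then show "c * ?q x \<le> ?q (c *\<^sub>R x)" using that by (simp add: field_simps)
  qed (use sc that in auto)
  with sub show ?thesis unfolding sublinear_def by blast
qed

text \<open>The terms t = 0 and t = 1 of the infimum give the two bounds. The second one is used
  twice: it makes a minimal sublinear functional superadditive, and for q = norm it forces a linear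
  minorant to attain the norm at \<open>y\<close>.\<close>

lemma sublinear_shift:
  fixes y :: "'a::real_vector"
  assumes q: "sublinear q"
  defines "r \<equiv> \<lambda>x. INF t\<in>{0..}. q (x + t *\<^sub>R y) - t * q y"
  shows "sublinear r" "r x \<le> q x" "r x \<le> q (x + y) - q y"
proof -
  have add: "q (a + b) \<le> q a + q b" and sc: "0 < c \<Longrightarrow> q (c *\<^sub>R a) = c * q a" for a b c
    using q unfolding sublinear_def by auto
  have sc0: "0 \<le> c \<Longrightarrow> q (c *\<^sub>R a) = c * q a" for a c
    using sc[of c a] sublinear_0[OF q] by (cases "c = 0") auto
  have bdd: "bdd_below ((\<lambda>t. q (x + t *\<^sub>R y) - t * q y) ` {0..})" for x
  proof (rule bdd_belowI2)
    fix t :: real assume "t \<in> {0..}"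
    then show "- q (-x) \<le> q (x + t *\<^sub>R y) - t * q y"
      using add[of "x + t *\<^sub>R y" "-x"] sc0[of t y] by simp
  qed
  show "sublinear r" unfolding r_def
  proof (rule sublinear_INF[OF _ bdd])
    fix c t :: real and x assume "0 < c" "t \<in> {0..}"
    then show "\<exists>s\<in>{0..}. q (c *\<^sub>R x + s *\<^sub>R y) - s * q y \<le> c * (q (x + t *\<^sub>R y) - t * q y)"
      using sc[of c "x + t *\<^sub>R y"]
      by (intro bexI[of _ "c * t"]) (auto simp: algebra_simps)
  next
    fix s t :: real and a b assume "s \<in> {0..}" "t \<in> {0..}"
    then show "\<exists>u\<in>{0..}. q (a + b + u *\<^sub>R y) - u * q y
        \<le> q (a + s *\<^sub>R y) - s * q y + (q (b + t *\<^sub>R y) - t * q y)"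
      using add[of "a + s *\<^sub>R y" "b + t *\<^sub>R y"]
      by (intro bexI[of _ "s + t"]) (auto simp: algebra_simps)
  qed auto
  show "r x \<le> q x"
    unfolding r_def by (rule order_trans[OF cINF_lower[OF bdd, of 0]]) auto
  show "r x \<le> q (x + y) - q y"
    unfolding r_def by (rule order_trans[OF cINF_lower[OF bdd, of 1]]) auto
qed

text \<open>A minimal sublinear functional is linear, because \<open>sublinear_shift\<close> cannot decrease it.\<close>

lemma sublinear_dominates_linear:
  fixes p :: "'a::real_vector \<Rightarrow> real"
  assumes p: "sublinear p"
  obtains f where "linear f" "\<And>x. f x \<le> p x"
proof -
  define A where "A = {q. sublinear q \<and> (\<forall>x. q x \<le> p x)}"
  define P where "P q r \<longleftrightarrow> (\<forall>x. r x \<le> q x)" for q r :: "'a \<Rightarrow> real"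
  have "\<exists>m\<in>A. \<forall>a\<in>A. P m a \<longrightarrow> a = m"
  proof (rule predicate_Zorn)
    show "partial_order_on A (relation_of P A)"
    proof (rule partial_order_on_relation_ofI)
      fix a b c :: "'a \<Rightarrow> real"
      assume "P a b" "P b c"
      then show "P a c" unfolding P_def by (meson order_trans)
    next
      fix a b :: "'a \<Rightarrow> real"
      assume "P a b" "P b a"
      then show "a = b" unfolding P_def by (intro ext antisym) auto
    qed (simp add: P_def)
  next
    fix C assume C: "C \<in> Chains (relation_of P A)"
    then have CA: "C \<subseteq> A" by (auto simp: Chains_def relation_of_def)
    have tot: "P q r \<or> P r q" if "q \<in> C" "r \<in> C" for q r
      using C that by (auto simp: Chains_def relation_of_def)
    show "\<exists>u\<in>A. \<forall>a\<in>C. P a u"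
    proof (cases "C = {}")
      case True
      then show ?thesis using p by (auto simp: A_def)
    next
      case False
      have bdd: "bdd_below ((\<lambda>q. q x) ` C)" for x
      proof (rule bdd_belowI2)
        fix q assume "q \<in> C"
        then have q: "sublinear q" "q (-x) \<le> p (-x)" using CA by (auto simp: A_def)
        then have "q (x + -x) \<le> q x + q (-x)" unfolding sublinear_def by blast
        then show "- p (-x) \<le> q x" using q sublinear_0[OF q(1)] by simp
      qed
      have "sublinear (\<lambda>x. INF q\<in>C. q x)"
      proof (rule sublinear_INF[OF False bdd])
        fix c :: real and x q assume "0 < c" "q \<in> C"
        then show "\<exists>j\<in>C. j (c *\<^sub>R x) \<le> c * q x"
          using CA by (intro bexI[of _ q]) (auto simp: A_def sublinear_def)
      next
        fix x y q r assume qr: "q \<in> C" "r \<in> C"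
        obtain s where s: "s \<in> C" "\<And>x. s x \<le> q x" "\<And>x. s x \<le> r x"
          using tot[OF qr] qr unfolding P_def by blast
        have "s (x + y) \<le> s x + s y" using s(1) CA by (auto simp: A_def sublinear_def)
        then have "s (x + y) \<le> q x + r y" using s(2)[of x] s(3)[of y] by linarith
        then show "\<exists>k\<in>C. k (x + y) \<le> q x + r y" using s(1) by blast
      qed
      moreover have low: "(INF q\<in>C. q x) \<le> q x" if "q \<in> C" for q x
        using that by (rule cINF_lower[OF bdd])
      moreover have "(INF q\<in>C. q x) \<le> p x" for x
      proof -
        obtain q where "q \<in> C" using False by blast
        with low[OF this, of x] CA show ?thesis by (force simp: A_def intro: order_trans)
      qed
      ultimately have "(\<lambda>x. INF q\<in>C. q x) \<in> A" by (auto simp: A_def)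
      then show ?thesis
        by (rule bexI[rotated]) (simp add: P_def low)
    qed
  qed
  then obtain m where m: "m \<in> A" and min: "\<And>a. a \<in> A \<Longrightarrow> P m a \<Longrightarrow> a = m" by blast
  have sm: "sublinear m" and mp: "\<And>x. m x \<le> p x" using m by (auto simp: A_def)
  have add: "m (x + y) = m x + m y" for x y
  proof (rule antisym)
    let ?r = "\<lambda>x. INF t\<in>{0..}. m (x + t *\<^sub>R y) - t * m y"
    note r = sublinear_shift[OF sm, where y = y]
    have "?r = m"
    proof (rule min)
      show "?r \<in> A" using r(1,2) mp by (auto simp: A_def intro: order_trans)
      show "P m ?r" using r(2) by (auto simp: P_def)
    qed
    then show "m x + m y \<le> m (x + y)" using r(3)[of x] by (simp add: fun_eq_iff)
  qed (use sm in \<open>auto simp: sublinear_def\<close>)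
  have neg: "m (- x) = - m x" for x using add[of x "-x"] sublinear_0[OF sm] by simp
  have "m (c *\<^sub>R x) = c * m x" for c x
  proof (cases c "0::real" rule: linorder_cases)
    case less
    then have "m ((-c) *\<^sub>R x) = (-c) * m x" using sm unfolding sublinear_def by (metis neg_0_less_iff_less)
    then show ?thesis using neg[of "c *\<^sub>R x"] by simp
  qed (use sm sublinear_0[OF sm] in \<open>auto simp: sublinear_def\<close>)
  with add have "linear m" by (intro linearI) auto
  with mp show thesis using that by blast
qed

text \<open>A linear minorant of the norm shifted along \<open>x0\<close> satisfies f (-x0) <= norm
  0 - norm x0, hence f x0 >= norm x0; being also a minorant of the norm itself, it attains
  equality.\<close>

lemma norming_functional:
  fixes x0 :: "'a::real_normed_vector"
  obtains f :: "'a \<Rightarrow> real" where "linear f" "f x0 = norm x0" "\<And>x. \<bar>f x\<bar> \<le> norm x"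
proof -
  have sn: "sublinear (norm :: 'a \<Rightarrow> real)" by (auto simp: sublinear_def norm_triangle_ineq)
  note r = sublinear_shift[OF sn, where y = x0]
  obtain f where f: "linear f"
    "\<And>x. f x \<le> (INF t\<in>{0..}. norm (x + t *\<^sub>R x0) - t * norm x0)"
    using sublinear_dominates_linear[OF r(1)] by metis
  have le: "f x \<le> norm x" for x using f(2)[of x] r(2)[of x] by linarith
  have "\<bar>f x\<bar> \<le> norm x" for x
    using le[of x] le[of "-x"] linear_neg[OF f(1), of x] by simp
  moreover have "f (- x0) \<le> - norm x0" using f(2)[of "-x0"] r(3)[of "-x0"] by simp
  ultimately show thesis using that[of f] f(1) le[of x0] linear_neg[OF f(1), of x0] by force
qed

section \<open>Nowhere differentiable Lipschitz curves from bushes\<close>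

text \<open>The hull is the plain one, not its closure: the chosen slopes must average exactly to
  \<open>z\<close>, so that the refined curve ends where the segment did.\<close>

definition bush :: "'a::real_normed_vector set \<Rightarrow> real \<Rightarrow> bool" where
  "bush K d \<longleftrightarrow> K \<noteq> {} \<and> bounded K \<and> 0 < d \<and> (\<forall>z\<in>K. z \<in> convex hull (K - ball z d))"

definition clip :: "real \<Rightarrow> real" where
  "clip t = max 0 (min 1 t)"

text \<open>The i-th summand is the length of the part of the i-th interval that lies below
  \<open>t\<close>, for consecutive intervals of lengths \<open>l i\<close> starting at 0.\<close>

lemma sum_clip_rescaled:
  fixes m :: nat
  assumes l: "\<And>i. i < m \<Longrightarrow> 0 < l i" 
  shows "(\<Sum>i<m. l i * clip ((t - (\<Sum>j<i. l j)) / l i)) = max 0 (min (\<Sum>j<m. l j) t)"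
  using l
proof (induction m)
  case (Suc m)
  have "l m > 0" "0 \<le> (\<Sum>j<m. l j)" using Suc.prems by (auto intro!: sum_nonneg intro: less_imp_le)
  moreover have "(\<Sum>i<m. l i * clip ((t - (\<Sum>j<i. l j)) / l i)) = max 0 (min (\<Sum>j<m. l j) t)"
    using Suc by simp
  ultimately show ?case by (auto simp: clip_def max_def min_def field_simps split: if_splits)
qed simp

lemma sum_interval_cover:
  fixes l :: "nat \<Rightarrow> real"
  assumes "0 \<le> t" "t \<le> (\<Sum>j<m. l j)" "0 < m"
  shows "\<exists>i<m. (\<Sum>j<i. l j) \<le> t \<and> t \<le> (\<Sum>j<Suc i. l j)"
  using assms
proof (induction m)
  case (Suc m)
  show ?case
  proof (cases "t \<le> (\<Sum>j<m. l j) \<and> 0 < m")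
    case True
    then show ?thesis using Suc less_Suc_eq by blast
  next
    case False
    then show ?thesis using Suc.prems by (intro exI[of _ m]) auto
  qed
qed simp

text \<open>A choice, for each point \<open>z\<close> of a bush, of a convex combination representing it. The curve
  \<open>curve z\<close> with total increment \<open>z\<close> is the concatenation of the copies of \<open>curve (p z i)\<close> scaled by
  \<open>l z i\<close>. Extending curves by constants outside the unit interval turns concatenation into
  the plain sum \<open>concat_curves\<close>.\<close>

locale bush_splitting =
  fixes K :: "'a::banach set" and d C :: real
    and m :: "'a \<Rightarrow> nat" and l :: "'a \<Rightarrow> nat \<Rightarrow> real" and p :: "'a \<Rightarrow> nat \<Rightarrow> 'a"
  assumes d: "0 < d" and C: "0 < C" "\<And>z. z \<in> K \<Longrightarrow> norm z \<le> C"
    and l_pos: "\<And>z i. z \<in> K \<Longrightarrow> i < m z \<Longrightarrow> 0 < l z i"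
    and p_in: "\<And>z i. z \<in> K \<Longrightarrow> i < m z \<Longrightarrow> p z i \<in> K"
    and p_far: "\<And>z i. z \<in> K \<Longrightarrow> i < m z \<Longrightarrow> d \<le> norm (p z i - z)"
    and l_sum: "\<And>z. z \<in> K \<Longrightarrow> (\<Sum>i<m z. l z i) = 1"
    and lp_sum: "\<And>z. z \<in> K \<Longrightarrow> (\<Sum>i<m z. l z i *\<^sub>R p z i) = z"
begin

section \<open>Concatenation of rescaled curves\<close>

definition s :: "'a \<Rightarrow> nat \<Rightarrow> real" where "s z i = (\<Sum>j<i. l z j)"

definition concat_curves :: "('a \<Rightarrow> real \<Rightarrow> 'a) \<Rightarrow> 'a \<Rightarrow> real \<Rightarrow> 'a" where
  "concat_curves u z t = (\<Sum>i<m z. l z i *\<^sub>R u (p z i) ((t - s z i) / l z i))"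

text \<open>Measuring time by \<open>clip\<close> expresses two things at once: the curve is
  Lipschitz with constant \<open>C\<close>, and it rests outside the unit interval.\<close>

definition admissible :: "('a \<Rightarrow> real \<Rightarrow> 'a) \<Rightarrow> bool" where
  "admissible u \<longleftrightarrow> (\<forall>z\<in>K. u z 0 = 0 \<and> u z 1 = z \<and>
     (\<forall>t t'. t \<le> t' \<longrightarrow> norm (u z t' - u z t) \<le> C * (clip t' - clip t)))"

definition \<rho> :: real where "\<rho> = 2 * C / (2 * C + d)"

lemma rho: "0 < \<rho>" "\<rho> < 1"
  using d C by (auto simp: \<rho>_def)

text \<open>The deviations from \<open>z\<close>, weighted by \<open>l z\<close>, sum to zero, so l
  * d <= (1 - l) * 2 * C for each weight l; solving for l gives \<open>\<rho>\<close>. A bound below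
  1 that is uniform in \<open>z\<close> makes both the distance of successive curves and the lengths
  of nested pieces decay geometrically.\<close>

lemma l_le_rho:
  assumes z: "z \<in> K" and i: "i < m z"
  shows "l z i \<le> \<rho>"
proof -
  let ?J = "{..<m z} - {i}"
  have "(\<Sum>j<m z. l z j *\<^sub>R (p z j - z)) = 0"
    using l_sum[OF z] lp_sum[OF z]
    by (simp add: scaleR_diff_right sum_subtractf flip: scaleR_left.sum)
  then have eq: "l z i *\<^sub>R (p z i - z) = - (\<Sum>j\<in>?J. l z j *\<^sub>R (p z j - z))"
    using i by (simp add: sum.remove[of _ i] eq_neg_iff_add_eq_0)
  have "l z i * d \<le> norm (l z i *\<^sub>R (p z i - z))"
    using p_far[OF z i] l_pos[OF z i] by simp
  also have "\<dots> \<le> (\<Sum>j\<in>?J. norm (l z j *\<^sub>R (p z j - z)))"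
    unfolding eq norm_minus_cancel by (rule norm_sum)
  also have "\<dots> \<le> (\<Sum>j\<in>?J. l z j * (2 * C))"
  proof (rule sum_mono)
    fix j assume "j \<in> ?J"
    then have j: "j < m z" by simp
    have "norm (p z j - z) \<le> 2 * C"
      using norm_triangle_ineq4[of "p z j" z] C(2)[OF z] C(2)[OF p_in[OF z j]] by linarith
    then show "norm (l z j *\<^sub>R (p z j - z)) \<le> l z j * (2 * C)"
      using l_pos[OF z j] by simp
  qed
  also have "\<dots> = (1 - l z i) * (2 * C)"
    using l_sum[OF z] i by (simp add: sum.remove[of _ i] flip: sum_distrib_right)
  finally show ?thesis
    using d C(1) by (simp add: \<rho>_def field_simps)
qed

lemma m_pos: "z \<in> K \<Longrightarrow> 0 < m z"
  using l_sum[of z] by (cases "m z") auto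

lemma s_mono: "z \<in> K \<Longrightarrow> i \<le> j \<Longrightarrow> j \<le> m z \<Longrightarrow> s z i \<le> s z j"
  unfolding s_def by (intro sum_mono2) (auto intro!: less_imp_le[OF l_pos])

lemma admissible_const:
  assumes u: "admissible u" and z: "z \<in> K"
  shows "t \<le> 0 \<Longrightarrow> u z t = 0" "1 \<le> t \<Longrightarrow> u z t = z"
proof -
  have *: "norm (u z t' - u z t) \<le> C * (clip t' - clip t)" if "t \<le> t'" for t t'
    using u z that by (auto simp: admissible_def)
  have e: "u z 0 = 0" "u z 1 = z" using u z by (auto simp: admissible_def)
  show "t \<le> 0 \<Longrightarrow> u z t = 0" using *[of t 0] e by (simp add: clip_def)
  show "1 \<le> t \<Longrightarrow> u z t = z" using *[of 1 t] e by (simp add: clip_def)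
qed

text \<open>At time \<open>t\<close> the pieces before \<open>i\<close> have finished and contribute
  their whole increments, while those after \<open>i\<close> have not started; here the constant
  extension of curves pays off.\<close>

lemma concat_curves_piece:
  assumes u: "admissible u" and z: "z \<in> K" and i: "i < m z" and t: "s z i \<le> t" "t \<le> s z (Suc i)"
  shows "concat_curves u z t =
    (\<Sum>j<i. l z j *\<^sub>R p z j) + l z i *\<^sub>R u (p z i) ((t - s z i) / l z i)"
proof -
  let ?f = "\<lambda>j. l z j *\<^sub>R u (p z j) ((t - s z j) / l z j)"
  have split: "{..<m z} = {..<i} \<union> {i} \<union> {i<..<m z}" using i by auto
  have "(\<Sum>j<m z. ?f j) = (\<Sum>j<i. ?f j) + ?f i + (\<Sum>j\<in>{i<..<m z}. ?f j)"
    unfolding split by (subst sum.union_disjoint; force)+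
  also have "(\<Sum>j<i. ?f j) = (\<Sum>j<i. l z j *\<^sub>R p z j)"
  proof (rule sum.cong)
    fix j assume "j \<in> {..<i}"
    then have j: "j < m z" "s z (Suc j) \<le> s z i" using i by (auto intro!: s_mono[OF z])
    then have "1 \<le> (t - s z j) / l z j" using t l_pos[OF z j(1)] by (simp add: s_def field_simps)
    then show "?f j = l z j *\<^sub>R p z j"
      using admissible_const(2)[OF u p_in[OF z j(1)]] by simp
  qed simp
  also have "(\<Sum>j\<in>{i<..<m z}. ?f j) = 0"
  proof (rule sum.neutral, rule ballI)
    fix j assume "j \<in> {i<..<m z}"
    then have j: "j < m z" "s z (Suc i) \<le> s z j" using i by (auto intro!: s_mono[OF z])
    then have "(t - s z j) / l z j \<le> 0" using t l_pos[OF z j(1)] by (simp add: field_simps)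
    then show "?f j = 0"
      using admissible_const(1)[OF u p_in[OF z j(1)]] by simp
  qed
  finally show ?thesis unfolding concat_curves_def by simp
qed

text \<open>The Lipschitz constant does not grow: each piece moves with constant at most
  \<open>C\<close>, and the times spent in the pieces add up to the elapsed time by
  \<open>sum_clip_rescaled\<close>.\<close>

lemma admissible_concat_curves:
  assumes u: "admissible u"
  shows "admissible (concat_curves u)"
  unfolding admissible_def
proof (intro ballI conjI allI impI)
  fix z assume z: "z \<in> K"
  have s: "s z 0 = 0" "s z (m z) = 1" using l_sum[OF z] by (auto simp: s_def)
  have "s z 0 \<le> s z (Suc 0)" using m_pos[OF z] by (intro s_mono[OF z]) auto
  then have "concat_curves u z 0 = (\<Sum>j<0. l z j *\<^sub>R p z j) + l z 0 *\<^sub>R u (p z 0) ((0 - s z 0) / l z 0)"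
    using m_pos[OF z] s by (intro concat_curves_piece[OF u z]) auto
  then show "concat_curves u z 0 = 0"
    using admissible_const(1)[OF u p_in[OF z m_pos[OF z]]] s by simp
  obtain k where k: "m z = Suc k" using m_pos[OF z] by (cases "m z") auto
  have "s z k \<le> 1" using s_mono[OF z, of k "m z"] k s by simp
  then have "concat_curves u z 1 = (\<Sum>j<k. l z j *\<^sub>R p z j) + l z k *\<^sub>R u (p z k) ((1 - s z k) / l z k)"
    using k s by (intro concat_curves_piece[OF u z]) auto
  moreover have "(1 - s z k) / l z k = 1"
    using s(2) l_pos[OF z, of k] k by (simp add: s_def field_simps)
  moreover have "p z k \<in> K" using p_in[OF z] k by simp
  ultimately show "concat_curves u z 1 = z"
    using admissible_const(2)[OF u, of "p z k" 1] lp_sum[OF z] k by simp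
  fix t t' :: real assume t: "t \<le> t'"
  have "norm (concat_curves u z t' - concat_curves u z t) \<le>
     (\<Sum>i<m z. norm (l z i *\<^sub>R u (p z i) ((t' - s z i) / l z i) - l z i *\<^sub>R u (p z i) ((t - s z i) / l z i)))"
    unfolding concat_curves_def sum_subtractf[symmetric] by (rule norm_sum)
  also have "\<dots> \<le> (\<Sum>i<m z. C * (l z i * clip ((t' - s z i) / l z i) - l z i * clip ((t - s z i) / l z i)))"
  proof (rule sum_mono)
    fix i assume "i \<in> {..<m z}"
    then have i: "i < m z" by simp
    have "norm (u (p z i) ((t' - s z i) / l z i) - u (p z i) ((t - s z i) / l z i))
      \<le> C * (clip ((t' - s z i) / l z i) - clip ((t - s z i) / l z i))"
      using u p_in[OF z i] l_pos[OF z i] t by (auto simp: admissible_def divide_right_mono)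
    then have "l z i * norm (u (p z i) ((t' - s z i) / l z i) - u (p z i) ((t - s z i) / l z i))
      \<le> l z i * (C * (clip ((t' - s z i) / l z i) - clip ((t - s z i) / l z i)))"
      using l_pos[OF z i] by (intro mult_left_mono) auto
    then show "norm (l z i *\<^sub>R u (p z i) ((t' - s z i) / l z i) - l z i *\<^sub>R u (p z i) ((t - s z i) / l z i))
      \<le> C * (l z i * clip ((t' - s z i) / l z i) - l z i * clip ((t - s z i) / l z i))"
      using l_pos[OF z i] by (simp add: algebra_simps flip: scaleR_diff_right)
  qed
  also have "\<dots> = C * (clip t' - clip t)"
    using sum_clip_rescaled[of "m z" "l z" t] sum_clip_rescaled[of "m z" "l z" t'] l_pos[OF z] l_sum[OF z]
    by (simp add: sum_subtractf clip_def s_def flip: sum_distrib_left)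
  finally show "norm (concat_curves u z t' - concat_curves u z t) \<le> C * (clip t' - clip t)" .
qed

lemma piece_exists:
  assumes "z \<in> K" "0 \<le> t" "t \<le> 1"
  obtains i where "i < m z" "s z i \<le> t" "t \<le> s z (Suc i)"
  using sum_interval_cover[of t "l z" "m z"] l_sum m_pos assms unfolding s_def by auto

text \<open>Inside the unit interval a single piece is active, and its difference is scaled by a
  weight of at most \<open>\<rho>\<close>. Outside, both curves rest at the same point.\<close>

lemma concat_curves_contraction:
  assumes u: "admissible u" and v: "admissible v"
    and D: "\<And>z t. z \<in> K \<Longrightarrow> norm (u z t - v z t) \<le> D" and z: "z \<in> K"
  shows "norm (concat_curves u z t - concat_curves v z t) \<le> \<rho> * D"
proof -
  have D0: "0 \<le> D" using D[OF z] norm_ge_zero order_trans by blast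
  note c = admissible_const[OF admissible_concat_curves[OF u] z, of t]
    admissible_const[OF admissible_concat_curves[OF v] z, of t]
  show ?thesis
  proof (cases "0 \<le> t \<and> t \<le> 1")
    case True
    then obtain i where i: "i < m z" "s z i \<le> t" "t \<le> s z (Suc i)"
      using piece_exists[OF z] by blast
    have "norm (concat_curves u z t - concat_curves v z t) =
      l z i * norm (u (p z i) ((t - s z i) / l z i) - v (p z i) ((t - s z i) / l z i))"
      using concat_curves_piece[OF u z i] concat_curves_piece[OF v z i] l_pos[OF z i(1)]
      by (simp flip: scaleR_diff_right)
    also have "\<dots> \<le> \<rho> * D"
      using l_le_rho[OF z i(1)] l_pos[OF z i(1)] D[OF p_in[OF z i(1)]] D0 rho
      by (intro mult_mono) auto
    finally show ?thesis .
  next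
    case False
    then have "concat_curves u z t = concat_curves v z t" using c by force
    then show ?thesis using D0 rho by simp
  qed
qed

section \<open>The self-similar limit curve\<close>

definition iter :: "nat \<Rightarrow> 'a \<Rightarrow> real \<Rightarrow> 'a" where
  "iter n = (concat_curves ^^ n) (\<lambda>z t. clip t *\<^sub>R z)"

lemma iter_Suc: "iter (Suc n) = concat_curves (iter n)"
  by (simp add: iter_def)

definition curve :: "'a \<Rightarrow> real \<Rightarrow> 'a" where
  "curve z t = lim (\<lambda>n. iter n z t)"

lemma admissible_iter: "admissible (iter n)"
proof (induction n)
  case 0
  have "norm (clip t' *\<^sub>R z - clip t *\<^sub>R z) \<le> C * (clip t' - clip t)" if "z \<in> K" "t \<le> t'" for z t t'
  proof -
    have "clip t \<le> clip t'" using that by (auto simp: clip_def)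
    then have "norm (clip t' *\<^sub>R z - clip t *\<^sub>R z) = (clip t' - clip t) * norm z"
      by (simp flip: scaleR_diff_left)
    also have "\<dots> \<le> (clip t' - clip t) * C"
      using C(2)[OF that(1)] \<open>clip t \<le> clip t'\<close> by (intro mult_left_mono) auto
    finally show ?thesis by (simp add: mult.commute)
  qed
  then show ?case by (auto simp: admissible_def iter_def clip_def)
next
  case (Suc n)
  then show ?case using admissible_concat_curves by (simp add: iter_def)
qed

lemma norm_admissible:
  assumes u: "admissible u" and z: "z \<in> K"
  shows "norm (u z t) \<le> C"
proof -
  have "norm (u z t - u z (min t 0)) \<le> C * (clip t - clip (min t 0))"
    using u z by (auto simp: admissible_def)
  also have "\<dots> \<le> C * 1" using C(1) by (intro mult_left_mono) (auto simp: clip_def)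
  finally show ?thesis using admissible_const(1)[OF u z, of "min t 0"] by simp
qed

lemma iter_step:
  assumes "z \<in> K"
  shows "norm (iter (Suc n) z t - iter n z t) \<le> \<rho> ^ n * (2 * C)"
  using assms
proof (induction n arbitrary: z t)
  case 0
  show ?case
    using norm_triangle_ineq4[of "iter (Suc 0) z t" "iter 0 z t"]
      norm_admissible[OF admissible_iter 0, of "Suc 0" t] norm_admissible[OF admissible_iter 0, of 0 t]
    by simp
next
  case (Suc n)
  have "norm (concat_curves (iter (Suc n)) z t - concat_curves (iter n) z t) \<le> \<rho> * (\<rho> ^ n * (2 * C))"
    by (rule concat_curves_contraction[OF admissible_iter admissible_iter Suc.IH Suc.prems])
  then show ?case by (simp add: iter_def)
qed

lemma iter_tendsto:
  assumes z: "z \<in> K"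
  shows "(\<lambda>n. iter n z t) \<longlonglongrightarrow> curve z t"
proof -
  have "summable (\<lambda>n. \<rho> ^ n * (2 * C))" using rho by (intro summable_mult2 summable_geometric) auto
  then have "summable (\<lambda>n. iter (Suc n) z t - iter n z t)"
    by (rule summable_comparison_test'[of _ 0]) (use iter_step[OF z] in auto)
  then have "convergent (\<lambda>n. \<Sum>k<n. iter (Suc k) z t - iter k z t)"
    by (simp add: summable_iff_convergent)
  then have "convergent (\<lambda>n. iter n z t - iter 0 z t)"
    by (simp only: sum_lessThan_telescope[of "\<lambda>n. iter n z t"])
  then have "convergent (\<lambda>n. (iter n z t - iter 0 z t) + iter 0 z t)"
    by (intro convergent_add convergent_const)
  then show ?thesis by (simp add: curve_def convergent_LIMSEQ_iff)
qed

lemma admissible_curve: "admissible curve"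
  unfolding admissible_def
proof (intro ballI conjI allI impI)
  fix z assume z: "z \<in> K"
  note L = iter_tendsto[OF z] and A = admissible_iter[unfolded admissible_def, rule_format, OF z]
  show "curve z 0 = 0" using L[of 0] A by (simp add: LIMSEQ_const_iff)
  show "curve z 1 = z" using L[of 1] A by (simp add: LIMSEQ_const_iff)
  fix t t' :: real assume "t \<le> t'"
  then show "norm (curve z t' - curve z t) \<le> C * (clip t' - clip t)"
    using A by (intro tendsto_le[OF _ tendsto_const tendsto_norm[OF tendsto_diff[OF L L]]]) auto
qed

text \<open>Self-similarity: concatenation is a finite sum, so it commutes with the pointwise
  limit.\<close>

lemma curve_fixpoint:
  assumes z: "z \<in> K"
  shows "concat_curves curve z t = curve z t"
proof (rule LIMSEQ_unique)
  show "(\<lambda>n. iter (Suc n) z t) \<longlonglongrightarrow> curve z t"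
    using iter_tendsto[OF z] by (rule LIMSEQ_Suc)
  show "(\<lambda>n. iter (Suc n) z t) \<longlonglongrightarrow> concat_curves curve z t"
    using p_in[OF z] unfolding iter_Suc concat_curves_def
    by (intro tendsto_sum tendsto_scaleR tendsto_const iter_tendsto) auto
qed

text \<open>Used for the kernel of \<open>\<phi>\<close>, so that \<open>\<phi>\<close> does not see
  the curve.\<close>

lemma curve_in_subspace:
  assumes W: "subspace W" "closed W" "K \<subseteq> W" and z: "z \<in> K"
  shows "curve z t \<in> W"
proof (rule closed_sequentially[OF W(2) _ iter_tendsto[OF z]])
  show "iter n z t \<in> W" for n
    using z
  proof (induction n arbitrary: z t)
    case 0
    then show ?case using W by (auto simp: iter_def intro: subspace_scale)
  next
    case (Suc n)
    have "concat_curves (iter n) z t \<in> W"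
      unfolding concat_curves_def using Suc p_in[OF Suc.prems] W(1)
      by (intro subspace_sum subspace_scale) auto
    then show ?case by (simp add: iter_def)
  qed
qed

section \<open>Chord slopes and non-differentiability\<close>

lemma curve_piece:
  assumes z: "z \<in> K" and i: "i < m z" and r: "0 \<le> r" "r \<le> 1"
  shows "curve z (s z i + l z i * r) = (\<Sum>j<i. l z j *\<^sub>R p z j) + l z i *\<^sub>R curve (p z i) r"
proof -
  have "l z i * r \<le> l z i" using l_pos[OF z i] r by simp
  then have "curve z (s z i + l z i * r) =
    (\<Sum>j<i. l z j *\<^sub>R p z j) + l z i *\<^sub>R curve (p z i) ((s z i + l z i * r - s z i) / l z i)"
    using l_pos[OF z i] r curve_fixpoint[OF z]
    by (subst concat_curves_piece[OF admissible_curve z i, symmetric]) (auto simp: s_def)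
  then show ?thesis using l_pos[OF z i] by simp
qed

text \<open>At the top level the whole interval has slope \<open>z\<close> and the piece containing
  \<open>t\<close> has a slope \<open>p z i\<close>, at distance at least \<open>d\<close>. Deeper
  pairs are affine copies of this pair inside nested pieces around \<open>t\<close>; each step
  multiplies lengths by at most \<open>\<rho>\<close>.\<close>

lemma curve_incompatible_slopes:
  assumes "z \<in> K" "0 \<le> t" "t \<le> 1"
  shows "\<exists>a b y a' b' y'. 0 \<le> a \<and> a \<le> t \<and> t \<le> b \<and> b \<le> 1 \<and> 0 < b - a \<and> b - a \<le> \<rho> ^ n \<and>
     0 \<le> a' \<and> a' \<le> t \<and> t \<le> b' \<and> b' \<le> 1 \<and> 0 < b' - a' \<and> b' - a' \<le> \<rho> ^ n \<and>
     curve z b - curve z a = (b - a) *\<^sub>R y \<and> curve z b' - curve z a' = (b' - a') *\<^sub>R y' \<and>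
     d \<le> norm (y' - y)"
  using assms
proof (induction n arbitrary: z t)
  case 0
  note z = 0(1)
  obtain i where i: "i < m z" "s z i \<le> t" "t \<le> s z (Suc i)"
    using piece_exists[OF 0] by blast
  have s: "s z (Suc i) = s z i + l z i" "0 \<le> s z i" "s z (Suc i) \<le> 1"
    using s_mono[OF z, of "Suc i" "m z"] s_mono[OF z, of 0 i] i l_sum[OF z] by (auto simp: s_def)
  have ends: "curve y 0 = 0" "curve y 1 = y" if "y \<in> K" for y
    using admissible_curve that by (auto simp: admissible_def)
  have "curve z (s z (Suc i)) - curve z (s z i) = l z i *\<^sub>R p z i"
    using curve_piece[OF z i(1), of 0] curve_piece[OF z i(1), of 1] ends[OF p_in[OF z i(1)]] s
    by simp
  then have "curve z (s z (Suc i)) - curve z (s z i) = (s z (Suc i) - s z i) *\<^sub>R p z i"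
    using s(1) by simp
  moreover have "0 < s z (Suc i) - s z i" "s z (Suc i) - s z i \<le> \<rho> ^ 0"
    using s l_pos[OF z i(1)] unfolding power_0 by linarith+
  moreover have "0 < (1::real) - 0" "(1::real) - 0 \<le> \<rho> ^ 0" by simp_all
  moreover have "curve z 1 - curve z 0 = (1 - 0) *\<^sub>R z" using ends[OF z] by simp
  ultimately show ?case
    using 0 i s p_far[OF z i(1)] by blast
next
  case (Suc n)
  note z = Suc.prems(1)
  obtain i where i: "i < m z" "s z i \<le> t" "t \<le> s z (Suc i)"
    using piece_exists[OF Suc.prems] by blast
  have s: "s z (Suc i) = s z i + l z i" "0 \<le> s z i" "s z (Suc i) \<le> 1"
    using s_mono[OF z, of "Suc i" "m z"] s_mono[OF z, of 0 i] i l_sum[OF z] by (auto simp: s_def)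
  note lp = l_pos[OF z i(1)]
  \<comment> \<open>\<open>\<phi>\<close> maps the unit interval onto piece \<open>i\<close>. By
    \<open>curve_piece\<close> lengths and increments are both multiplied by \<open>l z i\<close>,
    so chord slopes do not change.\<close>
  define \<phi> where "\<phi> r = s z i + l z i * r" for r
  define r where "r = (t - s z i) / l z i"
  have r: "0 \<le> r" "r \<le> 1" "t = \<phi> r" using i s lp by (auto simp: r_def \<phi>_def field_simps)
  obtain a b y a' b' y' where ab: "0 \<le> a" "a \<le> r" "r \<le> b" "b \<le> 1" "0 < b - a" "b - a \<le> \<rho> ^ n"
    and ab': "0 \<le> a'" "a' \<le> r" "r \<le> b'" "b' \<le> 1" "0 < b' - a'" "b' - a' \<le> \<rho> ^ n"
    and sl: "curve (p z i) b - curve (p z i) a = (b - a) *\<^sub>R y"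
      "curve (p z i) b' - curve (p z i) a' = (b' - a') *\<^sub>R y'" "d \<le> norm (y' - y)"
    using Suc.IH[OF p_in[OF z i(1)] r(1,2)] by blast
  have mono: "\<phi> x \<le> \<phi> y \<longleftrightarrow> x \<le> y" for x y using lp by (simp add: \<phi>_def)
  have diff: "\<phi> y - \<phi> x = l z i * (y - x)" for x y by (simp add: \<phi>_def algebra_simps)
  have range: "0 \<le> \<phi> x" "\<phi> x \<le> 1" if "0 \<le> x" "x \<le> 1" for x
    using mono[of 0 x] mono[of x 1] that s by (auto simp: \<phi>_def)
  have len: "l z i * x \<le> \<rho> ^ Suc n" if "0 < x" "x \<le> \<rho> ^ n" for x
    using l_le_rho[OF z i(1)] lp that rho by (auto intro: mult_mono)
  have inc: "curve z (\<phi> y) - curve z (\<phi> x) = l z i *\<^sub>R (curve (p z i) y - curve (p z i) x)"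
    if "0 \<le> x" "x \<le> 1" "0 \<le> y" "y \<le> 1" for x y
    using curve_piece[OF z i(1)] that by (simp add: \<phi>_def scaleR_diff_right)
  have "0 \<le> \<phi> a \<and> \<phi> a \<le> t \<and> t \<le> \<phi> b \<and> \<phi> b \<le> 1 \<and> 0 < \<phi> b - \<phi> a \<and> \<phi> b - \<phi> a \<le> \<rho> ^ Suc n"
    unfolding r(3) mono diff using ab lp len[of "b - a"] range[of a] range[of b] by simp
  moreover have "0 \<le> \<phi> a' \<and> \<phi> a' \<le> t \<and> t \<le> \<phi> b' \<and> \<phi> b' \<le> 1 \<and> 0 < \<phi> b' - \<phi> a' \<and> \<phi> b' - \<phi> a' \<le> \<rho> ^ Suc n"
    unfolding r(3) mono diff using ab' lp len[of "b' - a'"] range[of a'] range[of b'] by simp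
  moreover have "curve z (\<phi> b) - curve z (\<phi> a) = (\<phi> b - \<phi> a) *\<^sub>R y"
    using inc[of a b] ab sl(1) by (simp add: diff)
  moreover have "curve z (\<phi> b') - curve z (\<phi> a') = (\<phi> b' - \<phi> a') *\<^sub>R y'"
    using inc[of a' b'] ab' sl(2) by (simp add: diff)
  ultimately show ?case using sl(3) by blast
qed

text \<open>At a point of differentiability the slopes of short chords straddling it are close to
  the derivative. Tolerance d / 3 would put two slopes within 2 * d / 3 of each other, contradicting
  their distance of at least \<open>d\<close>.\<close>

lemma curve_not_differentiable:
  assumes z: "z \<in> K" and t: "0 \<le> t" "t \<le> 1"
  shows "\<not> (curve z has_vector_derivative D) (at t within {0..1})"
proof
  assume "(curve z has_vector_derivative D) (at t within {0..1})"
  then have "\<forall>\<epsilon>>0. \<exists>e>0. \<forall>y\<in>{0..1}. norm (y - t) < e \<longrightarrow>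
      norm (curve z y - curve z t - (y - t) *\<^sub>R D) \<le> \<epsilon> * norm (y - t)"
    by (simp add: has_vector_derivative_def has_derivative_within_alt)
  from this[rule_format, of "d / 3"] obtain e where "e > 0" and e: "\<And>y. 0 \<le> y \<Longrightarrow> y \<le> 1 \<Longrightarrow> \<bar>y - t\<bar> < e \<Longrightarrow>
      norm (curve z y - curve z t - (y - t) *\<^sub>R D) \<le> d / 3 * \<bar>y - t\<bar>"
    using d by auto
  obtain n where n: "\<rho> ^ n < e" using real_arch_pow_inv[OF \<open>e > 0\<close> rho(2)] by blast
  have close: "norm (y - D) \<le> d / 3"
    if "0 \<le> a" "a \<le> t" "t \<le> b" "b \<le> 1" "0 < b - a" "b - a \<le> \<rho> ^ n"
      "curve z b - curve z a = (b - a) *\<^sub>R y" for a b y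
  proof -
    \<comment> \<open>The chord is split at \<open>t\<close>. As \<open>t\<close> lies between
      \<open>a\<close> and \<open>b\<close>, the two linearisation errors are bounded by d / 3 times
      lengths that add up to b - a.\<close>
    have "(b - a) *\<^sub>R (y - D) = (curve z b - curve z t - (b - t) *\<^sub>R D) - (curve z a - curve z t - (a - t) *\<^sub>R D)"
      using that by (simp add: algebra_simps)
    then have "(b - a) * norm (y - D) \<le>
        norm (curve z b - curve z t - (b - t) *\<^sub>R D) + norm (curve z a - curve z t - (a - t) *\<^sub>R D)"
      using norm_triangle_ineq4 that(5) by (metis abs_of_pos norm_scaleR)
    also have "\<dots> \<le> d / 3 * \<bar>b - t\<bar> + d / 3 * \<bar>a - t\<bar>"
      using that n by (intro add_mono e) auto
    also have "\<dots> = (b - a) * (d / 3)" using that by (simp add: field_simps)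
    finally show ?thesis using that(5) by simp
  qed
  obtain a b y a' b' y' where ab: "0 \<le> a" "a \<le> t" "t \<le> b" "b \<le> 1" "0 < b - a" "b - a \<le> \<rho> ^ n"
      "curve z b - curve z a = (b - a) *\<^sub>R y"
    and ab': "0 \<le> a'" "a' \<le> t" "t \<le> b'" "b' \<le> 1" "0 < b' - a'" "b' - a' \<le> \<rho> ^ n"
      "curve z b' - curve z a' = (b' - a') *\<^sub>R y'"
    and far: "d \<le> norm (y' - y)"
    using curve_incompatible_slopes[OF z t, of n] by blast
  have "norm (y' - y) \<le> norm (y' - D) + norm (y - D)"
    using norm_triangle_ineq4[of "y' - D" "y - D"] by simp
  then show False using close[OF ab] close[OF ab'] far d by linarith
qed

text \<open>The curve is needed at all values of a functional on the domain. The constant extension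
  would be differentiable outside the unit interval; repeating the curve with increment
  \<open>z\<close> per unit keeps it bad everywhere.\<close>

definition line :: "'a \<Rightarrow> real \<Rightarrow> 'a" where
  "line z t = of_int \<lfloor>t\<rfloor> *\<^sub>R z + curve z (frac t)"

text \<open>The right end point is included: the floor jumps there by one, which
  \<open>curve z 1 = z\<close> compensates.\<close>

lemma line_on_unit_interval:
  assumes z: "z \<in> K" and t: "of_int k \<le> t" "t \<le> of_int k + 1"
  shows "line z t = of_int k *\<^sub>R z + curve z (t - of_int k)"
proof (cases "t = of_int k + 1")
  case True
  have "t = of_int (k + 1)" using True by simp
  then have "\<lfloor>t\<rfloor> = k + 1" by (simp only: floor_of_int)
  then show ?thesis
    using admissible_curve z True by (simp add: line_def frac_def admissible_def algebra_simps)
next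
  case False
  then have "\<lfloor>t\<rfloor> = k" using t by linarith
  then show ?thesis by (simp add: line_def frac_def)
qed

lemma line_lipschitz:
  assumes z: "z \<in> K"
  shows "norm (line z t' - line z t) \<le> C * \<bar>t' - t\<bar>"
proof -
  have *: "norm (line z t' - line z t) \<le> C * (t' - t)" if "t \<le> t'" for t t'
  proof -
    have c: "norm (curve z b - curve z a) \<le> C * (b - a)" if "0 \<le> a" "a \<le> b" "b \<le> 1" for a b
    proof -
      have "norm (curve z b - curve z a) \<le> C * (clip b - clip a)"
        using admissible_curve z that by (auto simp: admissible_def)
      then show ?thesis using that by (simp add: clip_def)
    qed
    have e: "curve z 0 = 0" "curve z 1 = z" using admissible_curve z by (auto simp: admissible_def)
    have f: "0 \<le> frac t" "frac t \<le> 1" "0 \<le> frac t'" "frac t' \<le> 1"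
      using frac_ge_0 frac_lt_1 less_imp_le by metis+
    show ?thesis
    proof (cases "\<lfloor>t\<rfloor> = \<lfloor>t'\<rfloor>")
      case True
      then show ?thesis using c[of "frac t" "frac t'"] f that by (simp add: line_def frac_def)
    next
      case False
      \<comment> \<open>The number of full unit intervals between \<open>t\<close> and
        \<open>t'\<close>; the subtracted 1 is the incomplete interval that contains
        \<open>t\<close>.\<close>
      define k :: real where "k = of_int (\<lfloor>t'\<rfloor> - \<lfloor>t\<rfloor> - 1)"
      have k: "0 \<le> k" using False floor_mono[OF that] by (simp add: k_def)
      have "line z t' - line z t = (curve z (frac t') - curve z 0) + k *\<^sub>R z + (curve z 1 - curve z (frac t))"
        using e by (simp add: line_def k_def algebra_simps)
      then have "norm (line z t' - line z t) \<le>
          norm (curve z (frac t') - curve z 0) + norm (k *\<^sub>R z) + norm (curve z 1 - curve z (frac t))"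
        using norm_triangle_ineq norm_triangle_le by (metis add_mono order_refl)
      also have "\<dots> \<le> C * (frac t' - 0) + k * C + C * (1 - frac t)"
        using f k C(2)[OF z] by (intro add_mono c) (auto intro: mult_left_mono)
      also have "\<dots> = C * (t' - t)" by (simp add: k_def frac_def algebra_simps)
      finally show ?thesis .
    qed
  qed
  show ?thesis
    using *[of t t'] *[of t' t] by (cases "t \<le> t'") (auto simp: norm_minus_commute)
qed

text \<open>A derivative on the line restricts to a derivative within the closed unit interval
  starting at the floor of \<open>t\<close>. At integers this is a one-sided derivative, which
  \<open>curve_not_differentiable\<close> also excludes.\<close>

lemma line_not_differentiable:
  assumes z: "z \<in> K"
  shows "\<not> (line z has_vector_derivative D) (at t)"
proof
  let ?k = "of_int \<lfloor>t\<rfloor> :: real"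
  have t: "?k \<le> t" "t \<le> ?k + 1" by linarith+
  assume "(line z has_vector_derivative D) (at t)"
  then have "(line z has_vector_derivative D) (at (?k + (t - ?k)) within (\<lambda>r. ?k + r) ` {0..1})"
    by (auto intro: has_vector_derivative_at_within)
  moreover have "((\<lambda>r. ?k + r) has_vector_derivative 1) (at (t - ?k) within {0..1})"
    by (auto intro!: derivative_eq_intros)
  moreover have eq: "?k *\<^sub>R z + curve z r = (line z \<circ> (\<lambda>r. ?k + r)) r" if "r \<in> {0..1}" for r
    using line_on_unit_interval[OF z, of "\<lfloor>t\<rfloor>" "?k + r"] that by simp
  ultimately have "((line z \<circ> (\<lambda>r. ?k + r)) has_vector_derivative (1 *\<^sub>R D)) (at (t - ?k) within {0..1})"
    by (intro vector_diff_chain_within)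
  then have "((\<lambda>r. ?k *\<^sub>R z + curve z r) has_vector_derivative (1 *\<^sub>R D)) (at (t - ?k) within {0..1})"
  proof (rule has_vector_derivative_transform[rotated 2])
    show "t - ?k \<in> {0..1}" unfolding atLeastAtMost_iff using t by linarith
  qed (use eq in auto)
  then have "((\<lambda>r. (?k *\<^sub>R z + curve z r) - ?k *\<^sub>R z) has_vector_derivative (1 *\<^sub>R D - 0)) (at (t - ?k) within {0..1})"
    by (intro has_vector_derivative_diff has_vector_derivative_const)
  then have "(curve z has_vector_derivative D) (at (t - ?k) within {0..1})" by simp
  then show False using curve_not_differentiable[OF z, of "t - ?k" D] t by simp
qed

end

section \<open>From non-dentable sets to bushes and curves\<close>

lemma convex_hull_indexed:
  fixes z :: "'a::real_vector"
  assumes "z \<in> convex hull S"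
  shows "\<exists>m l p. (\<forall>i<(m::nat). 0 < l i \<and> p i \<in> S) \<and> (\<Sum>i<m. l i) = (1::real) \<and> (\<Sum>i<m. l i *\<^sub>R p i) = z"
proof -
  obtain F u where F: "finite F" "F \<subseteq> S" "\<forall>x\<in>F. 0 \<le> u x" "sum u F = 1" "(\<Sum>v\<in>F. u v *\<^sub>R v) = z"
    using assms unfolding convex_hull_explicit by blast
  \<comment> \<open>Points of weight zero are dropped because the curve construction divides by the
    weights.\<close>
  define E where "E = {x\<in>F. u x \<noteq> 0}"
  have "finite E" using F(1) by (simp add: E_def)
  moreover have "sum u F = sum u E" "(\<Sum>v\<in>F. u v *\<^sub>R v) = (\<Sum>v\<in>E. u v *\<^sub>R v)"
    by (rule sum.mono_neutral_right; use F(1) in \<open>force simp: E_def\<close>)+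
  ultimately have E: "finite E" "sum u E = 1" "(\<Sum>v\<in>E. u v *\<^sub>R v) = z"
    using F by simp_all
  obtain h where h: "bij_betw h {..<card E} E"
    using ex_bij_betw_nat_finite[OF E(1)] by (auto simp: atLeast0LessThan)
  have "h i \<in> E" if "i < card E" for i using h that by (auto simp: bij_betw_def)
  then have "\<forall>i<card E. 0 < u (h i) \<and> h i \<in> S" using F by (force simp: E_def)
  moreover have "(\<Sum>i<card E. u (h i)) = 1" "(\<Sum>i<card E. u (h i) *\<^sub>R h i) = z"
    using E sum.reindex_bij_betw[OF h, of u] sum.reindex_bij_betw[OF h, of "\<lambda>v. u v *\<^sub>R v"] by simp_all
  ultimately show ?thesis by (intro exI[of _ "card E"] exI[of _ "\<lambda>i. u (h i)"] exI[of _ h]) blast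
qed

lemma bush_nowhere_differentiable:
  fixes K :: "'a::banach set"
  assumes K: "bush K d" and W: "subspace W" "closed W" "K \<subseteq> W"
  shows "\<exists>(\<gamma> :: real \<Rightarrow> 'a) C. 0 < C \<and> (\<forall>t t'. norm (\<gamma> t' - \<gamma> t) \<le> C * \<bar>t' - t\<bar>) \<and>
    (\<forall>t. \<gamma> t \<in> W) \<and> \<gamma> 0 = 0 \<and> (\<forall>t D. \<not> (\<gamma> has_vector_derivative D) (at t))"
proof -
  obtain C where C: "0 < C" "\<And>z. z \<in> K \<Longrightarrow> norm z \<le> C"
    using K unfolding bush_def bounded_pos by blast
  have "\<forall>z\<in>K. \<exists>m l p. (\<forall>i<(m::nat). 0 < l i \<and> p i \<in> K - ball z d) \<and> (\<Sum>i<m. l i) = (1::real) \<and>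
      (\<Sum>i<m. l i *\<^sub>R p i) = z"
    using K unfolding bush_def by (intro ballI convex_hull_indexed) blast
  from bchoice[OF this] obtain m where "\<forall>z\<in>K. \<exists>l p. (\<forall>i<(m z::nat). 0 < l i \<and> p i \<in> K - ball z d) \<and>
      (\<Sum>i<m z. l i) = (1::real) \<and> (\<Sum>i<m z. l i *\<^sub>R p i) = z" ..
  from bchoice[OF this] obtain l where "\<forall>z\<in>K. \<exists>p. (\<forall>i<(m z::nat). 0 < l z i \<and> p i \<in> K - ball z d) \<and>
      (\<Sum>i<m z. l z i) = (1::real) \<and> (\<Sum>i<m z. l z i *\<^sub>R p i) = z" ..
  from bchoice[OF this] obtain p where mlp: "\<forall>z\<in>K. (\<forall>i<(m z::nat). 0 < l z i \<and> p z i \<in> K - ball z d) \<and>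
      (\<Sum>i<m z. l z i) = (1::real) \<and> (\<Sum>i<m z. l z i *\<^sub>R p z i) = z" ..
  interpret bush_splitting K d C m l p
  proof
    show "0 < d" using K by (simp add: bush_def)
    fix z i assume "z \<in> K" "i < m z"
    then have "p z i \<notin> ball z d" using mlp by blast
    then show "d \<le> norm (p z i - z)" by (simp add: dist_norm norm_minus_commute)
  qed (use C mlp in auto)
  obtain z where z: "z \<in> K" using K by (auto simp: bush_def)
  show ?thesis
  proof (intro exI[of _ "line z"] exI[of _ C] conjI allI)
    show "0 < C" by fact
    show "line z t \<in> W" for t
      unfolding line_def using W z
      by (intro subspace_add subspace_scale curve_in_subspace) auto
    show "line z 0 = 0" using admissible_curve z by (simp add: line_def admissible_def)
  qed (use line_lipschitz[OF z] line_not_differentiable[OF z] in auto)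
qed

text \<open>Thickening a set absorbs the difference between the closed and the plain convex hull.\<close>

lemma bush_of_nondentable:
  fixes K :: "'a::real_normed_vector set"
  assumes K: "K \<noteq> {}" "bounded K" and e: "0 < e" and W: "subspace W" "K \<subseteq> W"
    and nd: "\<And>x. x \<in> K \<Longrightarrow> x \<in> closure (convex hull (K - ball x e))"
  obtains K' where "bush K' (e / 2)" "K' \<subseteq> W"
proof
  let ?B = "{u\<in>W. norm u < e / 4}"
  let ?K = "{x + u | x u. x \<in> K \<and> u \<in> ?B}"
  show "?K \<subseteq> W" using W by (auto intro: subspace_add)
  show "bush ?K (e / 2)"
    unfolding bush_def
  proof (intro conjI ballI)
    obtain x where "x \<in> K" using K by blast
    then have "x + 0 \<in> ?K" using subspace_0[OF W(1)] e by force
    then show "?K \<noteq> {}" by blast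
    obtain B where B: "\<And>x. x \<in> K \<Longrightarrow> norm x \<le> B" using K(2) by (auto simp: bounded_iff)
    have "norm (x + u) \<le> B + e / 4" if "x \<in> K" "norm u < e / 4" for x u
      using norm_triangle_ineq[of x u] B[OF that(1)] that(2) by linarith
    then show "bounded ?K" unfolding bounded_iff by blast
    show "0 < e / 2" using e by simp
    fix z assume "z \<in> ?K"
    then obtain x u where z: "z = x + u" and x: "x \<in> K" and u: "u \<in> W" "norm u < e / 4" by blast
    obtain y where y: "y \<in> convex hull (K - ball x e)" "dist y x < e / 4 - norm u"
      using nd[OF x] u(2) unfolding closure_approachable by (meson diff_gt_0_iff_gt)
    have yW: "y \<in> W" using y(1) W hull_minimal[of "K - ball x e" W convex] subspace_imp_convex by blast
    \<comment> \<open>The translation that takes \<open>y\<close> to \<open>z\<close> has norm below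
      e / 4, so it maps points of \<open>K\<close> into the thickened set. It preserves distances,
      and every \<open>v\<close> outside \<open>ball x e\<close> has distance at least e - e / 4
      from \<open>y\<close>.\<close>
    have sub: "(\<lambda>v. (u + x - y) + v) ` (K - ball x e) \<subseteq> ?K - ball z (e / 2)"
    proof
      fix w assume "w \<in> (\<lambda>v. (u + x - y) + v) ` (K - ball x e)"
      then obtain v where v: "v \<in> K" "e \<le> dist x v" and w: "w = v + (u + x - y)"
        by (auto simp: algebra_simps)
      have "norm (u + x - y) \<le> norm u + dist y x"
        using norm_triangle_ineq[of u "x - y"] by (simp add: dist_norm norm_minus_commute algebra_simps)
      then have "norm (u + x - y) < e / 4" using y(2) by linarith
      moreover have "u + x - y \<in> W" using u(1) yW W x by (auto intro: subspace_add subspace_diff)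
      ultimately have "w \<in> ?K" using v(1) w by blast
      moreover have "dist x v \<le> dist x y + dist y v" by (rule dist_triangle)
      moreover have "dist z w = dist y v" by (simp add: z w dist_norm)
      ultimately show "w \<in> ?K - ball z (e / 2)" 
        using v(2) y(2) norm_ge_zero[of u] e unfolding dist_commute[of x y] by (simp del: norm_ge_zero)
    qed
    have "(u + x - y) + y \<in> convex hull ((\<lambda>v. (u + x - y) + v) ` (K - ball x e))"
      unfolding convex_hull_translation using y(1) by blast
    then have "z \<in> convex hull ((\<lambda>v. (u + x - y) + v) ` (K - ball x e))" by (simp add: z add.commute)
    then show "z \<in> convex hull (?K - ball z (e / 2))"
      using hull_mono[OF sub] by blast
  qed
qed

section \<open>Densities of vector measures with shrinking averages\<close>

text \<open>Zorn's lemma gives a maximal disjoint family of sets of positive measure with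
  \<open>P\<close>. It is countable because its measures have bounded finite sums. Maximality says
  only that no further such set avoids the union; the applications choose \<open>P\<close> so that
  this controls the complement.\<close>

lemma (in finite_measure) exhaustion:
  fixes P :: "'a set \<Rightarrow> bool"
  shows "\<exists>A :: nat \<Rightarrow> 'a set. disjoint_family A \<and> (\<forall>n. A n \<in> sets M) \<and>
    (\<forall>n. A n \<noteq> {} \<longrightarrow> 0 < measure M (A n) \<and> P (A n)) \<and>
    (\<forall>F\<in>sets M. 0 < measure M F \<longrightarrow> P F \<longrightarrow> F \<inter> (\<Union>n. A n) \<noteq> {})"
proof -
  define Q where "Q = {F \<in> sets M. 0 < measure M F \<and> P F}"
  have "\<exists>C\<in>{C. disjoint C \<and> C \<subseteq> Q}. \<forall>X\<in>{C. disjoint C \<and> C \<subseteq> Q}. C \<subseteq> X \<longrightarrow> X = C"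
  proof (rule subset_Zorn', clarify)
    fix \<C> assume \<C>: "subset.chain {C. disjoint C \<and> C \<subseteq> Q} \<C>"
    then have sub: "\<And>C. C \<in> \<C> \<Longrightarrow> disjoint C \<and> C \<subseteq> Q"
      and tot: "\<And>C D. C \<in> \<C> \<Longrightarrow> D \<in> \<C> \<Longrightarrow> C \<subseteq> D \<or> D \<subseteq> C"
      by (auto simp: subset_chain_def)
    have "disjoint (\<Union>\<C>)"
    proof (rule disjointI)
      fix a b assume "a \<in> \<Union>\<C>" "b \<in> \<Union>\<C>" "a \<noteq> b"
      then obtain C where "C \<in> \<C>" "a \<in> C" "b \<in> C" using tot by (meson UnionE subsetD)
      then show "a \<inter> b = {}" using sub \<open>a \<noteq> b\<close> by (meson disjointD)
    qed
    then show "disjoint (\<Union>\<C>) \<and> \<Union>\<C> \<subseteq> Q" using sub by blast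
  qed
  then obtain C where C': "C \<in> {C. disjoint C \<and> C \<subseteq> Q}"
    and max': "\<forall>X\<in>{C. disjoint C \<and> C \<subseteq> Q}. C \<subseteq> X \<longrightarrow> X = C" by (rule bexE)
  have C: "disjoint C" "C \<subseteq> Q" using C' by auto
  have max: "X = C" if "disjoint X" "X \<subseteq> Q" "C \<subseteq> X" for X
    using max'[rule_format, of X] that by simp
  have "(\<lambda>F. measure M F) summable_on C"
  proof (rule nonneg_bdd_above_summable_on)
    show "bdd_above (sum (measure M) ` {F. F \<subseteq> C \<and> finite F})"
    proof (rule bdd_aboveI2)
      fix F assume F: "F \<in> {F. F \<subseteq> C \<and> finite F}"
      then have "sum (measure M) F = measure M (\<Union>F)"
        using C by (intro finite_measure_finite_Union[of F "\<lambda>x. x", simplified, symmetric])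
          (auto simp: Q_def disjoint_family_on_def dest: disjointD)
      then show "sum (measure M) F \<le> measure M (space M)" by (simp add: bounded_measure)
    qed
  qed simp
  then have "countable {F\<in>C. measure M F \<noteq> 0}"
    by (intro abs_summable_countable) simp
  moreover have "{F\<in>C. measure M F \<noteq> 0} = C" using C(2) by (auto simp: Q_def)
  ultimately have cC: "countable C" by simp
  define A where "A n = \<Union>{F\<in>C. to_nat_on C F = n}" for n
  have A: "A n \<noteq> {} \<Longrightarrow> A n \<in> C" for n
  proof -
    assume "A n \<noteq> {}"
    then obtain F where "F \<in> C" "to_nat_on C F = n" by (auto simp: A_def)
    then have "{F\<in>C. to_nat_on C F = n} = {F}"
      using inj_on_to_nat_on[OF cC] by (auto simp: inj_on_def)
    then show "A n \<in> C" using \<open>F \<in> C\<close> by (simp add: A_def)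
  qed
  have U: "(\<Union>n. A n) = \<Union>C" by (auto simp: A_def)
  show ?thesis
  proof (intro exI[of _ A] conjI allI ballI impI)
    show "disjoint_family A"
    proof (unfold disjoint_family_on_def, intro ballI impI)
      fix i j :: nat assume "i \<noteq> j"
      then show "A i \<inter> A j = {}" using disjointD[OF C(1)] by (force simp: A_def)
    qed
    show "A n \<in> sets M" for n using A[of n] C(2) by (cases "A n = {}") (auto simp: Q_def)
    show "0 < measure M (A n)" "P (A n)" if "A n \<noteq> {}" for n using A[OF that] C(2) by (auto simp: Q_def)
    fix F assume F: "F \<in> sets M" "0 < measure M F" "P F"
    show "F \<inter> (\<Union>n. A n) \<noteq> {}"
    proof (rule notI)
      assume e: "F \<inter> (\<Union>n. A n) = {}"
      have "insert F C = C"
        using F C e U by (intro max) (auto simp: Q_def disjoint_def)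
      then have "F \<subseteq> (\<Union>n. A n)" unfolding U by (intro Union_upper) (metis insertI1)
      then have "F = {}" using e by (simp add: Int_absorb2)
      then show False using F(2) by simp
    qed
  qed
qed

section \<open>Vector measures and their averages\<close>

definition vanishes_on_null :: "'w measure \<Rightarrow> ('w set \<Rightarrow> 'y::real_normed_vector) \<Rightarrow> bool" where
  "vanishes_on_null M G \<longleftrightarrow> (\<forall>E\<in>sets M. measure M E = 0 \<longrightarrow> G E = 0)"

text \<open>This consequence of continuity is what the construction of the density works with; it
  passes at once to compositions with linear maps.\<close>

lemma continuous_wrt_vanishes:
  assumes "continuous_wrt M G" shows "vanishes_on_null M G"
  unfolding vanishes_on_null_def
proof (intro ballI impI)
  fix E assume E: "E \<in> sets M" "measure M E = 0"
  show "G E = 0"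
  proof (rule ccontr)
    assume "G E \<noteq> 0"
    then have "0 < norm (G E)" by simp
    then obtain \<delta> where "\<delta> > 0" "\<forall>F\<in>sets M. measure M F < \<delta> \<longrightarrow> norm (G F) < norm (G E)"
      using assms unfolding continuous_wrt_def by blast
    then show False using E by force
  qed
qed

lemma vector_measure_empty: "vector_measure M G \<Longrightarrow> G {} = 0"
proof -
  assume "vector_measure M G"
  then have "(\<lambda>n. G {}) sums G {}"
    unfolding vector_measure_def
    by (drule_tac spec[of _ "\<lambda>_::nat. {}"]) (auto simp: disjoint_family_on_def)
  then have "(\<lambda>n. G {}) \<longlonglongrightarrow> 0" by (intro summable_LIMSEQ_zero sums_summable)
  then show ?thesis by (simp add: LIMSEQ_const_iff)
qed

lemma vector_measure_sums:
  assumes "vector_measure M G" "disjoint_family A" "\<And>n. A n \<in> sets M"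
  shows "(\<lambda>n. G (A n)) sums G (\<Union>n. A n)"
  using assms unfolding vector_measure_def by blast

lemma vector_measure_Un:
  assumes G: "vector_measure M G" and AB: "A \<in> sets M" "B \<in> sets M" "A \<inter> B = {}"
  shows "G (A \<union> B) = G A + G B"
proof -
  let ?A = "\<lambda>n::nat. if n = 0 then A else if n = 1 then B else {}"
  have 1: "(\<lambda>n. G (?A n)) sums G (\<Union>n. ?A n)"
    using AB by (intro vector_measure_sums[OF G]) (auto simp: disjoint_family_on_def)
  have 2: "(\<Union>n. ?A n) = A \<union> B" by (auto split: if_splits)
  have "(\<lambda>n. G (?A n)) sums (\<Sum>n<2. G (?A n))"
    using vector_measure_empty[OF G] by (intro sums_finite) auto
  from sums_unique2[OF 1[unfolded 2] this] have "G (A \<union> B) = (\<Sum>n<2. G (?A n))" .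
  then show ?thesis by (simp add: numeral_2_eq_2)
qed

lemma vector_measure_sums_exhausting:
  assumes G: "vector_measure M G" "vanishes_on_null M G"
    and A: "disjoint_family A" "\<And>n. A n \<in> sets M" and E: "E \<in> sets M"
    and null: "measure M (E - (\<Union>n. A n)) = 0"
  shows "(\<lambda>n. G (E \<inter> A n)) sums G E"
proof -
  have "(\<lambda>n. G (E \<inter> A n)) sums G (\<Union>n. E \<inter> A n)"
    using A E by (intro vector_measure_sums[OF G(1)]) (auto simp: disjoint_family_on_def)
  moreover have "G ((\<Union>n. E \<inter> A n) \<union> (E - (\<Union>n. A n))) = G (\<Union>n. E \<inter> A n) + G (E - (\<Union>n. A n))"
    using A(2) E by (intro vector_measure_Un[OF G(1)]) auto
  moreover have "G (E - (\<Union>n. A n)) = 0"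
    using G(2) null A(2) E by (auto simp: vanishes_on_null_def)
  moreover have "(\<Union>n. E \<inter> A n) \<union> (E - (\<Union>n. A n)) = E" by auto
  ultimately show ?thesis by simp
qed

lemma (in finite_measure) vector_measure_measure: "vector_measure M (measure M)"
  unfolding vector_measure_def by (auto intro: finite_measure_UNION)

text \<open>Known as the average range of the vector measure on \<open>A\<close>.\<close>

definition averages :: "'w measure \<Rightarrow> ('w set \<Rightarrow> 'y::real_normed_vector) \<Rightarrow> 'w set \<Rightarrow> 'y set" where
  "averages M G A = {G F /\<^sub>R measure M F | F. F \<in> sets M \<and> F \<subseteq> A \<and> 0 < measure M F}"

text \<open>Let \<open>x\<close> be the average over \<open>E\<close>. Exhaust \<open>E\<close> by
  disjoint sets whose averages lie outside \<open>ball x e\<close>. If the remainder has positive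
  measure, all its averages lie in the ball. If it is null, \<open>x\<close> is a limit of convex
  combinations of the bad averages, which the hypothesis on \<open>x\<close> forbids.\<close>

lemma (in finite_measure) small_averages_subset:
  fixes G :: "'a set \<Rightarrow> 'y::real_normed_vector"
  assumes G: "vector_measure M G" "vanishes_on_null M G"
    and x: "x \<in> averages M G A" "x \<notin> closure (convex hull (averages M G A - ball x e))"
  obtains B where "B \<in> sets M" "B \<subseteq> A" "0 < measure M B" "averages M G B \<subseteq> ball x e"
proof -
  let ?S = "averages M G A - ball x e"
  obtain E where E: "E \<in> sets M" "E \<subseteq> A" "0 < measure M E" and xE: "x = G E /\<^sub>R measure M E"
    using x(1) unfolding averages_def by blast
  from exhaustion[of "\<lambda>F. F \<subseteq> E \<and> G F /\<^sub>R measure M F \<notin> ball x e"]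
  obtain D :: "nat \<Rightarrow> 'a set" where D: "disjoint_family D" "\<And>n. D n \<in> sets M"
    "\<And>n. D n \<noteq> {} \<Longrightarrow> 0 < measure M (D n) \<and> D n \<subseteq> E \<and> G (D n) /\<^sub>R measure M (D n) \<notin> ball x e"
    and max: "\<And>F. F \<in> sets M \<Longrightarrow> 0 < measure M F \<Longrightarrow> F \<subseteq> E \<and> G F /\<^sub>R measure M F \<notin> ball x e
       \<Longrightarrow> F \<inter> (\<Union>n. D n) \<noteq> {}"
    by (elim exE conjE) simp
  let ?R = "E - (\<Union>n. D n)"
  have R: "?R \<in> sets M" using E D(2) by auto
  show thesis
  proof (cases "0 < measure M ?R")
    case True
    have "averages M G ?R \<subseteq> ball x e"
    proof
      fix y assume "y \<in> averages M G ?R"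
      then obtain F where "F \<in> sets M" "F \<subseteq> ?R" "0 < measure M F" "y = G F /\<^sub>R measure M F"
        unfolding averages_def by blast
      then show "y \<in> ball x e" using max[of F] by (cases "y \<in> ball x e") auto
    qed
    then show thesis using that[OF R _ True] E(2) by blast
  next
    case False
    then have null: "measure M ?R = 0" by (simp add: zero_less_measure_iff)
    have inD: "E \<inter> D n = D n" for n using D(3)[of n] by blast
    have sG: "(\<lambda>n. \<Sum>i<n. G (D i)) \<longlonglongrightarrow> G E"
      using vector_measure_sums_exhausting[OF G D(1,2) E(1) null] by (simp add: inD sums_def)
    have "vanishes_on_null M (measure M)" by (simp add: vanishes_on_null_def)
    then have s\<mu>: "(\<lambda>n. \<Sum>i<n. measure M (D i)) \<longlonglongrightarrow> measure M E"
      using vector_measure_sums_exhausting[OF vector_measure_measure _ D(1,2) E(1) null]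
      by (simp add: inD sums_def)
    have lim: "(\<lambda>n. (\<Sum>i<n. G (D i)) /\<^sub>R (\<Sum>i<n. measure M (D i))) \<longlonglongrightarrow> x"
      unfolding xE using E(3) by (intro tendsto_scaleR sG tendsto_inverse s\<mu>) auto
    have "\<forall>\<^sub>F n in sequentially. 0 < (\<Sum>i<n. measure M (D i))"
      using order_tendstoD(1)[OF s\<mu> E(3)] .
    then have ev: "\<forall>\<^sub>F n in sequentially. (\<Sum>i<n. G (D i)) /\<^sub>R (\<Sum>i<n. measure M (D i)) \<in> closure (convex hull ?S)"
    proof eventually_elim
      fix n assume pos: "0 < (\<Sum>i<n. measure M (D i))"
      \<comment> \<open>Non-empty members have positive measure, so their averages are defined; the
        weights are their shares of the partial sum \<open>?m\<close>.\<close>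
      let ?I = "{i\<in>{..<n}. D i \<noteq> {}}" and ?m = "\<Sum>i<n. measure M (D i)"
      have eq: "(\<Sum>i<n. G (D i)) = (\<Sum>i\<in>?I. G (D i))" "?m = (\<Sum>i\<in>?I. measure M (D i))"
        using vector_measure_empty[OF G(1)] by (intro sum.mono_neutral_right; force)+
      have "(\<Sum>i\<in>?I. (measure M (D i) / ?m) *\<^sub>R (G (D i) /\<^sub>R measure M (D i))) \<in> convex hull ?S"
      proof (rule convex_sum)
        show "(\<Sum>i\<in>?I. measure M (D i) / ?m) = 1"
          using pos eq(2) by (simp flip: sum_divide_distrib)
        show "G (D i) /\<^sub>R measure M (D i) \<in> convex hull ?S" if "i \<in> ?I" for i
        proof (rule hull_inc)
          show "G (D i) /\<^sub>R measure M (D i) \<in> ?S"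
            using D(2)[of i] D(3)[of i] E(2) that unfolding averages_def by blast
        qed
      qed (use pos in \<open>auto intro: divide_nonneg_pos\<close>)
      moreover have "(measure M (D i) / ?m) *\<^sub>R (G (D i) /\<^sub>R measure M (D i)) = G (D i) /\<^sub>R ?m" if "i \<in> ?I" for i
        using D(3)[of i] that by (simp add: field_simps)
      then have "(\<Sum>i\<in>?I. (measure M (D i) / ?m) *\<^sub>R (G (D i) /\<^sub>R measure M (D i))) = (\<Sum>i\<in>?I. G (D i) /\<^sub>R ?m)"
        by (intro sum.cong) auto
      ultimately have "(\<Sum>i\<in>?I. G (D i) /\<^sub>R ?m) \<in> convex hull ?S" by (simp only:)
      then have "(\<Sum>i<n. G (D i)) /\<^sub>R ?m \<in> convex hull ?S" by (simp add: eq(1) scaleR_right.sum)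
      then show "(\<Sum>i<n. G (D i)) /\<^sub>R ?m \<in> closure (convex hull ?S)" using closure_subset by blast
    qed
    have "x \<in> closure (convex hull ?S)"
      by (rule Lim_in_closed_set[OF closed_closure ev _ lim]) simp
    with x(2) show thesis by blast
  qed
qed

text \<open>Bounded variation speaks of finite partitions of the whole space. The remainder
  completes the sets to such a partition, and empty sets are left out to make the enumeration
  injective.\<close>

lemma disjoint_sum_le_variation:
  fixes A :: "nat \<Rightarrow> 'w set"
  assumes V: "\<forall>P. finite P \<longrightarrow> P \<subseteq> sets M \<longrightarrow> disjoint P \<longrightarrow> \<Union>P = space M \<longrightarrow> (\<Sum>E\<in>P. norm (G E)) \<le> V"
    and A: "disjoint_family A" "\<And>n. A n \<in> sets M" and G0: "G {} = 0"
  shows "(\<Sum>i<n. norm (G (A i))) \<le> V"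
proof -
  let ?I = "{i\<in>{..<n}. A i \<noteq> {}}"
  let ?R = "space M - (\<Union>i\<in>?I. A i)"
  have dj: "A i \<inter> A j = {}" if "i \<noteq> j" for i j using A(1) that by (auto simp: disjoint_family_on_def)
  have inj: "inj_on A ?I" using dj by (intro inj_onI) force
  have "(\<Sum>i<n. norm (G (A i))) = (\<Sum>i\<in>?I. norm (G (A i)))"
    by (rule sum.mono_neutral_right) (auto simp: G0)
  also have "\<dots> = (\<Sum>E\<in>A ` ?I. norm (G E))" using inj by (simp add: sum.reindex)
  also have "\<dots> \<le> (\<Sum>E\<in>insert ?R (A ` ?I). norm (G E))" by (rule sum_mono2) (simp_all, auto)
  also have "\<dots> \<le> V"
  proof (rule V[rule_format])
    show "insert ?R (A ` ?I) \<subseteq> sets M" using A(2) by auto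
    show "disjoint (insert ?R (A ` ?I))"
    proof (rule disjointI)
      fix a b assume "a \<in> insert ?R (A ` ?I)" "b \<in> insert ?R (A ` ?I)" "a \<noteq> b"
      then consider "a = ?R" "b \<in> A ` ?I" | "b = ?R" "a \<in> A ` ?I" | i j where "a = A i" "b = A j" "i \<noteq> j"
        by (elim insertE imageE) auto
      then show "a \<inter> b = {}" by cases (use dj in auto)
    qed
    have "(\<Union>i\<in>?I. A i) \<subseteq> space M" using sets.sets_into_space[OF A(2)] by (rule UN_least)
    then show "\<Union>(insert ?R (A ` ?I)) = space M" by auto
    show "finite (insert ?R (A ` ?I))" by (intro finite.insertI finite_imageI) simp
  qed
  finally show ?thesis .
qed

lemma (in finite_measure) locally_bounded_averages:
  fixes G :: "'a set \<Rightarrow> 'y::real_normed_vector"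
  assumes G: "vector_measure M G" "vanishes_on_null M G" "bounded_variation M G"
    and A: "A \<in> sets M" "0 < measure M A"
  obtains B where "B \<in> sets M" "B \<subseteq> A" "0 < measure M B" "bounded (averages M G B)"
proof -
  obtain V where V: "\<forall>P. finite P \<longrightarrow> P \<subseteq> sets M \<longrightarrow> disjoint P \<longrightarrow> \<Union>P = space M \<longrightarrow> (\<Sum>E\<in>P. norm (G E)) \<le> V"
    using G(3) unfolding bounded_variation_def ..
  \<comment> \<open>Chosen so that C * measure M A = V + measure M A exceeds the variation bound;
    hence sets with averages larger than \<open>C\<close> cannot exhaust \<open>A\<close>.\<close>
  define C where "C = V / measure M A + 1"
  from exhaustion[of "\<lambda>F. F \<subseteq> A \<and> C * measure M F < norm (G F)"]
  obtain D :: "nat \<Rightarrow> 'a set" where D: "disjoint_family D" "\<And>n. D n \<in> sets M"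
    "\<And>n. D n \<noteq> {} \<Longrightarrow> 0 < measure M (D n) \<and> D n \<subseteq> A \<and> C * measure M (D n) < norm (G (D n))"
    and max: "\<And>F. F \<in> sets M \<Longrightarrow> 0 < measure M F \<Longrightarrow> F \<subseteq> A \<and> C * measure M F < norm (G F)
       \<Longrightarrow> F \<inter> (\<Union>n. D n) \<noteq> {}"
    by (elim exE conjE) simp
  let ?R = "A - (\<Union>n. D n)"
  have R: "?R \<in> sets M" using A D(2) by auto
  have "0 < measure M ?R"
  proof (rule ccontr)
    assume "\<not> 0 < measure M ?R"
    then have null: "measure M ?R = 0" by (simp add: zero_less_measure_iff)
    have inD: "A \<inter> D n = D n" for n using D(3)[of n] by blast
    have "vanishes_on_null M (measure M)" by (simp add: vanishes_on_null_def)
    then have s\<mu>: "(\<lambda>n. \<Sum>i<n. measure M (D i)) \<longlonglongrightarrow> measure M A"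
      using vector_measure_sums_exhausting[OF vector_measure_measure _ D(1,2) A(1) null]
      by (simp add: inD sums_def)
    have le: "C * (\<Sum>i<n. measure M (D i)) \<le> V" for n
    proof -
      have "C * (\<Sum>i<n. measure M (D i)) \<le> (\<Sum>i<n. norm (G (D i)))"
        unfolding sum_distrib_left
      proof (rule sum_mono)
        fix i show "C * measure M (D i) \<le> norm (G (D i))" using D(3)[of i] by (cases "D i = {}") auto
      qed
      also have "\<dots> \<le> V" by (rule disjoint_sum_le_variation[OF V D(1,2) vector_measure_empty[OF G(1)]])
      finally show ?thesis .
    qed
    have "C * measure M A \<le> V"
      by (rule LIMSEQ_le_const2[OF tendsto_mult_left[OF s\<mu>]]) (use le in auto)
    then show False using A(2) by (simp add: C_def distrib_right)
  qed
  moreover have "bounded (averages M G ?R)"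
  proof (rule boundedI)
    fix y assume "y \<in> averages M G ?R"
    then obtain F where F: "F \<in> sets M" "F \<subseteq> ?R" "0 < measure M F" "y = G F /\<^sub>R measure M F"
      unfolding averages_def by blast
    then have "\<not> C * measure M F < norm (G F)" using max[of F] by auto
    then show "norm y \<le> C" using F(3,4) by (simp add: field_simps)
  qed
  ultimately show thesis using that[OF R] by blast
qed

lemma averages_mono: "B \<subseteq> A \<Longrightarrow> averages M G B \<subseteq> averages M G A"
  unfolding averages_def by blast

lemma vector_measure_linear:
  assumes "bounded_linear T" "vector_measure M G"
  shows "vector_measure M (\<lambda>E. T (G E))"
  using assms(2) bounded_linear.sums[OF assms(1)] unfolding vector_measure_def by simp

lemma averages_linear:
  assumes "linear T"
  shows "averages M (\<lambda>E. T (G E)) A = T ` averages M G A"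
proof -
  have "T (G F /\<^sub>R measure M F) = T (G F) /\<^sub>R measure M F" for F
    by (rule linear_scale[OF assms])
  then have "averages M (\<lambda>E. T (G E)) A = {T (G F /\<^sub>R measure M F) |F. F \<in> sets M \<and> F \<subseteq> A \<and> 0 < measure M F}"
    unfolding averages_def by simp
  then show ?thesis unfolding averages_def image_Collect by auto
qed

section \<open>Densities as limits of countably valued functions\<close>

definition averages_shrink :: "'w measure \<Rightarrow> ('w set \<Rightarrow> 'y::real_normed_vector) \<Rightarrow> bool" where
  "averages_shrink M G \<longleftrightarrow> (\<forall>A\<in>sets M. 0 < measure M A \<longrightarrow>
     (\<forall>e>0. \<exists>B x. B \<in> sets M \<and> B \<subseteq> A \<and> 0 < measure M B \<and> averages M G B \<subseteq> ball x e))"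

text \<open>The sets may overlap and the values may coincide, so the level sets of the sum are
  unwieldy. The integral is instead built by linearity from a single real indicator.\<close>

lemma simple_bochner_integral_indicator_sum:
  fixes x :: "'i \<Rightarrow> 'y::real_normed_vector"
  assumes "finite I" "\<And>i. i \<in> I \<Longrightarrow> A i \<in> sets M" "\<And>i. i \<in> I \<Longrightarrow> emeasure M (A i) < \<infinity>"
  shows "Bochner_Integration.simple_bochner_integrable M (\<lambda>w. \<Sum>i\<in>I. indicator (A i) w *\<^sub>R x i)"
    "Bochner_Integration.simple_bochner_integral M (\<lambda>w. \<Sum>i\<in>I. indicator (A i) w *\<^sub>R x i)
       = (\<Sum>i\<in>I. measure M (A i) *\<^sub>R x i)"
proof -
  have one: "Bochner_Integration.simple_bochner_integrable M (indicator B :: _ \<Rightarrow> real)"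
    "Bochner_Integration.simple_bochner_integral M (indicator B :: _ \<Rightarrow> real) = measure M B"
    if B: "B \<in> sets M" "emeasure M B < \<infinity>" for B
  proof -
    have eq: "{w \<in> space M. indicator B w = (1::real)} = B" "{w \<in> space M. indicator B w \<noteq> (0::real)} = B"
      using sets.sets_into_space[OF B(1)] by (auto simp: indicator_def)
    show *: "Bochner_Integration.simple_bochner_integrable M (indicator B :: _ \<Rightarrow> real)"
      using B by (intro Bochner_Integration.simple_bochner_integrable.intros) (auto simp: eq)
    have "Bochner_Integration.simple_bochner_integral M (indicator B :: _ \<Rightarrow> real) =
      (\<Sum>y\<in>indicator B ` space M. measure M {w\<in>space M. indicator B w = y} *\<^sub>R (y::real))"
      unfolding Bochner_Integration.simple_bochner_integral_def ..
    also have "\<dots> = (\<Sum>y\<in>{0, 1}. measure M {w\<in>space M. indicator B w = y} *\<^sub>R (y::real))"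
    proof (rule sum.mono_neutral_left)
      show "indicator B ` space M \<subseteq> {0, 1::real}" by (auto simp: indicator_def)
      show "\<forall>y\<in>{0, 1} - indicator B ` space M. measure M {w\<in>space M. indicator B w = y} *\<^sub>R (y::real) = 0"
      proof
        fix y :: real assume "y \<in> {0, 1} - indicator B ` space M"
        then have "{w\<in>space M. indicator B w = y} = {}" by auto
        then show "measure M {w\<in>space M. indicator B w = y} *\<^sub>R y = 0" by (metis measure_empty scaleR_zero_left)
      qed
    qed simp
    also have "\<dots> = measure M B" by (simp add: eq)
    finally show "Bochner_Integration.simple_bochner_integral M (indicator B :: _ \<Rightarrow> real) = measure M B" .
  qed
  have onex: "Bochner_Integration.simple_bochner_integrable M (\<lambda>w. (indicator B w :: real) *\<^sub>R y)"
    "Bochner_Integration.simple_bochner_integral M (\<lambda>w. (indicator B w :: real) *\<^sub>R y) = measure M B *\<^sub>R y"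
    if B: "B \<in> sets M" "emeasure M B < \<infinity>" for B and y :: 'y
  proof -
    show "Bochner_Integration.simple_bochner_integrable M (\<lambda>w. (indicator B w :: real) *\<^sub>R y)"
      using Bochner_Integration.simple_bochner_integrable_compose2[of "\<lambda>a b. a *\<^sub>R y", OF _ one(1)[OF B] one(1)[OF B]]
      by simp
    have "linear (\<lambda>r::real. r *\<^sub>R y)" by (intro linearI) (auto simp: algebra_simps)
    from Bochner_Integration.simple_bochner_integral_linear[OF this one(1)[OF B]]
    show "Bochner_Integration.simple_bochner_integral M (\<lambda>w. (indicator B w :: real) *\<^sub>R y) = measure M B *\<^sub>R y"
      by (simp add: one(2)[OF B])
  qed
  have zero: "Bochner_Integration.simple_bochner_integrable M (\<lambda>w. 0::'y)"
    "Bochner_Integration.simple_bochner_integral M (\<lambda>w. 0::'y) = 0"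
    using onex[of "{}" 0] by auto
  have "Bochner_Integration.simple_bochner_integrable M (\<lambda>w. \<Sum>i\<in>I. indicator (A i) w *\<^sub>R x i) \<and>
    Bochner_Integration.simple_bochner_integral M (\<lambda>w. \<Sum>i\<in>I. indicator (A i) w *\<^sub>R x i)
       = (\<Sum>i\<in>I. measure M (A i) *\<^sub>R x i)"
    using assms
  proof (induction I)
    case (insert i I)
    have 1: "Bochner_Integration.simple_bochner_integrable M (\<lambda>w. (indicator (A i) w :: real) *\<^sub>R x i)"
      "Bochner_Integration.simple_bochner_integral M (\<lambda>w. (indicator (A i) w :: real) *\<^sub>R x i) = measure M (A i) *\<^sub>R x i"
      using insert.prems by (auto intro!: onex)
    have 2: "Bochner_Integration.simple_bochner_integrable M (\<lambda>w. \<Sum>i\<in>I. (indicator (A i) w :: real) *\<^sub>R x i)"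
      "Bochner_Integration.simple_bochner_integral M (\<lambda>w. \<Sum>i\<in>I. (indicator (A i) w :: real) *\<^sub>R x i)
       = (\<Sum>i\<in>I. measure M (A i) *\<^sub>R x i)"
      using insert by blast+
    show ?case
      unfolding sum.insert[OF insert.hyps] Bochner_Integration.simple_bochner_integral_add[OF 1(1) 2(1)] 1(2) 2(2)
      using Bochner_Integration.simple_bochner_integrable_compose2[where p = "\<lambda>a b. a + b", OF _ 1(1) 2(1)] by simp
  qed (simp add: zero)
  then show "Bochner_Integration.simple_bochner_integrable M (\<lambda>w. \<Sum>i\<in>I. indicator (A i) w *\<^sub>R x i)"
    "Bochner_Integration.simple_bochner_integral M (\<lambda>w. \<Sum>i\<in>I. indicator (A i) w *\<^sub>R x i)
       = (\<Sum>i\<in>I. measure M (A i) *\<^sub>R x i)" by auto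
qed

lemma has_bochner_integral'_cong:
  assumes "\<And>w. w \<in> space M \<Longrightarrow> f w = g w"
  shows "has_bochner_integral' M f x \<longleftrightarrow> has_bochner_integral' M g x"
proof -
  have "(\<integral>\<^sup>+w. ennreal (norm (f w - s w)) \<partial>M) = (\<integral>\<^sup>+w. ennreal (norm (g w - s w)) \<partial>M)" for s
    by (rule nn_integral_cong) (simp add: assms)
  moreover have "f \<in> borel_measurable M \<longleftrightarrow> g \<in> borel_measurable M"
    by (rule measurable_cong) (simp add: assms)
  ultimately show ?thesis unfolding has_bochner_integral'_def by simp
qed

text \<open>\<open>A\<close> and \<open>x\<close> describe a countably valued approximation of the density \<open>g\<close>, with finite
  truncations as the simple functions.\<close>

lemma (in finite_measure) has_bochner_integral'_countably_valued:
  fixes G :: "'a set \<Rightarrow> 'y::banach" and x :: "nat \<Rightarrow> nat \<Rightarrow> 'y"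
  assumes G: "vector_measure M G" "vanishes_on_null M G"
    and V: "\<forall>P. finite P \<longrightarrow> P \<subseteq> sets M \<longrightarrow> disjoint P \<longrightarrow> \<Union>P = space M \<longrightarrow> (\<Sum>E\<in>P. norm (G E)) \<le> V"
    and A: "\<And>n. disjoint_family (A n)" "\<And>n i. A n i \<in> sets M"
      "\<And>n. measure M (space M - (\<Union>i. A n i)) = 0"
    and x: "\<And>n i F. F \<in> sets M \<Longrightarrow> F \<subseteq> A n i \<Longrightarrow> norm (G F - measure M F *\<^sub>R x n i) \<le> e n * measure M F"
    and e: "\<And>n. 0 \<le> e n" "e \<longlonglongrightarrow> 0"
    and g: "g \<in> borel_measurable M" "AE w in M. \<forall>n i. w \<in> A n i \<longrightarrow> norm (g w - x n i) \<le> e n"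
    and E: "E \<in> sets M"
  shows "has_bochner_integral' M (\<lambda>w. if w \<in> E then g w else 0) (G E)"
proof -
  let ?\<mu> = "measure M"
  have s\<mu>: "summable (\<lambda>i. ?\<mu> (A n i))" for n
    using finite_measure_UNION[of "A n"] A by (auto intro: sums_summable)
  \<comment> \<open>The values \<open>x n i\<close> need not be bounded; summability comes from
    bounded variation, as each term exceeds the norm of \<open>G (A n i)\<close> by at most the
    error e n * measure.\<close>
  have sx: "summable (\<lambda>i. ?\<mu> (A n i) * norm (x n i))" for n
  proof (rule summable_comparison_test'[of _ 0])
    have "summable (\<lambda>i. norm (G (A n i)))"
    proof (rule bounded_imp_summable[of _ V])
      show "(\<Sum>i\<le>k. norm (G (A n i))) \<le> V" for k
        using disjoint_sum_le_variation[OF V A(1) A(2) vector_measure_empty[OF G(1)], where n = "Suc k"]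
        by (simp only: lessThan_Suc_atMost)
    qed simp
    then show "summable (\<lambda>i. norm (G (A n i)) + e n * ?\<mu> (A n i))"
      using s\<mu> by (intro summable_add summable_mult)
    fix i
    have "norm (?\<mu> (A n i) *\<^sub>R x n i) \<le> norm (G (A n i)) + norm (G (A n i) - ?\<mu> (A n i) *\<^sub>R x n i)"
      using norm_triangle_ineq4[of "G (A n i)" "G (A n i) - ?\<mu> (A n i) *\<^sub>R x n i"] by simp
    then show "norm (?\<mu> (A n i) * norm (x n i)) \<le> norm (G (A n i)) + e n * ?\<mu> (A n i)"
      using x[of "A n i" n i] A(2) by simp
  qed
  have null: "?\<mu> (E - (\<Union>i. A n i)) = 0" for n
  proof -
    have "?\<mu> (E - (\<Union>i. A n i)) \<le> ?\<mu> (space M - (\<Union>i. A n i))"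
      using A(2) sets.sets_into_space[OF E] by (intro finite_measure_mono) auto
    then show ?thesis using A(3)[of n] by (simp add: measure_le_0_iff)
  qed
  have sG: "(\<lambda>i. G (E \<inter> A n i)) sums G E" for n
    by (rule vector_measure_sums_exhausting[OF G A(1) A(2) E null])
  \<comment> \<open>One truncation index makes two tails small: that of the approximation in the L1
    norm and that of the series for \<open>G E\<close>.\<close>
  have "\<exists>J. (\<Sum>i. ?\<mu> (A n (i + J)) * norm (x n (i + J))) < 1 / Suc n \<and> norm ((\<Sum>i<J. G (E \<inter> A n i)) - G E) < 1 / Suc n" for n
  proof -
    have "(\<lambda>J. \<Sum>i. ?\<mu> (A n (i + J)) * norm (x n (i + J))) \<longlonglongrightarrow> 0"
      using sx[of n] by (rule suminf_exist_split2)
    then have "\<forall>\<^sub>F J in sequentially. (\<Sum>i. ?\<mu> (A n (i + J)) * norm (x n (i + J))) < 1 / Suc n"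
      by (rule order_tendstoD) simp
    moreover have "\<forall>\<^sub>F J in sequentially. norm ((\<Sum>i<J. G (E \<inter> A n i)) - G E) < 1 / Suc n"
      using tendstoD[OF sG[of n, unfolded sums_def], of "1 / Suc n"] by (simp add: dist_norm)
    ultimately have "\<forall>\<^sub>F J in sequentially. (\<Sum>i. ?\<mu> (A n (i + J)) * norm (x n (i + J))) < 1 / Suc n \<and>
        norm ((\<Sum>i<J. G (E \<inter> A n i)) - G E) < 1 / Suc n"
      by eventually_elim simp
    then show ?thesis by (auto simp: eventually_sequentially)
  qed
  then have "\<forall>n. \<exists>J. (\<Sum>i. ?\<mu> (A n (i + J)) * norm (x n (i + J))) < 1 / Suc n \<and> norm ((\<Sum>i<J. G (E \<inter> A n i)) - G E) < 1 / Suc n" ..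
  from choice[OF this] obtain J where "\<forall>n. (\<Sum>i. ?\<mu> (A n (i + J n)) * norm (x n (i + J n))) < 1 / Suc n \<and>
      norm ((\<Sum>i<J n. G (E \<inter> A n i)) - G E) < 1 / Suc n" ..
  then have J1: "(\<Sum>i. ?\<mu> (A n (i + J n)) * norm (x n (i + J n))) < 1 / Suc n"
    and J2: "norm ((\<Sum>i<J n. G (E \<inter> A n i)) - G E) < 1 / Suc n" for n by auto
  define s where "s n w = (\<Sum>i\<in>{..<J n}. indicator (E \<inter> A n i) w *\<^sub>R x n i)" for n w
  have fin: "E \<inter> A n i \<in> sets M" "emeasure M (E \<inter> A n i) < \<infinity>" for n i
    using E A(2) by (auto simp: less_top[symmetric])
  have s1: "Bochner_Integration.simple_bochner_integrable M (s n)" for n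
    unfolding s_def using fin by (intro simple_bochner_integral_indicator_sum) auto
  have s2: "Bochner_Integration.simple_bochner_integral M (s n) = (\<Sum>i<J n. ?\<mu> (E \<inter> A n i) *\<^sub>R x n i)" for n
    unfolding s_def using fin by (intro simple_bochner_integral_indicator_sum) auto
  have lim: "(\<lambda>n. e n * ?\<mu> (space M) + 1 / Suc n) \<longlonglongrightarrow> 0"
  proof -
    have "(\<lambda>n. e n * ?\<mu> (space M) + 1 / Suc n) \<longlonglongrightarrow> 0 * ?\<mu> (space M) + 0"
      using LIMSEQ_inverse_real_of_nat by (intro tendsto_add tendsto_mult e(2) tendsto_const) (simp add: inverse_eq_divide)
    then show ?thesis by simp
  qed
  have bound: "(\<integral>\<^sup>+w. ennreal (norm ((if w \<in> E then g w else 0) - s n w)) \<partial>M)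
      \<le> ennreal (e n * ?\<mu> (space M) + 1 / Suc n)" for n
  proof -
    have "AE w in M. w \<notin> space M - (\<Union>i. A n i)"
      using A(2,3)[of n] by (intro AE_not_in) (auto simp: null_sets_def emeasure_eq_measure)
    then have "AE w in M. ennreal (norm ((if w \<in> E then g w else 0) - s n w)) \<le>
       ennreal (e n) + (\<Sum>i. ennreal (norm (x n (i + J n))) * indicator (A n (i + J n)) w)"
      using g(2) AE_space
    proof eventually_elim
      fix w assume "w \<notin> space M - (\<Union>i. A n i)" "w \<in> space M" and gw: "\<forall>n i. w \<in> A n i \<longrightarrow> norm (g w - x n i) \<le> e n"
      then obtain i where i: "w \<in> A n i" by blast
      have uniq: "w \<in> A n j \<longleftrightarrow> j = i" for j
        using A(1)[of n] i by (auto simp: disjoint_family_on_def)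
      have sw: "s n w = (if w \<in> E \<and> i < J n then x n i else 0)"
      proof -
        have "s n w = (\<Sum>j<J n. if j = i then indicator E w *\<^sub>R x n i else 0)"
          unfolding s_def by (rule sum.cong) (auto simp: indicator_def uniq)
        then show ?thesis by (simp add: indicator_def)
      qed
      show "ennreal (norm ((if w \<in> E then g w else 0) - s n w)) \<le>
       ennreal (e n) + (\<Sum>i. ennreal (norm (x n (i + J n))) * indicator (A n (i + J n)) w)" (is "_ \<le> _ + ?T")
      \<comment> \<open>Within \<open>E\<close> but beyond the truncation index \<open>s n w\<close>
        is zero, so the tail \<open>?T\<close> has to pay for \<open>x n i\<close>. Elsewhere the
        error is at most \<open>e n\<close>.\<close>
      proof (cases "w \<in> E \<and> \<not> i < J n")
        case True
        have "ennreal (norm (x n (i - J n + J n))) * indicator (A n (i - J n + J n)) w \<le> ?T"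
          using sum_le_suminf[of "\<lambda>i. ennreal (norm (x n (i + J n))) * indicator (A n (i + J n)) w" "{i - J n}"]
          by (simp only: sum.insert finite.emptyI finite.insertI empty_iff not_False_eq_True sum.empty
              add_0_right summableI simp_thms zero_le)
        then have T: "ennreal (norm (x n i)) \<le> ?T" using True i by simp
        have "norm (g w) \<le> e n + norm (x n i)"
          using gw i norm_triangle_sub[of "g w" "x n i"] by fastforce
        then have "ennreal (norm (g w)) \<le> ennreal (e n) + ennreal (norm (x n i))"
          using e(1) by (simp flip: ennreal_plus)
        also have "\<dots> \<le> ennreal (e n) + ?T" using T by (intro add_left_mono)
        finally show ?thesis using True sw by simp
      next
        case False
        then have "norm ((if w \<in> E then g w else 0) - s n w) \<le> e n"
          using gw i sw e(1) by auto
        then show ?thesis by (meson add_increasing2 ennreal_leI zero_le)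
      qed
    qed
    then have "(\<integral>\<^sup>+w. ennreal (norm ((if w \<in> E then g w else 0) - s n w)) \<partial>M) \<le>
      (\<integral>\<^sup>+w. ennreal (e n) + (\<Sum>i. ennreal (norm (x n (i + J n))) * indicator (A n (i + J n)) w) \<partial>M)"
      by (rule nn_integral_mono_AE)
    also have "\<dots> = ennreal (e n) * emeasure M (space M) + (\<Sum>i. ennreal (norm (x n (i + J n))) * emeasure M (A n (i + J n)))"
      using A(2) by (simp add: nn_integral_add nn_integral_suminf nn_integral_cmult_indicator)
    also have "(\<Sum>i. ennreal (norm (x n (i + J n))) * emeasure M (A n (i + J n))) =
        (\<Sum>i. ennreal (?\<mu> (A n (i + J n)) * norm (x n (i + J n))))"
      by (simp add: emeasure_eq_measure mult.commute flip: ennreal_mult)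
    also have "\<dots> = ennreal (\<Sum>i. ?\<mu> (A n (i + J n)) * norm (x n (i + J n)))"
      using sx[of n] by (intro suminf_ennreal2) (auto intro: summable_ignore_initial_segment)
    also have "ennreal (e n) * emeasure M (space M) + \<dots> \<le> ennreal (e n * ?\<mu> (space M)) + ennreal (1 / Suc n)"
      using J1[of n] e(1) by (intro add_mono) (auto simp: emeasure_eq_measure ennreal_mult intro: ennreal_leI less_imp_le)
    also have "\<dots> = ennreal (e n * ?\<mu> (space M) + 1 / Suc n)"
      using e(1) by (intro ennreal_plus[symmetric]) auto
    finally show ?thesis .
  qed
  show ?thesis
    unfolding has_bochner_integral'_def
  proof (intro conjI exI allI)
    show "(\<lambda>w. if w \<in> E then g w else 0) \<in> borel_measurable M"
      using g(1) E by (intro measurable_If_set) auto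
    show "Bochner_Integration.simple_bochner_integrable M (s n)" for n by (rule s1)
    show "(\<lambda>n. \<integral>\<^sup>+w. ennreal (norm ((if w \<in> E then g w else 0) - s n w)) \<partial>M) \<longlonglongrightarrow> 0"
    proof (rule tendsto_sandwich[OF _ _ tendsto_const])
      show "(\<lambda>n. ennreal (e n * ?\<mu> (space M) + 1 / Suc n)) \<longlonglongrightarrow> 0"
        using tendsto_ennrealI[OF lim] by simp
    qed (use bound in auto)
    show "(\<lambda>n. Bochner_Integration.simple_bochner_integral M (s n)) \<longlonglongrightarrow> G E"
    proof (rule Lim_null_comparison[THEN LIM_zero_cancel], rule always_eventually, rule allI)
      show "(\<lambda>n. e n * ?\<mu> (space M) + 1 / Suc n) \<longlonglongrightarrow> 0" by (rule lim)
      fix n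
      have "norm (Bochner_Integration.simple_bochner_integral M (s n) - G E) \<le>
         norm ((\<Sum>i<J n. G (E \<inter> A n i)) - G E) + norm (\<Sum>i<J n. G (E \<inter> A n i) - ?\<mu> (E \<inter> A n i) *\<^sub>R x n i)"
        unfolding s2 sum_subtractf
        using dist_triangle[of "\<Sum>i<J n. ?\<mu> (E \<inter> A n i) *\<^sub>R x n i" "G E" "\<Sum>i<J n. G (E \<inter> A n i)"]
        by (simp add: dist_norm norm_minus_commute)
      also have "norm (\<Sum>i<J n. G (E \<inter> A n i) - ?\<mu> (E \<inter> A n i) *\<^sub>R x n i) \<le> (\<Sum>i<J n. e n * ?\<mu> (E \<inter> A n i))"
        using fin by (intro sum_norm_le x) auto
      also have "\<dots> = e n * ?\<mu> (\<Union>i<J n. E \<inter> A n i)"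
      proof -
        have "disjoint_family_on (\<lambda>i. E \<inter> A n i) {..<J n}"
          using A(1)[of n] unfolding disjoint_family_on_def by blast
        then have "?\<mu> (\<Union>i<J n. E \<inter> A n i) = (\<Sum>i<J n. ?\<mu> (E \<inter> A n i))"
          using fin by (intro finite_measure_finite_Union) auto
        then show ?thesis by (simp add: sum_distrib_left)
      qed
      also have "\<dots> \<le> e n * ?\<mu> (space M)"
        using e(1) by (intro mult_left_mono bounded_measure)
      finally show "norm (Bochner_Integration.simple_bochner_integral M (s n) - G E) \<le> e n * ?\<mu> (space M) + 1 / Suc n"
        using J2[of n] by linarith
    qed
  qed
qed

text \<open>The exhausting family consists of sets whose averages lie in one ball of radius
  \<open>e\<close>. A remainder of positive measure would contain a further such set.\<close>

lemma averages_shrink_partition: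
  fixes G :: "'a set \<Rightarrow> 'y::banach"
  assumes "finite_measure M" and G: "vector_measure M G" "vanishes_on_null M G" "averages_shrink M G" and e: "0 < e"
  shows "\<exists>A x. disjoint_family A \<and> (\<forall>i::nat. A i \<in> sets M) \<and> measure M (space M - (\<Union>i. A i)) = 0 \<and>
    (\<forall>i F. F \<in> sets M \<and> F \<subseteq> A i \<longrightarrow> norm (G F - measure M F *\<^sub>R x i) \<le> e * measure M F)"
proof -
  interpret finite_measure M by fact
  from exhaustion[of "\<lambda>F. \<exists>x. averages M G F \<subseteq> ball x e"]
  obtain A :: "nat \<Rightarrow> 'a set" where A: "disjoint_family A" "\<And>n. A n \<in> sets M"
    "\<And>n. A n \<noteq> {} \<Longrightarrow> 0 < measure M (A n) \<and> (\<exists>x. averages M G (A n) \<subseteq> ball x e)"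
    and max: "\<And>F. F \<in> sets M \<Longrightarrow> 0 < measure M F \<Longrightarrow> (\<exists>x. averages M G F \<subseteq> ball x e)
       \<Longrightarrow> F \<inter> (\<Union>n. A n) \<noteq> {}"
    by (elim exE conjE) simp
  have "\<exists>x. \<forall>F. F \<in> sets M \<and> F \<subseteq> A i \<longrightarrow> norm (G F - measure M F *\<^sub>R x) \<le> e * measure M F" for i
  proof (cases "A i = {}")
    case True
    then show ?thesis using vector_measure_empty[OF G(1)] by auto
  next
    case False
    then obtain x where x: "averages M G (A i) \<subseteq> ball x e" using A(3) by blast
    have "norm (G F - measure M F *\<^sub>R x) \<le> e * measure M F" if F: "F \<in> sets M" "F \<subseteq> A i" for F
    proof (cases "measure M F = 0")
      case True
      then show ?thesis using G(2) F by (simp add: vanishes_on_null_def)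
    next
      case False
      then have pos: "0 < measure M F" by (simp add: zero_less_measure_iff)
      then have "G F /\<^sub>R measure M F \<in> ball x e" using x F unfolding averages_def by blast
      then have "norm (G F /\<^sub>R measure M F - x) \<le> e" by (simp add: dist_norm norm_minus_commute)
      then have "measure M F * norm (G F /\<^sub>R measure M F - x) \<le> measure M F * e"
        using pos by (intro mult_left_mono) auto
      moreover have "measure M F * norm (G F /\<^sub>R measure M F - x) = norm (measure M F *\<^sub>R (G F /\<^sub>R measure M F - x))"
        by simp
      moreover have "measure M F *\<^sub>R (G F /\<^sub>R measure M F - x) = G F - measure M F *\<^sub>R x"
        using pos by (simp add: scaleR_diff_right)
      ultimately show ?thesis by (simp add: mult.commute)
    qed
    then show ?thesis by blast
  qed
  then have "\<forall>i. \<exists>x. \<forall>F. F \<in> sets M \<and> F \<subseteq> A i \<longrightarrow> norm (G F - measure M F *\<^sub>R x) \<le> e * measure M F" ..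
  from choice[OF this] obtain x where x: "\<forall>i F. F \<in> sets M \<and> F \<subseteq> A i \<longrightarrow> norm (G F - measure M F *\<^sub>R x i) \<le> e * measure M F" ..
  have R: "space M - (\<Union>i. A i) \<in> sets M" using A(2) by auto
  have "measure M (space M - (\<Union>i. A i)) = 0"
  proof (rule ccontr)
    assume "measure M (space M - (\<Union>i. A i)) \<noteq> 0"
    then have "0 < measure M (space M - (\<Union>i. A i))" by (simp add: zero_less_measure_iff)
    from G(3)[unfolded averages_shrink_def, rule_format, OF R this e]
    obtain B y where B: "B \<in> sets M" "B \<subseteq> space M - (\<Union>i. A i)" "0 < measure M B" "averages M G B \<subseteq> ball y e"
      by (elim exE conjE)
    have "B \<inter> (\<Union>n. A n) \<noteq> {}" by (rule max[OF B(1,3)]) (rule exI[of _ y], rule B(4))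
    then show False using B(2) by blast
  qed
  then show ?thesis using x A(1,2) by (intro exI[of _ A] exI[of _ x]) simp
qed

text \<open>Take such a partition for each error \<open>e n\<close>. Two cells that overlap in
  positive measure have values within e n + e m, since both approximate the average of
  \<open>G\<close> over the overlap. The countably many null overlaps are discarded, and the
  countably valued functions converge uniformly to the density.\<close>

lemma density_of_averages_shrink:
  fixes G :: "'a set \<Rightarrow> 'y::banach"
  assumes fm: "finite_measure M" and G: "vector_measure M G" "vanishes_on_null M G" "averages_shrink M G"
    and bv: "bounded_variation M G"
  shows "\<exists>g. \<forall>E\<in>sets M. has_bochner_integral' M (\<lambda>w. if w \<in> E then g w else 0) (G E)"
proof -
  interpret finite_measure M by fact
  obtain V where V: "\<forall>P. finite P \<longrightarrow> P \<subseteq> sets M \<longrightarrow> disjoint P \<longrightarrow> \<Union>P = space M \<longrightarrow> (\<Sum>E\<in>P. norm (G E)) \<le> V"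
    using bv unfolding bounded_variation_def ..
  define e where "e n = 1 / Suc n" for n :: nat
  have e: "0 < e n" for n by (simp add: e_def)
  have e0: "e \<longlonglongrightarrow> 0" unfolding e_def using LIMSEQ_inverse_real_of_nat by (simp add: inverse_eq_divide)
  have "\<forall>n. \<exists>A x. disjoint_family A \<and> (\<forall>i::nat. A i \<in> sets M) \<and> measure M (space M - (\<Union>i. A i)) = 0 \<and>
    (\<forall>i F. F \<in> sets M \<and> F \<subseteq> A i \<longrightarrow> norm (G F - measure M F *\<^sub>R x i) \<le> e n * measure M F)"
    using averages_shrink_partition[OF fm G e] by blast
  from choice[OF this] obtain A :: "nat \<Rightarrow> nat \<Rightarrow> 'a set" where "\<forall>n. \<exists>x. disjoint_family (A n) \<and> (\<forall>i. A n i \<in> sets M) \<and>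
    measure M (space M - (\<Union>i. A n i)) = 0 \<and>
    (\<forall>i F. F \<in> sets M \<and> F \<subseteq> A n i \<longrightarrow> norm (G F - measure M F *\<^sub>R x i) \<le> e n * measure M F)" ..
  from choice[OF this] obtain x where Ax: "\<forall>n. disjoint_family (A n) \<and> (\<forall>i. A n i \<in> sets M) \<and>
    measure M (space M - (\<Union>i. A n i)) = 0 \<and>
    (\<forall>i F. F \<in> sets M \<and> F \<subseteq> A n i \<longrightarrow> norm (G F - measure M F *\<^sub>R x n i) \<le> e n * measure M F)" ..
  have A: "disjoint_family (A n)" "A n i \<in> sets M" "measure M (space M - (\<Union>i. A n i)) = 0" for n i
    using Ax by auto
  have x: "norm (G F - measure M F *\<^sub>R x n i) \<le> e n * measure M F" if "F \<in> sets M" "F \<subseteq> A n i" for n i F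
    using Ax that by blast
  have good: "AE w in M. (\<forall>n. \<exists>i. w \<in> A n i) \<and>
     (\<forall>n i m j. w \<in> A n i \<longrightarrow> w \<in> A m j \<longrightarrow> norm (x n i - x m j) \<le> e n + e m)"
  proof (intro AE_conjI AE_all_countable[THEN iffD2] allI)
    fix n
    have "AE w in M. w \<notin> space M - (\<Union>i. A n i)"
      using A(2,3)[of n] by (intro AE_not_in) (auto simp: null_sets_def emeasure_eq_measure)
    then show "AE w in M. \<exists>i. w \<in> A n i" using AE_space by eventually_elim auto
  next
    fix n i m j
    let ?E = "A n i \<inter> A m j"
    have E: "?E \<in> sets M" using A(2) by auto
    show "AE w in M. w \<in> A n i \<longrightarrow> w \<in> A m j \<longrightarrow> norm (x n i - x m j) \<le> e n + e m"
    proof (cases "measure M ?E = 0")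
      case True
      then have "AE w in M. w \<notin> ?E" using E by (intro AE_not_in) (auto simp: null_sets_def emeasure_eq_measure)
      then show ?thesis by eventually_elim auto
    next
      case False
      then have pos: "0 < measure M ?E" by (simp add: zero_less_measure_iff)
      have "measure M ?E * norm (x n i - x m j) = norm (measure M ?E *\<^sub>R x n i - measure M ?E *\<^sub>R x m j)"
        by (simp flip: scaleR_diff_right)
      also have "\<dots> \<le> norm (G ?E - measure M ?E *\<^sub>R x n i) + norm (G ?E - measure M ?E *\<^sub>R x m j)"
        using dist_triangle2[of "measure M ?E *\<^sub>R x n i" "measure M ?E *\<^sub>R x m j" "G ?E"]
        by (simp add: dist_norm norm_minus_commute)
      also have "\<dots> \<le> e n * measure M ?E + e m * measure M ?E" by (intro add_mono x E) auto
      finally have "measure M ?E * norm (x n i - x m j) \<le> measure M ?E * (e n + e m)"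
        by (simp add: algebra_simps)
      then have "norm (x n i - x m j) \<le> e n + e m" using pos by (rule mult_left_le_imp_le)
      then show ?thesis by simp
    qed
  qed
  then obtain N where N: "N \<in> null_sets M" "{w\<in>space M. \<not> ((\<forall>n. \<exists>i. w \<in> A n i) \<and>
     (\<forall>n i m j. w \<in> A n i \<longrightarrow> w \<in> A m j \<longrightarrow> norm (x n i - x m j) \<le> e n + e m))} \<subseteq> N"
    unfolding eventually_ae_filter by (elim bexE)
  \<comment> \<open>The value 0 on the exceptional set makes the sequence converge at every point,
    so that the limit is measurable. Each \<open>w\<close> lies in at most one cell, so
    \<open>LEAST\<close> just names its index.\<close>
  define h where "h n w = (if w \<in> N then 0 else x n (LEAST i. w \<in> A n i))" for n w
  have hA: "h n w = x n i" if "w \<in> A n i" "w \<notin> N" for n i w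
  proof -
    have uniq: "j = i" if "w \<in> A n j" for j
      using A(1)[of n] \<open>w \<in> A n i\<close> that unfolding disjoint_family_on_def by blast
    have "(LEAST i. w \<in> A n i) = i"
      using \<open>w \<in> A n i\<close> by (rule Least_equality) (drule uniq, simp)
    then show ?thesis using that(2) by (simp add: h_def)
  qed
  have close: "norm (h n w - h m w) \<le> e n + e m" if w: "w \<in> space M" for n m w
  proof (cases "w \<in> N")
    case True
    then show ?thesis using e[of n] e[of m] by (simp add: h_def)
  next
    case False
    then obtain i j where "w \<in> A n i" "w \<in> A m j" using N(2) w by blast
    then show ?thesis using False N(2) w hA by auto
  qed
  define g where "g w = lim (\<lambda>n. h n w)" for w
  have lim: "(\<lambda>n. h n w) \<longlonglongrightarrow> g w" if w: "w \<in> space M" for w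
  proof -
    have "Cauchy (\<lambda>n. h n w)"
    proof (rule metric_CauchyI)
      fix r :: real assume r: "0 < r"
      obtain N where N: "\<And>n. n \<ge> N \<Longrightarrow> e n < r / 2"
        using order_tendstoD(2)[OF e0, of "r / 2"] r by (auto simp: eventually_sequentially)
      have "dist (h m w) (h n w) < r" if "m \<ge> N" "n \<ge> N" for m n
        using close[OF w, of m n] N[OF that(1)] N[OF that(2)] by (simp add: dist_norm)
      then show "\<exists>N. \<forall>m\<ge>N. \<forall>n\<ge>N. dist (h m w) (h n w) < r" by blast
    qed
    then show ?thesis by (simp add: g_def Cauchy_convergent_iff convergent_LIMSEQ_iff)
  qed
  have close_g: "norm (g w - h n w) \<le> e n" if w: "w \<in> space M" for w n
  proof -
    have "(\<lambda>m. norm (h m w - h n w)) \<longlonglongrightarrow> norm (g w - h n w)"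
      by (intro tendsto_norm tendsto_diff lim[OF w] tendsto_const)
    moreover have "(\<lambda>m. e m + e n) \<longlonglongrightarrow> 0 + e n" by (intro tendsto_add e0 tendsto_const)
    ultimately show ?thesis
      using close[OF w, of _ n] by (intro LIMSEQ_le[of _ _ "\<lambda>m. e m + e n"]) auto
  qed
  have gm: "g \<in> borel_measurable M"
  proof (rule borel_measurable_LIMSEQ_metric[OF _ lim])
    fix n
    \<comment> \<open>The map factors through the discrete space of indices, so measurability
      requires no separability of the target.\<close>
    have "(\<lambda>w. LEAST i. w \<in> A n i) \<in> measurable M (count_space UNIV)"
      using A(2) by (intro measurable_Least) (auto simp: pred_def Int_def[symmetric] Collect_conj_eq[symmetric])
    then have "(\<lambda>w. x n (LEAST i. w \<in> A n i)) \<in> borel_measurable M"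
      by (rule measurable_compose) simp
    then show "h n \<in> borel_measurable M"
      unfolding h_def using N(1) by (intro measurable_If_set) auto
  qed
  have "AE w in M. \<forall>n i. w \<in> A n i \<longrightarrow> norm (g w - x n i) \<le> e n"
    using AE_not_in[OF N(1)] AE_space
  proof eventually_elim
    fix w assume "w \<notin> N" "w \<in> space M"
    then show "\<forall>n i. w \<in> A n i \<longrightarrow> norm (g w - x n i) \<le> e n" using close_g[of w] hA by metis
  qed
  then show ?thesis
    by (intro exI[of _ g] ballI has_bochner_integral'_countably_valued[OF G(1,2) V A x less_imp_le[OF e] e0 gm])
qed

section \<open>Attainment of maximal derivatives implies the Radon-Nikodym property\<close>

text \<open>For \<open>x\<close> within \<open>e\<close> of the supremum, removing
  \<open>ball x e\<close> leaves only points below x - e, a closed convex condition.\<close>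

lemma real_dentable:
  fixes K :: "real set"
  assumes K: "K \<noteq> {}" "bounded K" and e: "0 < e"
  obtains x where "x \<in> K" "x \<notin> closure (convex hull (K - ball x e))"
proof -
  have bdd: "bdd_above K" using K(2) by (rule bounded_imp_bdd_above)
  obtain x where x: "x \<in> K" "Sup K - e < x"
    using less_cSupE[of "Sup K - e" K] K(1) e by auto
  have "K - ball x e \<subseteq> {..x - e}"
  proof
    fix y assume y: "y \<in> K - ball x e"
    then have "y \<le> Sup K" using cSup_upper[OF _ bdd] by blast
    then show "y \<in> {..x - e}" using y x by (auto simp: dist_real_def)
  qed
  then have "closure (convex hull (K - ball x e)) \<subseteq> {..x - e}"
    by (intro closure_minimal hull_minimal) auto
  then show thesis using that x(1) e by fastforce
qed

lemma (in finite_measure) averages_nonempty: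
  "B \<in> sets M \<Longrightarrow> 0 < measure M B \<Longrightarrow> averages M G B \<noteq> {}"
  unfolding averages_def by blast

text \<open>Since \<open>dent\<close> covers only the kernel, y is split as P y + \<phi> y times
  \<open>y0\<close>. Three successive subsets make the averages bounded, then their
  \<open>\<phi>\<close>-coordinates almost constant by \<open>real_dentable\<close>, then their
  kernel parts by \<open>dent\<close>; the last two contribute e / 2 each.\<close>

lemma averages_shrink_of_dentable:
  fixes G :: "'a set \<Rightarrow> 'y::real_normed_vector" and \<phi> :: "'y \<Rightarrow> real"
  assumes fm: "finite_measure M" and G: "vector_measure M G" "vanishes_on_null M G" "bounded_variation M G"
    and \<phi>: "bounded_linear \<phi>" "\<phi> y0 = 1"
    and dent: "\<And>K e. K \<subseteq> {y. \<phi> y = 0} \<Longrightarrow> K \<noteq> {} \<Longrightarrow> bounded K \<Longrightarrow> 0 < e \<Longrightarrow>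
        \<exists>x\<in>K. x \<notin> closure (convex hull (K - ball x e))"
  shows "averages_shrink M G"
  unfolding averages_shrink_def
proof (intro ballI impI allI)
  interpret finite_measure M by fact
  fix A and e :: real assume A: "A \<in> sets M" "0 < measure M A" and e: "0 < e"
  define P where "P y = y - \<phi> y *\<^sub>R y0" for y
  have lin\<phi>: "linear \<phi>" using \<phi>(1) by (rule bounded_linear.linear)
  have "bounded_linear (\<lambda>y. y - \<phi> y *\<^sub>R y0)"
    by (intro bounded_linear_sub bounded_linear_ident bounded_linear_compose[OF bounded_linear_scaleR_left \<phi>(1)])
  then have P: "bounded_linear P" by (simp add: P_def[abs_def])
  then have linP: "linear P" by (rule bounded_linear.linear)
  have \<phi>P: "\<phi> (P y) = 0" for y
    using linear_diff[OF lin\<phi>] linear_scale[OF lin\<phi>] \<phi>(2) by (simp add: P_def)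
  have nz: "0 < norm y0" using \<phi>(2) linear_0[OF lin\<phi>] by fastforce
  obtain B1 where B1: "B1 \<in> sets M" "B1 \<subseteq> A" "0 < measure M B1" "bounded (averages M G B1)"
    using locally_bounded_averages[OF G A] by blast
  let ?\<phi>G = "\<lambda>E. \<phi> (G E)" and ?PG = "\<lambda>E. P (G E)"
  have v: "vector_measure M ?\<phi>G" "vector_measure M ?PG"
    using vector_measure_linear[OF \<phi>(1) G(1)] vector_measure_linear[OF P G(1)] by auto
  have n: "vanishes_on_null M ?\<phi>G" "vanishes_on_null M ?PG"
    using G(2) linear_0[OF lin\<phi>] linear_0[OF linP] by (auto simp: vanishes_on_null_def)
  have "bounded (averages M ?\<phi>G B1)"
    unfolding averages_linear[OF lin\<phi>] using B1(4) \<phi>(1) by (rule bounded_linear_image)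
  then obtain r where r: "r \<in> averages M ?\<phi>G B1"
    "r \<notin> closure (convex hull (averages M ?\<phi>G B1 - ball r (e / (2 * norm y0))))"
    using real_dentable[OF averages_nonempty[OF B1(1,3)]] e nz by (metis half_gt_zero_iff divide_pos_pos mult_pos_pos zero_less_numeral)
  obtain B2 where B2: "B2 \<in> sets M" "B2 \<subseteq> B1" "0 < measure M B2"
    "averages M ?\<phi>G B2 \<subseteq> ball r (e / (2 * norm y0))"
    by (rule small_averages_subset[OF v(1) n(1) r])
  have "bounded (averages M G B2)" using B1(4) averages_mono[OF B2(2)] by (rule bounded_subset)
  then have "bounded (averages M ?PG B2)"
    unfolding averages_linear[OF linP] using P by (rule bounded_linear_image)
  moreover have "averages M ?PG B2 \<subseteq> {y. \<phi> y = 0}"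
    unfolding averages_linear[OF linP] using \<phi>P by auto
  ultimately have "\<exists>x\<in>averages M ?PG B2. x \<notin> closure (convex hull (averages M ?PG B2 - ball x (e / 2)))"
    using e by (intro dent averages_nonempty[OF B2(1,3)]) auto
  then obtain x where x: "x \<in> averages M ?PG B2"
    "x \<notin> closure (convex hull (averages M ?PG B2 - ball x (e / 2)))" by (elim bexE)
  obtain B3 where B3: "B3 \<in> sets M" "B3 \<subseteq> B2" "0 < measure M B3"
    "averages M ?PG B3 \<subseteq> ball x (e / 2)"
    by (rule small_averages_subset[OF v(2) n(2) x])
  have "averages M G B3 \<subseteq> ball (x + r *\<^sub>R y0) e"
  proof
    fix y assume y: "y \<in> averages M G B3"
    have "P y \<in> ball x (e / 2)" using y B3(4) unfolding averages_linear[OF linP] by blast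
    moreover have "y \<in> averages M G B2" using y averages_mono[OF B3(2)] by blast
    then have "\<phi> y \<in> ball r (e / (2 * norm y0))" using B2(4) unfolding averages_linear[OF lin\<phi>] by blast
    then have "\<bar>r - \<phi> y\<bar> * norm y0 < e / 2" using nz by (simp add: dist_real_def field_simps)
    moreover have "norm (x + r *\<^sub>R y0 - y) \<le> norm (x - P y) + norm ((r - \<phi> y) *\<^sub>R y0)"
      using norm_triangle_ineq[of "x - P y" "(r - \<phi> y) *\<^sub>R y0"] by (simp add: P_def algebra_simps)
    ultimately have "norm (x + r *\<^sub>R y0 - y) < e" by (simp add: dist_norm)
    then show "y \<in> ball (x + r *\<^sub>R y0) e" by (simp add: dist_norm)
  qed
  then show "\<exists>B x. B \<in> sets M \<and> B \<subseteq> A \<and> 0 < measure M B \<and> averages M G B \<subseteq> ball x e"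
    using B1(2) B2(2) B3(1-3) by blast
qed

lemma RNP_of_dentable:
  fixes \<phi> :: "'y::banach \<Rightarrow> real"
  assumes \<phi>: "bounded_linear \<phi>" "\<phi> y0 = 1"
    and dent: "\<And>K e. K \<subseteq> {y. \<phi> y = 0} \<Longrightarrow> K \<noteq> {} \<Longrightarrow> bounded K \<Longrightarrow> 0 < e \<Longrightarrow>
        \<exists>x\<in>K. x \<notin> closure (convex hull (K - ball x e))"
  shows "has_RNP TYPE('w) TYPE('y)"
  unfolding has_RNP_def
proof (intro allI impI)
  fix M :: "'w measure" and G :: "'w set \<Rightarrow> 'y"
  assume M: "finite_measure M" "vector_measure M G" "continuous_wrt M G" "bounded_variation M G"
  note n = continuous_wrt_vanishes[OF M(3)]
  obtain g where g: "\<forall>E\<in>sets M. has_bochner_integral' M (\<lambda>w. if w \<in> E then g w else 0) (G E)"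
    using density_of_averages_shrink[OF M(1,2) n averages_shrink_of_dentable[OF M(1,2) n M(4) \<phi> dent] M(4)]
    by blast
  have "has_bochner_integral' M g (G (space M))"
    using g[rule_format, OF sets.top] by (subst has_bochner_integral'_cong[of _ _ "\<lambda>w. if w \<in> space M then g w else 0"]) auto
  moreover have "has_bochner_integral' M (\<lambda>w. indicator E w *\<^sub>R g w) (G E)" if "E \<in> sets M" for E
    using g[rule_format, OF that] by (subst has_bochner_integral'_cong[of _ _ "\<lambda>w. if w \<in> E then g w else 0"]) (auto simp: indicator_def)
  ultimately show "\<exists>g. (\<exists>I. has_bochner_integral' M g I) \<and>
     (\<forall>E\<in>sets M. has_bochner_integral' M (\<lambda>w. indicator E w *\<^sub>R g w) (G E))" by blast
qed

text \<open>The renorming \<open>N\<close> is chosen such that the linear part \<open>t \<mapsto> t *\<^sub>R y0\<close> dominates the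
  nowhere differentiable perturbation \<open>\<gamma>\<close>, whose values lie in the kernel of \<open>\<phi>\<close>.\<close>

lemma SNA_not_Der_of_bush:
  fixes K :: "'y::banach set" and \<phi> :: "'y \<Rightarrow> real"
  assumes x0: "\<exists>x :: 'x::banach. x \<noteq> 0"
    and \<phi>: "bounded_linear \<phi>" "\<phi> y0 = 1"
    and K: "bush K d" "K \<subseteq> {y. \<phi> y = 0}"
  shows "\<exists>N :: 'y \<Rightarrow> real. equivalent_norm N \<and> \<not> (SNA N :: ('x \<Rightarrow> 'y) set) \<subseteq> Der N"
proof -
  have lin\<phi>: "linear \<phi>" using \<phi>(1) by (rule bounded_linear.linear)
  note \<phi>simps = linear_diff[OF lin\<phi>] linear_add[OF lin\<phi>] linear_scale[OF lin\<phi>] linear_0[OF lin\<phi>] \<phi>(2)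
  have sub: "subspace {y. \<phi> y = 0}" by (auto simp: subspace_def \<phi>simps)
  have cl: "closed {y. \<phi> y = 0}"
    using \<phi>(1) by (intro closed_Collect_eq linear_continuous_on continuous_on_const)
  from bush_nowhere_differentiable[OF K(1) sub cl K(2)]
  obtain \<gamma> C where C: "0 < C" and \<gamma>: "\<forall>t t'. norm (\<gamma> t' - \<gamma> t) \<le> C * \<bar>t' - t\<bar>"
    "\<forall>t. \<gamma> t \<in> {y. \<phi> y = 0}" and \<gamma>0: "\<gamma> 0 = 0"
    and nd: "\<forall>t D. \<not> (\<gamma> has_vector_derivative D) (at t)"
    by (elim exE conjE)
  have lip: "norm (\<gamma> t' - \<gamma> t) \<le> C * \<bar>t' - t\<bar>" and ker: "\<phi> (\<gamma> t) = 0" for t t'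
    using \<gamma> by auto
  define P where "P y = y - \<phi> y *\<^sub>R y0" for y
  have Psimps: "P (a + b) = P a + P b" "P (c *\<^sub>R a) = c *\<^sub>R P a" for a b c
    by (auto simp: P_def \<phi>simps algebra_simps)
  define N where "N y = max \<bar>\<phi> y\<bar> (norm (P y) / C)" for y
  obtain F where F: "0 < F" "\<And>y. \<bar>\<phi> y\<bar> \<le> norm y * F"
    using bounded_linear.pos_bounded[OF \<phi>(1)] by auto
  have yP: "y = P y + \<phi> y *\<^sub>R y0" for y by (simp add: P_def)
  have y_le: "norm y \<le> (C + norm y0) * N y" for y
  proof -
    have "norm y \<le> norm (P y) + \<bar>\<phi> y\<bar> * norm y0"
      using norm_triangle_ineq[of "P y" "\<phi> y *\<^sub>R y0"] by (simp flip: yP)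
    also have "\<dots> \<le> C * N y + N y * norm y0"
      using C by (intro add_mono mult_right_mono) (auto simp: N_def max_def field_simps)
    finally show ?thesis by (simp add: algebra_simps)
  qed
  have N_le: "N y \<le> (F + (1 + F * norm y0) / C) * norm y" for y
  proof -
    have "norm (P y) \<le> norm y + \<bar>\<phi> y\<bar> * norm y0"
      using norm_triangle_ineq4[of y "\<phi> y *\<^sub>R y0"] by (simp add: P_def)
    also have "\<dots> \<le> norm y + (norm y * F) * norm y0"
      using F(2) by (intro add_left_mono mult_right_mono) auto
    finally have "norm (P y) / C \<le> (1 + F * norm y0) / C * norm y"
      using C by (simp add: field_simps)
    moreover have "\<bar>\<phi> y\<bar> \<le> F * norm y" using F(2)[of y] by (simp add: mult.commute)
    moreover have "0 \<le> F * norm y" "0 \<le> (1 + F * norm y0) / C * norm y" using F(1) C by auto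
    ultimately show ?thesis unfolding N_def distrib_right by linarith
  qed
  have Cy: "0 < C + norm y0" using C by (simp add: add_pos_nonneg)
  have pos: "0 < F + (1 + F * norm y0) / C" using F C by (auto intro!: add_pos_nonneg divide_nonneg_pos)
  have N: "equivalent_norm N"
    unfolding equivalent_norm_def
  proof (intro conjI allI)
    show "0 \<le> N y" for y by (simp add: N_def)
    show "N y = 0 \<longleftrightarrow> y = 0" for y
    proof
      assume "N y = 0"
      then show "y = 0" using y_le[of y] by simp
    next
      assume "y = 0"
      then show "N y = 0" by (simp add: N_def P_def \<phi>simps)
    qed
    show "N (c *\<^sub>R y) = \<bar>c\<bar> * N y" for c y
      by (simp add: N_def Psimps \<phi>simps abs_mult max_mult_distrib_left)
    show "N (y + z) \<le> N y + N z" for y z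
    proof -
      have "norm (P (y + z)) / C \<le> norm (P y) / C + norm (P z) / C"
        using C norm_triangle_ineq[of "P y" "P z"] by (simp add: Psimps divide_right_mono flip: add_divide_distrib)
      moreover have "\<bar>\<phi> (y + z)\<bar> \<le> \<bar>\<phi> y\<bar> + \<bar>\<phi> z\<bar>" by (simp add: \<phi>simps)
      ultimately show ?thesis unfolding N_def by linarith
    qed
    show "\<exists>a>0. \<exists>b>0. \<forall>y. a * norm y \<le> N y \<and> N y \<le> b * norm y"
      using Cy pos y_le N_le
      by (intro exI[of _ "1 / (C + norm y0)"] exI[of _ "F + (1 + F * norm y0) / C"])
        (auto simp: field_simps)
  qed
  obtain x :: 'x where "x \<noteq> 0" using x0 by blast
  define u where "u = x /\<^sub>R norm x"
  have u: "norm u = 1" using \<open>x \<noteq> 0\<close> by (simp add: u_def)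
  obtain \<psi> :: "'x \<Rightarrow> real" where \<psi>: "linear \<psi>" "\<psi> u = norm u" "\<And>x. \<bar>\<psi> x\<bar> \<le> norm x"
    using norming_functional[of u] by blast
  define f where "f x = \<psi> x *\<^sub>R y0 + \<gamma> (\<psi> x)" for x
  \<comment> \<open>The factor 1 / C in \<open>N\<close> keeps the contribution of
    \<open>\<gamma>\<close> below that of the \<open>y0\<close>-coordinate, so \<open>N\<close> sees
    only the increments of \<open>\<psi>\<close>.\<close>
  have Nf: "N (f p - f q) = \<bar>\<psi> (p - q)\<bar>" for p q
  proof -
    have "\<phi> (f p - f q) = \<psi> (p - q)" by (simp add: f_def \<phi>simps ker linear_diff[OF \<psi>(1)])
    moreover have "P (f p - f q) = \<gamma> (\<psi> p) - \<gamma> (\<psi> q)" by (simp add: P_def f_def \<phi>simps ker algebra_simps)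
    moreover have "norm (\<gamma> (\<psi> p) - \<gamma> (\<psi> q)) / C \<le> \<bar>\<psi> p - \<psi> q\<bar>"
      using lip[of "\<psi> p" "\<psi> q"] C by (simp add: field_simps)
    ultimately show ?thesis by (simp add: N_def linear_diff[OF \<psi>(1)])
  qed
  have f0: "f 0 = 0" by (simp add: f_def linear_0[OF \<psi>(1)] \<gamma>0)
  have fL: "f \<in> Lip0 N"
    unfolding Lip0_def using f0 Nf \<psi>(3) by (auto intro!: exI[of _ 1])
  have quot: "N (f p - f q) / norm (p - q) \<le> 1" if "p \<noteq> q" for p q
    using \<psi>(3)[of "p - q"] that by (simp add: Nf)
  have att: "N (f u - f 0) / norm (u - 0) = 1" using u \<psi>(2) by (simp add: Nf)
  have "u \<noteq> 0" using u by auto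
  have ln: "lip_norm N f = 1"
    unfolding lip_norm_def
  proof (rule cSup_eq_maximum)
    show "1 \<in> {N (f p - f q) / norm (p - q) |p q. p \<noteq> q}"
      using att \<open>u \<noteq> 0\<close> by (smt (verit) mem_Collect_eq)
  qed (use quot in auto)
  have "f \<in> SNA N"
    unfolding SNA_def using fL ln att \<open>u \<noteq> 0\<close> by (smt (verit) mem_Collect_eq)
  moreover have "f \<notin> Der N"
  proof
    assume "f \<in> Der N"
    from this[unfolded Der_def mem_Collect_eq]
    obtain x e z where lim: "((\<lambda>t::real. N ((f (x + t *\<^sub>R e) - f x) /\<^sub>R t - z)) \<longlongrightarrow> 0) (at 0)"
      and z: "N z = lip_norm N f" by (elim exE conjE)
    have "((\<lambda>t. (f (x + t *\<^sub>R e) - f x) /\<^sub>R t - z) \<longlongrightarrow> 0) (at 0)"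
    proof (rule Lim_null_comparison[OF always_eventually])
      show "\<forall>t. norm ((f (x + t *\<^sub>R e) - f x) /\<^sub>R t - z) \<le> (C + norm y0) * N ((f (x + t *\<^sub>R e) - f x) /\<^sub>R t - z)"
        using y_le by blast
      show "((\<lambda>t. (C + norm y0) * N ((f (x + t *\<^sub>R e) - f x) /\<^sub>R t - z)) \<longlongrightarrow> 0) (at 0)"
        using tendsto_mult_left[OF lim, of "C + norm y0"] by simp
    qed
    then have lim: "((\<lambda>t. (f (x + t *\<^sub>R e) - f x) /\<^sub>R t) \<longlongrightarrow> z) (at 0)"
      by (rule LIM_zero_cancel)
    show False
    proof (cases "\<psi> e = 0")
      \<comment> \<open>In directions annihilated by \<open>\<psi>\<close> the map is constant, so
        the derivative is 0 while the Lipschitz norm is 1.\<close>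
      case True
      then have "f (x + t *\<^sub>R e) = f x" for t
        by (simp add: f_def linear_add[OF \<psi>(1)] linear_scale[OF \<psi>(1)])
      then have "z = 0" using lim by (simp add: tendsto_const_iff)
      then show False using z ln by (simp add: N_def P_def \<phi>simps)
    next
      case False
      \<comment> \<open>Replacing t by t / s moves the argument of \<open>\<gamma>\<close> at unit
        speed. Dividing the limit by \<open>s\<close> and subtracting \<open>y0\<close> isolates the
        difference quotient of \<open>\<gamma>\<close> at \<open>\<psi> x\<close>.\<close>
      define s where "s = \<psi> e"
      have "((\<lambda>t. (f (x + (t / s) *\<^sub>R e) - f x) /\<^sub>R (t / s)) \<longlongrightarrow> z) (at 0)"
      proof (rule filterlim_compose[OF lim])
        show "filterlim (\<lambda>t. t / s) (at 0) (at 0)"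
          unfolding filterlim_at using False
          by (auto simp: s_def eventually_at_filter intro!: tendsto_eq_intros)
      qed
      then have "((\<lambda>t. inverse s *\<^sub>R ((f (x + (t / s) *\<^sub>R e) - f x) /\<^sub>R (t / s)) - y0) \<longlongrightarrow> inverse s *\<^sub>R z - y0) (at 0)"
        by (intro tendsto_diff tendsto_scaleR tendsto_const)
      moreover have "\<forall>\<^sub>F t in at 0. inverse s *\<^sub>R ((f (x + (t / s) *\<^sub>R e) - f x) /\<^sub>R (t / s)) - y0 =
          (\<gamma> (\<psi> x + t) - \<gamma> (\<psi> x)) /\<^sub>R t"
        unfolding eventually_at_filter
      proof (rule always_eventually, intro allI impI)
        fix t :: real assume "t \<noteq> 0"
        have "\<psi> (x + (t / s) *\<^sub>R e) = \<psi> x + t"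
          using False by (simp add: linear_add[OF \<psi>(1)] linear_scale[OF \<psi>(1)] s_def)
        then have 1: "f (x + (t / s) *\<^sub>R e) - f x = t *\<^sub>R y0 + (\<gamma> (\<psi> x + t) - \<gamma> (\<psi> x))"
          by (simp add: f_def algebra_simps)
        have 2: "inverse s *\<^sub>R (v /\<^sub>R (t / s)) = v /\<^sub>R t" for v :: 'y
          using False \<open>t \<noteq> 0\<close> by (simp add: s_def inverse_eq_divide)
        show "inverse s *\<^sub>R ((f (x + (t / s) *\<^sub>R e) - f x) /\<^sub>R (t / s)) - y0 =
          (\<gamma> (\<psi> x + t) - \<gamma> (\<psi> x)) /\<^sub>R t"
          unfolding 1 2 using \<open>t \<noteq> 0\<close> by (simp add: scaleR_add_right)
      qed
      ultimately have "((\<lambda>t. (\<gamma> (\<psi> x + t) - \<gamma> (\<psi> x)) /\<^sub>R t) \<longlongrightarrow> inverse s *\<^sub>R z - y0) (at 0)"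
        by (rule Lim_transform_eventually)
      then have "((\<lambda>t. norm ((\<gamma> (\<psi> x + t) - \<gamma> (\<psi> x)) /\<^sub>R t - (inverse s *\<^sub>R z - y0))) \<longlongrightarrow> 0) (at 0)"
        by (intro tendsto_norm_zero LIM_zero)
      moreover have "\<forall>\<^sub>F t in at 0. norm ((\<gamma> (\<psi> x + t) - \<gamma> (\<psi> x)) /\<^sub>R t - (inverse s *\<^sub>R z - y0)) =
          norm (\<gamma> (\<psi> x + t) - \<gamma> (\<psi> x) - t *\<^sub>R (inverse s *\<^sub>R z - y0)) / norm t"
        unfolding eventually_at_filter
      proof (rule always_eventually, intro allI impI)
        fix t :: real assume "t \<noteq> 0"
        let ?a = "\<gamma> (\<psi> x + t) - \<gamma> (\<psi> x)" and ?b = "inverse s *\<^sub>R z - y0"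
        have "?a - t *\<^sub>R ?b = t *\<^sub>R (?a /\<^sub>R t - ?b)"
          using \<open>t \<noteq> 0\<close> by (simp add: scaleR_diff_right[of t "?a /\<^sub>R t"])
        then show "norm (?a /\<^sub>R t - ?b) = norm (?a - t *\<^sub>R ?b) / norm t"
          using \<open>t \<noteq> 0\<close> by (simp only: norm_scaleR real_norm_def) simp
      qed
      ultimately have "((\<lambda>t. norm (\<gamma> (\<psi> x + t) - \<gamma> (\<psi> x) - t *\<^sub>R (inverse s *\<^sub>R z - y0)) / norm t) \<longlongrightarrow> 0) (at 0)"
        by (rule Lim_transform_eventually)
      then have "(\<gamma> has_vector_derivative inverse s *\<^sub>R z - y0) (at (\<psi> x))"
        unfolding has_vector_derivative_def has_derivative_at
        by (intro conjI bounded_linear_scaleR_left)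
      then show False using nd by blast
    qed
  qed
  ultimately show ?thesis using N by blast
qed

lemma RNP_of_SNA_subset_Der:
  assumes x0: "\<exists>x :: 'x::banach. x \<noteq> 0" and y0: "\<exists>y :: 'y::banach. y \<noteq> 0"
    and all: "\<forall>N :: 'y \<Rightarrow> real. equivalent_norm N \<longrightarrow> (SNA N :: ('x \<Rightarrow> 'y) set) \<subseteq> Der N"
  shows "has_RNP TYPE('w) TYPE('y)"
proof -
  obtain y :: 'y where "y \<noteq> 0" using y0 by blast
  obtain \<phi> :: "'y \<Rightarrow> real" where \<phi>: "linear \<phi>" "\<phi> y = norm y" "\<And>x. \<bar>\<phi> x\<bar> \<le> norm x"
    using norming_functional[of y] by blast
  define y0 where "y0 = y /\<^sub>R norm y"
  have b: "bounded_linear \<phi>" "\<phi> y0 = 1"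
    using \<phi> \<open>y \<noteq> 0\<close> by (auto simp: y0_def linear_scale bounded_linear_def bounded_linear_axioms_def intro!: exI[of _ 1])
  have sub: "subspace {y. \<phi> y = 0}"
    by (auto simp: subspace_def linear_0[OF \<phi>(1)] linear_add[OF \<phi>(1)] linear_scale[OF \<phi>(1)])
  show ?thesis
  proof (rule RNP_of_dentable[OF b], rule ccontr)
    fix K and e :: real
    assume K: "K \<subseteq> {y. \<phi> y = 0}" "K \<noteq> {}" "bounded K" "0 < e"
      and "\<not> (\<exists>x\<in>K. x \<notin> closure (convex hull (K - ball x e)))"
    then have nd: "\<And>x. x \<in> K \<Longrightarrow> x \<in> closure (convex hull (K - ball x e))" by blast
    obtain K' where "bush K' (e / 2)" "K' \<subseteq> {y. \<phi> y = 0}"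
      by (rule bush_of_nondentable[OF K(2,3,4) sub K(1) nd])
    from SNA_not_Der_of_bush[OF x0 b this] all show False by blast
  qed
qed

section \<open>The vector measure of a Lipschitz curve\<close>

text \<open>Dominated convergence for series in a Banach space, reduced to Tannery's theorem for the
  real series of norms of a n i - b i, dominated by 2 * c i.\<close>

lemma suminf_dominated_tendsto:
  fixes a :: "nat \<Rightarrow> nat \<Rightarrow> 'a::banach"
  assumes lim: "\<And>i. (\<lambda>n. a n i) \<longlonglongrightarrow> b i" and bound: "\<And>n i. norm (a n i) \<le> c i" and c: "summable c"
  shows "summable b" "(\<lambda>n. \<Sum>i. a n i) \<longlonglongrightarrow> (\<Sum>i. b i)"
proof -
  have b: "norm (b i) \<le> c i" for i
    by (rule LIMSEQ_le_const2[OF tendsto_norm[OF lim]]) (use bound in auto)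
  have sa: "summable (a n)" for n by (rule summable_comparison_test'[OF c, of 0]) (rule bound)
  show sb: "summable b" by (rule summable_comparison_test'[OF c, of 0]) (rule b)
  have nb: "norm (norm (a n i - b i)) \<le> 2 * c i" for n i
    using norm_triangle_ineq4[of "a n i" "b i"] bound[of n i] b[of i] by simp
  have c2: "summable (\<lambda>i. 2 * c i)" using c by (rule summable_mult)
  have sn: "summable (\<lambda>i. norm (a n i - b i))" for n
    by (rule summable_comparison_test'[OF c2, of 0]) (rule nb)
  have "(\<lambda>n. \<Sum>i. norm (a n i - b i)) \<longlonglongrightarrow> (\<Sum>i::nat. 0)"
  proof (rule tannerys_theorem[THEN conjunct2, THEN conjunct2, OF _ _ c2])
    show "(\<lambda>n. norm (a n i - b i)) \<longlonglongrightarrow> 0" for i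
      by (intro tendsto_norm_zero LIM_zero lim)
    show "\<forall>\<^sub>F (i, n) in sequentially \<times>\<^sub>F sequentially. norm (norm (a n i - b i)) \<le> 2 * c i"
      using nb by (intro always_eventually) auto
  qed simp
  then have 0: "(\<lambda>n. \<Sum>i. norm (a n i - b i)) \<longlonglongrightarrow> 0" by simp
  have "norm ((\<Sum>i. a n i) - (\<Sum>i. b i)) \<le> (\<Sum>i. norm (a n i - b i))" for n
    using summable_norm[OF sn[of n]] by (simp add: suminf_diff[OF sa sb])
  then have "(\<lambda>n. (\<Sum>i. a n i) - (\<Sum>i. b i)) \<longlonglongrightarrow> 0"
    by (intro Lim_null_comparison[OF _ 0] always_eventually allI)
  then show "(\<lambda>n. \<Sum>i. a n i) \<longlonglongrightarrow> (\<Sum>i. b i)" by (rule LIM_zero_cancel)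
qed

text \<open>Keeping the whole line as space lets half-lines generate the measurable sets and
  complements be taken in \<open>UNIV\<close>.\<close>

definition unit_measure :: "real measure" where
  "unit_measure = density lborel (indicator {0..<1})"

lemma sets_unit_measure [simp, measurable_cong]: "sets unit_measure = sets borel"
  and space_unit_measure [simp]: "space unit_measure = UNIV"
  by (auto simp: unit_measure_def)

lemma emeasure_unit_measure:
  "E \<in> sets borel \<Longrightarrow> emeasure unit_measure E = emeasure lborel (E \<inter> {0..<1})"
  by (simp add: unit_measure_def emeasure_density Int_commute flip: indicator_inter_arith)

lemma finite_measure_unit_measure: "finite_measure unit_measure"
proof
  show "emeasure unit_measure (space unit_measure) \<noteq> \<infinity>" by (simp add: emeasure_unit_measure)
qed

lemma measure_unit_measure:
  "E \<in> sets borel \<Longrightarrow> measure unit_measure E = measure lborel (E \<inter> {0..<1})"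
  by (simp add: measure_def emeasure_unit_measure)

text \<open>The vector measure of a Lipschitz curve \<open>g\<close> is the limit of the integrals of the difference
  quotients of \<open>g\<close> over a subdivision of the unit interval into \<open>Suc n\<close> cells.\<close>

context
  fixes g :: "real \<Rightarrow> 'y::banach" and L :: real
  assumes g: "\<And>t t'. norm (g t' - g t) \<le> L * \<bar>t' - t\<bar>"
begin

definition cell :: "nat \<Rightarrow> nat \<Rightarrow> real set" where
  "cell n k = {real k / Suc n ..< real (Suc k) / Suc n}"

definition cell_increment :: "nat \<Rightarrow> nat \<Rightarrow> 'y" where
  "cell_increment n k = g (real (Suc k) / Suc n) - g (real k / Suc n)"

definition step_measure :: "nat \<Rightarrow> real set \<Rightarrow> 'y" where
  "step_measure n E = (\<Sum>k<Suc n. (Suc n * measure lborel (E \<inter> cell n k)) *\<^sub>R cell_increment n k)"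

definition curve_measure :: "real set \<Rightarrow> 'y" where
  "curve_measure E = lim (\<lambda>n. step_measure n E)"

lemma L_nonneg: "0 \<le> L"
  using order_trans[OF norm_ge_zero g[of 1 0]] by simp

lemma cell_measurable: "E \<in> sets borel \<Longrightarrow> E \<inter> cell n k \<in> sets borel"
  by (simp add: cell_def)

lemma emeasure_cell_finite: "E \<in> sets borel \<Longrightarrow> emeasure lborel (E \<inter> cell n k) < \<infinity>"
proof -
  assume "E \<in> sets borel"
  have "emeasure lborel (E \<inter> cell n k) \<le> emeasure lborel (cell n k)"
    by (rule emeasure_mono) (auto simp: cell_def)
  also have "\<dots> < \<infinity>" by (simp add: cell_def divide_right_mono)
  finally show ?thesis .
qed

lemma norm_cell_increment: "Suc n * norm (cell_increment n k) \<le> L"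
proof -
  have "norm (cell_increment n k) \<le> L * \<bar>real (Suc k) / Suc n - real k / Suc n\<bar>"
    unfolding cell_increment_def by (rule g)
  also have "real (Suc k) / Suc n - real k / Suc n = 1 / Suc n" by (simp flip: diff_divide_distrib)
  finally show ?thesis by (simp add: field_simps)
qed

lemma cell_disjoint: "i \<noteq> j \<Longrightarrow> cell n i \<inter> cell n j = {}"
proof -
  have "cell n i \<inter> cell n j = {}" if "i < j" for i j
  proof -
    have "real (Suc i) / Suc n \<le> real j / Suc n" using that by (intro divide_right_mono) auto
    then show ?thesis by (auto simp: cell_def)
  qed
  then show "i \<noteq> j \<Longrightarrow> ?thesis" by (metis Int_commute nat_neq_iff)
qed

lemma cell_cover: "(\<Union>k<Suc n. cell n k) = {0..<1}"
proof (intro equalityI subsetI)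
  fix t assume "t \<in> (\<Union>k<Suc n. cell n k)"
  then obtain k where k: "k < Suc n" "real k / Suc n \<le> t" "t < real (Suc k) / Suc n" by (auto simp: cell_def)
  have "real (Suc k) / Suc n \<le> 1" using k(1) by simp
  moreover have "0 \<le> real k / Suc n" by simp
  ultimately show "t \<in> {0..<1}" unfolding atLeastLessThan_iff using k by linarith
next
  fix t :: real assume t: "t \<in> {0..<1}"
  define k where "k = nat \<lfloor>t * Suc n\<rfloor>"
  have k: "real k \<le> t * Suc n" "t * Suc n < real (Suc k)"
    using t by (simp_all add: k_def) linarith
  have "t * Suc n < 1 * real (Suc n)" using t by (intro mult_strict_right_mono) auto
  from le_less_trans[OF k(1) this] have "k < Suc n" by simp
  moreover have "t \<in> cell n k" using k by (simp add: cell_def field_simps)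
  ultimately show "t \<in> (\<Union>k<Suc n. cell n k)" by blast
qed

lemma measure_cells:
  assumes "E \<in> sets borel"
  shows "(\<Sum>k<Suc n. measure lborel (E \<inter> cell n k)) = measure unit_measure E"
proof -
  have "measure lborel (\<Union>k\<in>{..<Suc n}. E \<inter> cell n k) = (\<Sum>k<Suc n. measure lborel (E \<inter> cell n k))"
  proof (rule measure_finite_Union)
    show "disjoint_family_on (\<lambda>k. E \<inter> cell n k) {..<Suc n}"
      unfolding disjoint_family_on_def using cell_disjoint by blast
  qed (use assms emeasure_cell_finite in \<open>auto simp: cell_measurable less_top\<close>)
  moreover have "(\<Union>k\<in>{..<Suc n}. E \<inter> cell n k) = E \<inter> {0..<1}" using cell_cover[of n] by blast
  ultimately show ?thesis using assms by (simp add: measure_unit_measure)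
qed

lemma norm_step_measure:
  assumes E: "E \<in> sets borel"
  shows "norm (step_measure n E) \<le> L * measure unit_measure E"
proof -
  have "norm (step_measure n E) \<le> (\<Sum>k<Suc n. measure lborel (E \<inter> cell n k) * L)"
    unfolding step_measure_def
  proof (rule sum_norm_le)
    fix k
    have "norm ((Suc n * measure lborel (E \<inter> cell n k)) *\<^sub>R cell_increment n k) =
      measure lborel (E \<inter> cell n k) * (Suc n * norm (cell_increment n k))" by simp
    also have "\<dots> \<le> measure lborel (E \<inter> cell n k) * L"
      by (intro mult_left_mono norm_cell_increment) simp
    finally show "norm ((Suc n * measure lborel (E \<inter> cell n k)) *\<^sub>R cell_increment n k) \<le> measure lborel (E \<inter> cell n k) * L" .
  qed
  also have "\<dots> = measure unit_measure E * L"
    unfolding sum_distrib_right[symmetric] measure_cells[OF E] ..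
  finally show ?thesis by (simp add: mult.commute)
qed

lemma step_measure_sums:
  assumes A: "disjoint_family A" "\<And>i::nat. A i \<in> sets borel"
  shows "(\<lambda>i. step_measure n (A i)) sums step_measure n (\<Union>i. A i)"
  unfolding step_measure_def
proof (rule sums_sum)
  fix k
  have "(\<lambda>i. measure lborel (A i \<inter> cell n k)) sums measure lborel (\<Union>i. A i \<inter> cell n k)"
  proof (rule measure_UNION)
    show "disjoint_family (\<lambda>i. A i \<inter> cell n k)" using A(1) unfolding disjoint_family_on_def by blast
    have "(\<Union>i. A i \<inter> cell n k) = (\<Union>i. A i) \<inter> cell n k" by blast
    then show "emeasure lborel (\<Union>i. A i \<inter> cell n k) \<noteq> \<infinity>"
      using emeasure_cell_finite[of "\<Union>i. A i" n k] A(2) by auto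
  qed (use A(2) in \<open>auto simp: cell_measurable\<close>)
  moreover have "(\<Union>i. A i \<inter> cell n k) = (\<Union>i. A i) \<inter> cell n k" by blast
  ultimately show "(\<lambda>i. (Suc n * measure lborel (A i \<inter> cell n k)) *\<^sub>R cell_increment n k) sums
      ((Suc n * measure lborel ((\<Union>i. A i) \<inter> cell n k)) *\<^sub>R cell_increment n k)"
    by (intro sums_scaleR_left sums_mult) simp
qed

lemma telescope_cells: "m \<le> Suc n \<Longrightarrow> (\<Sum>k<m. cell_increment n k) = g (real m / Suc n) - g 0"
  unfolding cell_increment_def using sum_lessThan_telescope[of "\<lambda>k. g (real k / Suc n)" m] by simp

lemma measure_cell: "Suc n * measure lborel (cell n k) = 1"
proof -
  have "real k / Suc n \<le> real (Suc k) / Suc n" by (intro divide_right_mono) auto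
  then show ?thesis by (simp add: cell_def flip: diff_divide_distrib)
qed

text \<open>With \<open>m\<close> complete cells below \<open>b\<close> the sum telescopes to g (m /
  Suc n) - g 0. One error L / Suc n comes from the cell cut by \<open>b\<close> (absent if m = Suc
  n), the other from replacing m / Suc n by \<open>b\<close>.\<close>

lemma step_measure_lessThan:
  assumes b: "0 \<le> b" "b \<le> 1"
  shows "norm (step_measure n {..<b} - (g b - g 0)) \<le> 2 * L / Suc n"
proof -
  define m where "m = nat \<lfloor>b * Suc n\<rfloor>"
  have m: "real m \<le> b * Suc n" "b * Suc n < real (Suc m)"
    using b by (simp_all add: m_def) linarith
  have "b * Suc n \<le> 1 * real (Suc n)" using b by (intro mult_right_mono) auto
  from order_trans[OF m(1) this] have mn: "m \<le> Suc n" by simp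
  have below: "{..<b} \<inter> cell n k = cell n k" if "k < m" for k
  proof -
    have "real (Suc k) \<le> b * Suc n" using that m(1) by linarith
    then have "real (Suc k) / Suc n \<le> b" by (simp add: field_simps)
    then show ?thesis by (auto simp: cell_def)
  qed
  have above: "{..<b} \<inter> cell n k = {}" if "m < k" for k
  proof -
    have "b * Suc n \<le> real k" using that m(2) by linarith
    then have "b \<le> real k / Suc n" by (simp add: field_simps)
    then show ?thesis by (auto simp: cell_def)
  qed
  let ?f = "\<lambda>k. (Suc n * measure lborel ({..<b} \<inter> cell n k)) *\<^sub>R cell_increment n k"
  have low: "(\<Sum>k<m. ?f k) = g (real m / Suc n) - g 0"
  proof -
    have "(\<Sum>k<m. ?f k) = (\<Sum>k<m. cell_increment n k)"
      using measure_cell[of n] by (intro sum.cong) (simp_all add: below)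
    then show ?thesis using telescope_cells[OF mn] by simp
  qed
  have up: "norm (step_measure n {..<b} - (\<Sum>k<m. ?f k)) \<le> L / Suc n"
  proof (cases "m < Suc n")
    case False
    then have "m = Suc n" using mn by simp
    then show ?thesis using L_nonneg by (simp add: step_measure_def)
  next
    case True
    have "(\<Sum>k<Suc n. ?f k) = (\<Sum>k<Suc m. ?f k)"
      using True by (intro sum.mono_neutral_right) (auto simp: above)
    then have eq: "step_measure n {..<b} - (\<Sum>k<m. ?f k) = ?f m" by (simp add: step_measure_def)
    have "measure lborel ({..<b} \<inter> cell n m) \<le> measure lborel (cell n m)"
      using emeasure_cell_finite[of UNIV n m]
      by (intro measure_mono_fmeasurable) (auto simp: fmeasurable_def cell_def)
    then have "Suc n * measure lborel ({..<b} \<inter> cell n m) \<le> Suc n * measure lborel (cell n m)"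
      by (intro mult_left_mono) auto
    then have "Suc n * measure lborel ({..<b} \<inter> cell n m) \<le> 1" by (simp only: measure_cell)
    then have "norm (?f m) \<le> 1 * norm (cell_increment n m)"
      unfolding norm_scaleR by (intro mult_right_mono) auto
    also have "\<dots> \<le> L / Suc n" using norm_cell_increment[of n m] by (simp add: field_simps)
    finally show ?thesis unfolding eq .
  qed
  have "norm (g (real m / Suc n) - g b) \<le> L * \<bar>real m / Suc n - b\<bar>" by (rule g)
  also have "\<bar>real m / Suc n - b\<bar> \<le> 1 / Suc n"
  proof -
    have "real m / Suc n \<le> b" "b \<le> real (Suc m) / Suc n" using m by (simp_all add: field_simps)
    moreover have "real (Suc m) / Suc n = real m / Suc n + 1 / Suc n" by (simp add: add_divide_distrib)
    ultimately show ?thesis by linarith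
  qed
  then have "L * \<bar>real m / Suc n - b\<bar> \<le> L * (1 / Suc n)" using L_nonneg by (rule mult_left_mono)
  finally have gb: "norm (g (real m / Suc n) - g b) \<le> L / Suc n" by simp
  have eq: "step_measure n {..<b} - (g b - g 0) =
      (step_measure n {..<b} - (\<Sum>k<m. ?f k)) + (g (real m / Suc n) - g b)"
    unfolding low by simp
  show ?thesis
    unfolding eq by (rule order_trans[OF norm_triangle_le[OF add_mono[OF up gb]]]) simp
qed

lemma step_measure_lessThan_tendsto:
  assumes b: "0 \<le> b" "b \<le> 1"
  shows "(\<lambda>n. step_measure n {..<b}) \<longlonglongrightarrow> g b - g 0"
proof (rule LIM_zero_cancel, rule Lim_null_comparison[OF always_eventually], rule allI)
  show "norm (step_measure n {..<b} - (g b - g 0)) \<le> 2 * L * (1 / Suc n)" for n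
    using step_measure_lessThan[OF b] by simp
  show "(\<lambda>n. 2 * L * (1 / Suc n)) \<longlonglongrightarrow> 0"
    using tendsto_mult_left[OF LIMSEQ_inverse_real_of_nat, of "2 * L"] by (simp add: inverse_eq_divide)
qed

lemma step_measure_cong:
  assumes "E \<inter> {0..<1} = F \<inter> {0..<1}"
  shows "step_measure n E = step_measure n F"
proof -
  have "E \<inter> cell n k = F \<inter> cell n k" if "k < Suc n" for k
    using assms cell_cover[of n] that by blast
  then show ?thesis unfolding step_measure_def by (intro sum.cong) auto
qed

lemma summable_unit_measure:
  assumes "disjoint_family A" "\<And>i::nat. A i \<in> sets borel"
  shows "summable (\<lambda>i. L * measure unit_measure (A i))"
  using finite_measure.finite_measure_UNION[OF finite_measure_unit_measure, of A] assms
  by (intro summable_mult) (auto intro: sums_summable)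

text \<open>The sets on which the approximations converge form a Dynkin system: disjoint unions are
  handled by dominated convergence with majorant \<open>L\<close> times the measure. It contains the
  half-lines, which are stable under intersection and generate the Borel sets.\<close>

lemma step_measure_tendsto:
  assumes "E \<in> sets borel"
  shows "(\<lambda>n. step_measure n E) \<longlonglongrightarrow> curve_measure E"
proof -
  have "sets borel = sigma_sets UNIV (range (lessThan :: real \<Rightarrow> real set))"
    by (simp add: borel_Iio)
  with assms have E: "E \<in> sigma_sets UNIV (range (lessThan :: real \<Rightarrow> real set))" by simp
  have "Int_stable (range (lessThan :: real \<Rightarrow> real set))"
  proof (rule Int_stableI)
    fix A B :: "real set" assume "A \<in> range lessThan" "B \<in> range lessThan"
    then obtain a b where "A = {..<a}" "B = {..<b}" by blast
    then have "A \<inter> B = {..<min a b}" by auto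
    then show "A \<inter> B \<in> range lessThan" by blast
  qed
  moreover have "range (lessThan :: real \<Rightarrow> real set) \<subseteq> Pow UNIV" by simp
  ultimately have "convergent (\<lambda>n. step_measure n E)"
    using E
  proof (induction rule: sigma_sets_induct_disjoint)
    case (basic A)
    then obtain b where A: "A = {..<b}" by blast
    have "step_measure n A = step_measure n {..<max 0 (min 1 b)}" for n
      unfolding A by (rule step_measure_cong) auto
    then show ?case
      using step_measure_lessThan_tendsto[of "max 0 (min 1 b)"] by (auto simp: convergent_def)
  next
    case empty
    then show ?case by (simp add: step_measure_def convergent_const)
  next
    case (compl A)
    then have A: "A \<in> sets borel" by (simp add: borel_Iio)
    have "step_measure n (UNIV - A) = step_measure n {..<1} - step_measure n A" for n
    proof -
      have "measure lborel ((UNIV - A) \<inter> cell n k) = measure lborel (cell n k) - measure lborel (A \<inter> cell n k)" for k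
      proof -
        have "measure lborel (cell n k - A \<inter> cell n k) = measure lborel (cell n k) - measure lborel (A \<inter> cell n k)"
          using A emeasure_cell_finite[of UNIV n k] by (intro measure_Diff) (auto simp: cell_def)
        moreover have "cell n k - A \<inter> cell n k = (UNIV - A) \<inter> cell n k" by blast
        ultimately show ?thesis by simp
      qed
      then have "step_measure n (UNIV - A) = step_measure n UNIV - step_measure n A"
        by (simp only: step_measure_def right_diff_distrib scaleR_diff_left sum_subtractf Int_UNIV_left)
      moreover have "step_measure n UNIV = step_measure n {..<1}" by (rule step_measure_cong) auto
      ultimately show ?thesis by simp
    qed
    moreover have "convergent (\<lambda>n. step_measure n {..<1} - step_measure n A)"
      using step_measure_lessThan_tendsto[of 1] compl by (intro convergent_diff) (auto simp: convergent_def)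
    ultimately show ?case by simp
  next
    case (union A)
    have A: "A i \<in> sets borel" for i using union(2) by (auto simp: borel_Iio)
    have "(\<lambda>n. step_measure n (A i)) \<longlonglongrightarrow> lim (\<lambda>n. step_measure n (A i))" for i
      using union(3) by (simp add: convergent_LIMSEQ_iff)
    from suminf_dominated_tendsto(2)[OF this norm_step_measure[OF A] summable_unit_measure[OF union(1) A]]
    show ?case
      using sums_unique[OF step_measure_sums[OF union(1) A]] by (auto simp: convergent_def)
  qed
  then show ?thesis by (simp add: curve_measure_def convergent_LIMSEQ_iff)
qed

lemma norm_curve_measure:
  assumes "E \<in> sets borel"
  shows "norm (curve_measure E) \<le> L * measure unit_measure E"
  by (rule LIMSEQ_le_const2[OF tendsto_norm[OF step_measure_tendsto[OF assms]]])
    (use norm_step_measure[OF assms] in auto)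

lemma vector_measure_curve_measure: "vector_measure unit_measure curve_measure"
  unfolding vector_measure_def
proof (intro allI impI)
  fix A :: "nat \<Rightarrow> real set"
  assume "range A \<subseteq> sets unit_measure" and dj: "disjoint_family A"
  then have A: "A i \<in> sets borel" for i by auto
  note d = suminf_dominated_tendsto[OF step_measure_tendsto[OF A] norm_step_measure[OF A] summable_unit_measure[OF dj A]]
  have "(\<lambda>n. step_measure n (\<Union>i. A i)) \<longlonglongrightarrow> (\<Sum>i. curve_measure (A i))"
    using d(2) by (simp add: sums_unique[OF step_measure_sums[OF dj A], symmetric])
  moreover have "(\<lambda>n. step_measure n (\<Union>i. A i)) \<longlonglongrightarrow> curve_measure (\<Union>i. A i)"
    using A by (intro step_measure_tendsto) auto
  ultimately have "(\<Sum>i. curve_measure (A i)) = curve_measure (\<Union>i. A i)" by (rule LIMSEQ_unique)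
  then show "(\<lambda>i. curve_measure (A i)) sums curve_measure (\<Union>i. A i)"
    using summable_sums[OF d(1)] by simp
qed

lemma curve_measure_interval:
  assumes "0 \<le> a" "a \<le> b" "b \<le> 1"
  shows "curve_measure {a..<b} = g b - g a"
proof -
  have lt: "curve_measure {..<c} = g c - g 0" if "0 \<le> c" "c \<le> 1" for c
    using step_measure_tendsto[of "{..<c}"] step_measure_lessThan_tendsto[OF that]
    by (intro LIMSEQ_unique) auto
  have "curve_measure ({..<a} \<union> {a..<b}) = curve_measure {..<a} + curve_measure {a..<b}"
    by (intro vector_measure_Un[OF vector_measure_curve_measure]) auto
  moreover have "{..<a} \<union> {a..<b} = {..<b}" using assms by auto
  ultimately show ?thesis using lt[of a] lt[of b] assms by simp
qed

end

section \<open>Vector measures dominated by a scalar measure\<close>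

lemma dominated_continuous_wrt:
  assumes "\<And>E. E \<in> sets M \<Longrightarrow> norm (G E) \<le> L * measure M E" "0 \<le> L"
  shows "continuous_wrt M G"
  unfolding continuous_wrt_def
proof (intro allI impI)
  fix e :: real assume e: "0 < e"
  show "\<exists>\<delta>>0. \<forall>E\<in>sets M. measure M E < \<delta> \<longrightarrow> norm (G E) < e"
  proof (intro exI[of _ "e / (L + 1)"] conjI ballI impI)
    show "0 < e / (L + 1)" using e assms(2) by simp
    fix E assume E: "E \<in> sets M" "measure M E < e / (L + 1)"
    have "norm (G E) \<le> L * measure M E" by (rule assms(1)[OF E(1)])
    also have "\<dots> \<le> (L + 1) * measure M E" by (intro mult_right_mono) auto
    also have "\<dots> < e" using E(2) assms(2) by (simp add: field_simps)
    finally show "norm (G E) < e" .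
  qed
qed

lemma (in finite_measure) dominated_bounded_variation:
  assumes "\<And>E. E \<in> sets M \<Longrightarrow> norm (G E) \<le> L * measure M E"
  shows "bounded_variation M G"
  unfolding bounded_variation_def
proof (intro exI[of _ "L * measure M (space M)"] allI impI)
  fix P assume P: "finite P" "P \<subseteq> sets M" "disjoint P" "\<Union>P = space M"
  have "(\<Sum>E\<in>P. norm (G E)) \<le> (\<Sum>E\<in>P. L * measure M E)"
    using P(2) assms by (intro sum_mono) auto
  also have "\<dots> = L * (\<Sum>E\<in>P. measure M E)" by (simp add: sum_distrib_left)
  also have "(\<Sum>E\<in>P. measure M E) = measure M (\<Union>P)"
    using P by (intro finite_measure_finite_Union[of P "\<lambda>x. x", simplified, symmetric])
      (auto simp: disjoint_family_on_def dest: disjointD)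
  finally show "(\<Sum>E\<in>P. norm (G E)) \<le> L * measure M (space M)" by (simp add: P(4))
qed

section \<open>Differentiability of Lipschitz curves\<close>

text \<open>By Henstock's lemma the total length of disjoint intervals on which the average of \<open>u\<close> deviates
  from the value at the centre is small; Vitali's covering lemma turns this into a bound for
  the measure of the set of bad centres.\<close>

lemma negligible_bad_centres:
  fixes u :: "real \<Rightarrow> real"
  assumes u: "u integrable_on {a..b}" and \<eta>: "0 < \<eta>"
  shows "negligible {t\<in>{a<..<b}. \<forall>\<delta>>0. \<exists>r. 0 < r \<and> r < \<delta> \<and> cball t r \<subseteq> {a..b} \<and>
    \<eta> * (2 * r) < \<bar>2 * r * u t - integral (cball t r) u\<bar>}" (is "negligible ?S")
  unfolding negligible_outer_le
proof (intro allI impI)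
  fix e :: real assume e: "0 < e"
  \<comment> \<open>Each bad interval contributes more than \<open>\<eta>\<close> times its length,
    so disjoint ones have total length at most e / 5; the Vitali enlargement by 5 turns this into
    \<open>e\<close>.\<close>
  obtain \<gamma> where \<gamma>: "gauge \<gamma>" and hen: "\<And>p. p tagged_partial_division_of (cbox a b) \<Longrightarrow> \<gamma> fine p \<Longrightarrow>
      (\<Sum>(x,k)\<in>p. norm (measure lborel k *\<^sub>R u x - integral k u)) < e * \<eta> / 5"
    using Henstock_lemma[of u a b "e * \<eta> / 5"] u e \<eta> by auto
  have "\<exists>r. 0 < r \<and> r \<le> 1 \<and> cball t r \<subseteq> {a..b} \<and> cball t r \<subseteq> \<gamma> t \<and>
      \<eta> * (2 * r) < \<bar>2 * r * u t - integral (cball t r) u\<bar>" if t: "t \<in> ?S" for t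
  proof -
    obtain d where d: "0 < d" "ball t d \<subseteq> \<gamma> t"
      using \<gamma> unfolding gauge_def by (meson openE)
    \<comment> \<open>The 1 gives the uniform bound on radii that the Vitali covering lemma asks
      for.\<close>
    have "0 < min d 1" using d by simp
    then obtain r where r: "0 < r" "r < min d 1" "cball t r \<subseteq> {a..b}"
      "\<eta> * (2 * r) < \<bar>2 * r * u t - integral (cball t r) u\<bar>"
      using t by blast
    moreover have "cball t r \<subseteq> ball t d" using r(2) by auto
    ultimately show ?thesis using d(2) by (intro exI[of _ r]) auto
  qed
  then have "\<forall>t\<in>?S. \<exists>r. 0 < r \<and> r \<le> 1 \<and> cball t r \<subseteq> {a..b} \<and> cball t r \<subseteq> \<gamma> t \<and>
      \<eta> * (2 * r) < \<bar>2 * r * u t - integral (cball t r) u\<bar>" by blast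
  from bchoice[OF this] obtain r where r: "\<forall>t\<in>?S. 0 < r t \<and> r t \<le> 1 \<and> cball t (r t) \<subseteq> {a..b} \<and>
      cball t (r t) \<subseteq> \<gamma> t \<and> \<eta> * (2 * r t) < \<bar>2 * r t * u t - integral (cball t (r t)) u\<bar>" ..
  have cov: "?S \<subseteq> (\<Union>t\<in>?S. cball t (r t))"
  proof
    fix t assume t: "t \<in> ?S"
    then have "t \<in> cball t (r t)" using r[rule_format, OF t] by simp
    with t show "t \<in> (\<Union>t\<in>?S. cball t (r t))" by (rule UN_I)
  qed
  obtain C where C: "countable C" "C \<subseteq> ?S"
    "pairwise (\<lambda>i j. disjnt (cball i (r i)) (cball j (r j))) C"
    and cover: "?S \<subseteq> (\<Union>i\<in>C. cball i (5 * r i))"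
    by (rule Vitali_covering_lemma_cballs[OF cov, of 1]) (use r in auto)
  have rC: "0 < r t" "cball t (r t) \<subseteq> {a..b}" "cball t (r t) \<subseteq> \<gamma> t"
    "\<eta> * (2 * r t) < \<bar>2 * r t * u t - integral (cball t (r t)) u\<bar>" if "t \<in> C" for t
    using r C(2) that by auto
  have content: "measure lebesgue (cball t s) = 2 * s" if "0 \<le> s" for t s :: real
    using that by (simp add: cball_eq_atLeastAtMost)
  have bound: "(\<Sum>i\<in>F. measure lebesgue (cball i (5 * r i))) \<le> e" if F: "F \<subseteq> C" "finite F" for F
  proof -
    define p where "p = (\<lambda>t. (t, cball t (r t))) ` F"
    have inj: "inj_on (\<lambda>t. (t, cball t (r t))) F" by (rule inj_onI) simp
    have "p tagged_partial_division_of (cbox a b)"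
      unfolding tagged_partial_division_of_def
    proof (intro conjI allI impI)
      show "finite p" using F(2) by (simp add: p_def)
      fix t k assume "(t, k) \<in> p"
      then have t: "t \<in> C" "k = cball t (r t)" using F(1) by (auto simp: p_def)
      show "t \<in> k" using rC(1)[OF t(1)] t(2) by simp
      show "k \<subseteq> cbox a b" using rC(2)[OF t(1)] t(2) by simp
      show "\<exists>a b. k = cbox a b" unfolding t(2) cball_eq_atLeastAtMost by auto
    next
      fix t1 k1 t2 k2 assume *: "(t1, k1) \<in> p \<and> (t2, k2) \<in> p \<and> (t1, k1) \<noteq> (t2, k2)"
      then have t: "t1 \<in> C" "t2 \<in> C" "k1 = cball t1 (r t1)" "k2 = cball t2 (r t2)" "t1 \<noteq> t2"
        using F(1) by (auto simp: p_def)
      have "disjnt k1 k2" using pairwiseD[OF C(3) t(1,2,5)] t(3,4) by simp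
      then show "interior k1 \<inter> interior k2 = {}"
        using interior_subset unfolding disjnt_def by blast
    qed
    moreover have "\<gamma> fine p"
      unfolding fine_def p_def using rC(3) F(1) by auto
    ultimately have "(\<Sum>(x,k)\<in>p. norm (measure lborel k *\<^sub>R u x - integral k u)) < e * \<eta> / 5" by (rule hen)
    also have "(\<Sum>(x,k)\<in>p. norm (measure lborel k *\<^sub>R u x - integral k u)) =
        (\<Sum>t\<in>F. \<bar>2 * r t * u t - integral (cball t (r t)) u\<bar>)"
      unfolding p_def sum.reindex[OF inj] o_def case_prod_conv
    proof (rule sum.cong)
      fix t assume "t \<in> F"
      then have "0 < r t" using rC(1) F(1) by blast
      then have "measure lborel (cball t (r t)) = 2 * r t"
        by (simp add: cball_eq_atLeastAtMost)
      then show "norm (measure lborel (cball t (r t)) *\<^sub>R u t - integral (cball t (r t)) u) =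
          \<bar>2 * r t * u t - integral (cball t (r t)) u\<bar>" by simp
    qed simp
    finally have *: "(\<Sum>t\<in>F. \<bar>2 * r t * u t - integral (cball t (r t)) u\<bar>) < e * \<eta> / 5" .
    have "(\<Sum>t\<in>F. \<eta> * (2 * r t)) \<le> (\<Sum>t\<in>F. \<bar>2 * r t * u t - integral (cball t (r t)) u\<bar>)"
      using rC(4) F(1) by (intro sum_mono less_imp_le) blast
    also note *
    finally have "\<eta> * (\<Sum>t\<in>F. 2 * r t) \<le> \<eta> * (e / 5)"
      unfolding sum_distrib_left by (simp add: mult.commute[of e])
    then have "(\<Sum>t\<in>F. 2 * r t) \<le> e / 5" using \<eta> by simp
    moreover have "(\<Sum>i\<in>F. measure lebesgue (cball i (5 * r i))) = (\<Sum>i\<in>F. 5 * (2 * r i))"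
    proof (rule sum.cong)
      fix i assume "i \<in> F"
      then have "0 < r i" using rC(1) F(1) by blast
      then show "measure lebesgue (cball i (5 * r i)) = 5 * (2 * r i)" using content[of "5 * r i" i] by simp
    qed simp
    ultimately show ?thesis by (simp add: sum_distrib_left[symmetric])
  qed
  have bound: "measure lebesgue (\<Union>i\<in>F. cball i (5 * r i)) \<le> e" if F: "F \<subseteq> C" "finite F" for F
    by (rule order_trans[OF measure_UNION_le[OF F(2)] bound[OF F]]) simp
  show "\<exists>T. ?S \<subseteq> T \<and> T \<in> lmeasurable \<and> measure lebesgue T \<le> e"
  proof (intro exI conjI)
    show "?S \<subseteq> (\<Union>i\<in>C. cball i (5 * r i))" by (rule cover)
    show "(\<Union>i\<in>C. cball i (5 * r i)) \<in> lmeasurable"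
      by (rule fmeasurable_UN_bound[OF C(1) _ bound]) auto
    show "measure lebesgue (\<Union>i\<in>C. cball i (5 * r i)) \<le> e"
      by (rule measure_UN_bound[OF C(1) _ bound]) auto
  qed
qed

text \<open>The upper half of Lebesgue differentiation. It will be applied to norms of differences,
  where only upper bounds on averages matter.\<close>

lemma AE_lebesgue_point:
  fixes u :: "real \<Rightarrow> real"
  assumes u: "u integrable_on {a..b}"
  shows "AE t in lebesgue. t \<in> {a<..<b} \<longrightarrow> (\<forall>\<eta>>0. \<exists>\<delta>>0. \<forall>r. 0 < r \<and> r < \<delta> \<longrightarrow>
    integral (cball t r) u \<le> (u t + \<eta>) * (2 * r))"
proof -
  let ?S = "\<lambda>\<eta>. {t\<in>{a<..<b}. \<forall>\<delta>>0. \<exists>r. 0 < r \<and> r < \<delta> \<and> cball t r \<subseteq> {a..b} \<and>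
    \<eta> * (2 * r) < \<bar>2 * r * u t - integral (cball t r) u\<bar>}"
  have "?S (1 / Suc n) \<in> null_sets lebesgue" for n
    by (rule negligible_bad_centres[OF u, unfolded negligible_iff_null_sets]) simp
  then have "AE t in lebesgue. \<forall>n. t \<notin> ?S (1 / Suc n)"
    unfolding AE_all_countable by (intro allI AE_not_in)
  then show ?thesis
  proof eventually_elim
    fix t assume ae: "\<forall>n. t \<notin> ?S (1 / Suc n)"
    show "t \<in> {a<..<b} \<longrightarrow> (\<forall>\<eta>>0. \<exists>\<delta>>0. \<forall>r. 0 < r \<and> r < \<delta> \<longrightarrow>
      integral (cball t r) u \<le> (u t + \<eta>) * (2 * r))"
    proof (intro impI allI)
      fix \<eta> :: real assume t: "t \<in> {a<..<b}" and "0 < \<eta>"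
      then obtain n where n: "1 / Suc n < \<eta>" using nat_approx_posE by blast
      have "\<not> (\<forall>\<delta>>0. \<exists>r. 0 < r \<and> r < \<delta> \<and> cball t r \<subseteq> {a..b} \<and>
          1 / Suc n * (2 * r) < \<bar>2 * r * u t - integral (cball t r) u\<bar>)"
        using ae[rule_format, of n] t by blast
      then obtain \<delta> where \<delta>: "0 < \<delta>" "\<not> (\<exists>r. 0 < r \<and> r < \<delta> \<and> cball t r \<subseteq> {a..b} \<and>
          1 / Suc n * (2 * r) < \<bar>2 * r * u t - integral (cball t r) u\<bar>)"
        by blast
      show "\<exists>\<delta>>0. \<forall>r. 0 < r \<and> r < \<delta> \<longrightarrow> integral (cball t r) u \<le> (u t + \<eta>) * (2 * r)"
      proof (intro exI[of _ "min \<delta> (min (t - a) (b - t))"] conjI allI impI)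
        show "0 < min \<delta> (min (t - a) (b - t))" using \<delta>(1) t by simp
        fix r assume r: "0 < r \<and> r < min \<delta> (min (t - a) (b - t))"
        then have "cball t r \<subseteq> {a..b}" by (auto simp: cball_eq_atLeastAtMost)
        with \<delta>(2) r have "\<not> 1 / Suc n * (2 * r) < \<bar>2 * r * u t - integral (cball t r) u\<bar>"
          unfolding min_less_iff_conj by blast
        then have "\<bar>2 * r * u t - integral (cball t r) u\<bar> \<le> 1 / Suc n * (2 * r)" by linarith
        also have "\<dots> \<le> \<eta> * (2 * r)" using n r by (intro mult_right_mono) auto
        finally have "integral (cball t r) u \<le> 2 * r * u t + \<eta> * (2 * r)" by linarith
        then show "integral (cball t r) u \<le> (u t + \<eta>) * (2 * r)" by (simp add: algebra_simps)
      qed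
    qed
  qed
qed

section \<open>Norm estimates for Bochner integrals without separability\<close>

lemma measurable_norm_diff_simple:
  assumes f: "f \<in> borel_measurable M" and s: "simple_function M s"
  shows "(\<lambda>w. norm (f w - s w)) \<in> borel_measurable M"
\<comment> \<open>A simple function takes finitely many values; on each level set the difference is
  \<open>f\<close> minus a constant.\<close>
proof (rule measurable_compose_countable'[where f = "\<lambda>y w. norm (f w - y)" and g = s and I = "s ` space M"])
  show "(\<lambda>w. norm (f w - y)) \<in> borel_measurable M" for y
    by (rule measurable_compose[OF f]) (intro borel_measurable_continuous_onI continuous_intros)
  show "s \<in> measurable M (count_space (s ` space M))"
    using s by (auto simp: measurable_count_space_eq2 simple_function_def)
  show "countable (s ` space M)" using s by (intro countable_finite) (simp add: simple_function_def)
qed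

lemma measurable_norm_diff_const:
  assumes f: "f \<in> borel_measurable M"
  shows "(\<lambda>w. norm (f w - y)) \<in> borel_measurable M"
  by (rule measurable_compose[OF f]) (intro borel_measurable_continuous_onI continuous_intros)

text \<open>The norm inequality for the integral of g - y over \<open>E\<close>. It holds for simple
  functions, and the L1 error of the approximating sequence disappears in the limit.\<close>

lemma has_bochner_integral'_norm_le:
  assumes fm: "finite_measure M" and g: "has_bochner_integral' M (\<lambda>w. indicator E w *\<^sub>R g w) x"
    and gm: "g \<in> borel_measurable M" and E: "E \<in> sets M"
  shows "ennreal (norm (x - measure M E *\<^sub>R y)) \<le> (\<integral>\<^sup>+w. indicator E w * ennreal (norm (g w - y)) \<partial>M)"
proof -
  interpret finite_measure M by fact
  from g[unfolded has_bochner_integral'_def] obtain s where f: "(\<lambda>w. indicator E w *\<^sub>R g w) \<in> borel_measurable M"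
    and s: "\<forall>i. Bochner_Integration.simple_bochner_integrable M (s i)"
    and lim: "(\<lambda>i. \<integral>\<^sup>+w. ennreal (norm (indicator E w *\<^sub>R g w - s i w)) \<partial>M) \<longlonglongrightarrow> 0"
    and int: "(\<lambda>i. Bochner_Integration.simple_bochner_integral M (s i)) \<longlonglongrightarrow> x"
    by (elim conjE exE)
  let ?b = "\<integral>\<^sup>+w. indicator E w * ennreal (norm (g w - y)) \<partial>M"
  \<comment> \<open>A sum with one term, to match
    \<open>simple_bochner_integral_indicator_sum\<close>.\<close>
  let ?c = "\<lambda>w. \<Sum>i\<in>{()}. indicator E w *\<^sub>R y"
  have c: "Bochner_Integration.simple_bochner_integrable M ?c"
    "Bochner_Integration.simple_bochner_integral M ?c = measure M E *\<^sub>R y"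
    using simple_bochner_integral_indicator_sum[of "{()}" "\<lambda>_. E" M "\<lambda>_. y"] E
    by (auto simp: less_top[symmetric])
  have le: "ennreal (norm (Bochner_Integration.simple_bochner_integral M (s i) - measure M E *\<^sub>R y)) \<le>
      (\<integral>\<^sup>+w. ennreal (norm (indicator E w *\<^sub>R g w - s i w)) \<partial>M) + ?b" for i
  proof -
    have si: "Bochner_Integration.simple_bochner_integrable M (s i)" using s ..
    have d: "Bochner_Integration.simple_bochner_integrable M (\<lambda>w. s i w - ?c w)"
      using Bochner_Integration.simple_bochner_integrable_compose2[where p = "\<lambda>a b. a - b", OF _ si c(1)] by simp
    have dn: "Bochner_Integration.simple_bochner_integrable M (\<lambda>w. norm (s i w - ?c w))"
      using Bochner_Integration.simple_bochner_integrable_compose2[where p = "\<lambda>a b. norm a", OF _ d d] by simp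
    have "norm (Bochner_Integration.simple_bochner_integral M (s i) - measure M E *\<^sub>R y) \<le>
        Bochner_Integration.simple_bochner_integral M (\<lambda>w. norm (s i w - ?c w))"
      using Bochner_Integration.simple_bochner_integral_norm_bound[OF d]
      unfolding Bochner_Integration.simple_bochner_integral_diff[OF si c(1)] c(2) .
    then have "ennreal (norm (Bochner_Integration.simple_bochner_integral M (s i) - measure M E *\<^sub>R y)) \<le>
        ennreal (Bochner_Integration.simple_bochner_integral M (\<lambda>w. norm (s i w - ?c w)))"
      by (rule ennreal_leI)
    also have "\<dots> = (\<integral>\<^sup>+w. ennreal (norm (s i w - ?c w)) \<partial>M)"
      using Bochner_Integration.simple_bochner_integral_eq_nn_integral[OF dn] by simp
    also have "\<dots> \<le> (\<integral>\<^sup>+w. ennreal (norm (indicator E w *\<^sub>R g w - s i w)) + indicator E w * ennreal (norm (g w - y)) \<partial>M)"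
    proof (rule nn_integral_mono)
      fix w
      have "norm (s i w - indicator E w *\<^sub>R y) \<le>
          norm (indicator E w *\<^sub>R g w - s i w) + indicator E w * norm (g w - y)"
        using dist_triangle2[of "s i w" "indicator E w *\<^sub>R y" "indicator E w *\<^sub>R g w"]
        by (cases "w \<in> E") (auto simp: dist_norm norm_minus_commute)
      then have "ennreal (norm (s i w - indicator E w *\<^sub>R y)) \<le>
          ennreal (norm (indicator E w *\<^sub>R g w - s i w) + indicator E w * norm (g w - y))"
        by (rule ennreal_leI)
      then show "ennreal (norm (s i w - ?c w)) \<le> ennreal (norm (indicator E w *\<^sub>R g w - s i w)) + indicator E w * ennreal (norm (g w - y))"
        by (cases "w \<in> E") auto
    qed
    also have "\<dots> = (\<integral>\<^sup>+w. ennreal (norm (indicator E w *\<^sub>R g w - s i w)) \<partial>M) + ?b"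
    proof (rule nn_integral_add)
      have "simple_function M (s i)" using si by (cases rule: Bochner_Integration.simple_bochner_integrable.cases)
      then show "(\<lambda>w. ennreal (norm (indicator E w *\<^sub>R g w - s i w))) \<in> borel_measurable M"
        by (intro measurable_compose[OF measurable_norm_diff_simple[OF f]]) auto
      show "(\<lambda>w. indicator E w * ennreal (norm (g w - y))) \<in> borel_measurable M"
        using E measurable_norm_diff_const[OF gm, of y] by measurable
    qed
    finally show ?thesis .
  qed
  have 1: "(\<lambda>i. ennreal (norm (Bochner_Integration.simple_bochner_integral M (s i) - measure M E *\<^sub>R y)))
     \<longlonglongrightarrow> ennreal (norm (x - measure M E *\<^sub>R y))"
    by (intro tendsto_ennrealI tendsto_norm tendsto_diff int tendsto_const)
  have 2: "(\<lambda>i. (\<integral>\<^sup>+w. ennreal (norm (indicator E w *\<^sub>R g w - s i w)) \<partial>M) + ?b) \<longlonglongrightarrow> 0 + ?b"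
    by (intro tendsto_add lim tendsto_const)
  have "ennreal (norm (x - measure M E *\<^sub>R y)) \<le> 0 + ?b"
    by (rule LIMSEQ_le[OF 1 2]) (use le in blast)
  then show ?thesis by simp
qed

lemma has_bochner_integral'_integrable:
  assumes fm: "finite_measure M" and g: "has_bochner_integral' M g x"
  shows "(\<integral>\<^sup>+w. ennreal (norm (g w - y)) \<partial>M) < \<infinity>"
proof -
  interpret finite_measure M by fact
  from g[unfolded has_bochner_integral'_def] obtain s where gm: "g \<in> borel_measurable M"
    and s: "\<forall>i. Bochner_Integration.simple_bochner_integrable M (s i)"
    and lim: "(\<lambda>i. \<integral>\<^sup>+w. ennreal (norm (g w - s i w)) \<partial>M) \<longlonglongrightarrow> 0"
    by (elim conjE exE)
  have "\<forall>\<^sub>F i in sequentially. (\<integral>\<^sup>+w. ennreal (norm (g w - s i w)) \<partial>M) < 1"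
    by (rule order_tendstoD[OF lim]) simp
  then obtain i where i: "(\<integral>\<^sup>+w. ennreal (norm (g w - s i w)) \<partial>M) < 1"
    by (auto simp: eventually_sequentially)
  have si: "simple_function M (s i)" using s[rule_format, of i]
    by (cases rule: Bochner_Integration.simple_bochner_integrable.cases)
  then have "finite (s i ` space M)" by (simp add: simple_function_def)
  then have "bounded ((\<lambda>w. s i w - y) ` space M)"
    by (intro finite_imp_bounded) (simp add: image_image[of "\<lambda>v. v - y" "s i", symmetric])
  then obtain B where B: "\<And>w. w \<in> space M \<Longrightarrow> norm (s i w - y) \<le> B" by (auto simp: bounded_iff)
  have "(\<integral>\<^sup>+w. ennreal (norm (g w - y)) \<partial>M) \<le> (\<integral>\<^sup>+w. ennreal (norm (g w - s i w)) + ennreal B \<partial>M)"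
  proof (rule nn_integral_mono)
    fix w assume w: "w \<in> space M"
    have "norm (g w - y) \<le> norm (g w - s i w) + norm (s i w - y)"
      using dist_triangle[of "g w" y "s i w"] by (simp add: dist_norm)
    then have "norm (g w - y) \<le> norm (g w - s i w) + B" using B[OF w] by linarith
    moreover have "0 \<le> B" using B[OF w] norm_ge_zero order_trans by blast
    ultimately show "ennreal (norm (g w - y)) \<le> ennreal (norm (g w - s i w)) + ennreal B"
      by (simp flip: ennreal_plus)
  qed
  also have "\<dots> = (\<integral>\<^sup>+w. ennreal (norm (g w - s i w)) \<partial>M) + (\<integral>\<^sup>+w. ennreal B \<partial>M)"
    by (intro nn_integral_add measurable_compose[OF measurable_norm_diff_simple[OF gm si]]) auto
  also have "\<dots> < \<infinity>"
  proof -
    have "(\<integral>\<^sup>+w. ennreal (norm (g w - s i w)) \<partial>M) < top" by (rule order.strict_trans[OF i]) simp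
    moreover have "(\<integral>\<^sup>+w. ennreal B \<partial>M) < top" by (simp add: emeasure_eq_measure ennreal_mult_less_top)
    ultimately show ?thesis by (simp add: ennreal_add_less_top)
  qed
  finally show ?thesis .
qed

text \<open>\<open>D\<close> collects the values of all approximating simple functions. Where
  \<open>g\<close> stays at distance at least \<epsilon> from \<open>D\<close> it is that far from
  every approximant, so by Markov's inequality this set is null.\<close>

lemma has_bochner_integral'_separable:
  assumes fm: "finite_measure M" and g: "has_bochner_integral' M g x"
  obtains D where "countable D" "AE w in M. \<forall>\<epsilon>>0. \<exists>y\<in>D. norm (g w - y) < \<epsilon>"
proof -
  interpret finite_measure M by fact
  from g[unfolded has_bochner_integral'_def] obtain s where gm: "g \<in> borel_measurable M"
    and s: "\<forall>i. Bochner_Integration.simple_bochner_integrable M (s i)"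
    and lim: "(\<lambda>i. \<integral>\<^sup>+w. ennreal (norm (g w - s i w)) \<partial>M) \<longlonglongrightarrow> 0"
    by (elim conjE exE)
  define D where "D = (\<Union>i. s i ` space M)"
  have "finite (s i ` space M)" for i
    using s[rule_format, of i]
    by (cases rule: Bochner_Integration.simple_bochner_integrable.cases) (simp add: simple_function_def)
  then have cD: "countable D" unfolding D_def by (intro countable_UN) (auto intro: countable_finite)
  have "AE w in M. \<exists>y\<in>D. norm (g w - y) < \<epsilon>" if \<epsilon>: "0 < \<epsilon>" for \<epsilon>
  proof -
    let ?B = "{w\<in>space M. \<forall>y\<in>D. \<epsilon> \<le> norm (g w - y)}"
    have B: "?B \<in> sets M"
      using cD measurable_norm_diff_const[OF gm] by (intro sets.sets_Collect_countable_All' borel_measurable_le) auto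
    have "ennreal \<epsilon> * emeasure M ?B \<le> (\<integral>\<^sup>+w. ennreal (norm (g w - s i w)) \<partial>M)" for i
    proof -
      have "ennreal \<epsilon> * emeasure M ?B = (\<integral>\<^sup>+w. ennreal \<epsilon> * indicator ?B w \<partial>M)"
        using B by (simp add: nn_integral_cmult_indicator)
      also have "\<dots> \<le> (\<integral>\<^sup>+w. ennreal (norm (g w - s i w)) \<partial>M)"
      proof (rule nn_integral_mono)
        fix w assume w: "w \<in> space M"
        show "ennreal \<epsilon> * indicator ?B w \<le> ennreal (norm (g w - s i w))"
        proof (cases "w \<in> ?B")
          case True
          then have "\<epsilon> \<le> norm (g w - s i w)" using w by (auto simp: D_def)
          then show ?thesis using True by (simp add: ennreal_leI)
        qed simp
      qed
      finally show ?thesis .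
    qed
    then have "ennreal \<epsilon> * emeasure M ?B \<le> 0"
      by (intro LIMSEQ_le_const[OF lim]) auto
    then have "emeasure M ?B = 0" using \<epsilon> by simp
    then have "AE w in M. w \<notin> ?B" using B by (intro AE_not_in) (simp add: null_sets_def)
    then show ?thesis using AE_space by eventually_elim (auto simp: not_le)
  qed
  then have "AE w in M. \<forall>n. \<exists>y\<in>D. norm (g w - y) < 1 / Suc n"
    unfolding AE_all_countable by simp
  then have "AE w in M. \<forall>\<epsilon>>0. \<exists>y\<in>D. norm (g w - y) < \<epsilon>"
  proof eventually_elim
    fix w assume w: "\<forall>n. \<exists>y\<in>D. norm (g w - y) < 1 / Suc n"
    show "\<forall>\<epsilon>>0. \<exists>y\<in>D. norm (g w - y) < \<epsilon>"
    proof (intro allI impI)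
      fix \<epsilon> :: real assume "0 < \<epsilon>"
      then obtain n where "1 / Suc n < \<epsilon>" using nat_approx_posE by blast
      then show "\<exists>y\<in>D. norm (g w - y) < \<epsilon>" using w by (meson less_trans)
    qed
  qed
  with cD show thesis by (rule that)
qed

section \<open>Lebesgue points of the density of a curve\<close>

lemma AE_unit_measure_imp_lebesgue:
  assumes "AE t in unit_measure. P t"
  shows "AE t in lebesgue. t \<in> {0..<1} \<longrightarrow> P t"
proof -
  have "AE t in lborel. t \<in> {0..<1} \<longrightarrow> P t"
    using assms unfolding unit_measure_def by (subst (asm) AE_density) (auto simp: indicator_def)
  then show ?thesis by (rule AE_completion)
qed

text \<open>The density \<open>h\<close> satisfies \<open>g b - g a = \<integral>h\<close>, expressed through the resulting estimate.\<close>

lemma RNP_curve_density: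
  fixes g :: "real \<Rightarrow> 'y::banach"
  assumes rnp: "has_RNP TYPE('v + real) TYPE('y)" and g: "\<And>t t'. norm (g t' - g t) \<le> L * \<bar>t' - t\<bar>"
  obtains h D where "h \<in> borel_measurable borel" "countable D"
    "AE t in unit_measure. \<forall>\<epsilon>>0. \<exists>y\<in>D. norm (h t - y) < \<epsilon>"
    "\<forall>y. (\<integral>\<^sup>+t. ennreal (norm (h t - y)) \<partial>unit_measure) < \<infinity>"
    "\<forall>a b y. 0 \<le> a \<longrightarrow> a \<le> b \<longrightarrow> b \<le> 1 \<longrightarrow> ennreal (norm (g b - g a - (b - a) *\<^sub>R y)) \<le>
       (\<integral>\<^sup>+t. indicator {a..<b} t * ennreal (norm (h t - y)) \<partial>unit_measure)"
proof -
  \<comment> \<open>The unit interval is transported into the universe type; the summand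
    \<open>'v\<close> lies outside the space of \<open>M\<close>.\<close>
  let ?i = "Inr :: real \<Rightarrow> 'v + real"
  define M where "M = embed_measure unit_measure ?i"
  define G where "G E = curve_measure g (?i -` E)" for E
  have inj: "inj ?i" by simp
  have iM: "?i \<in> measurable unit_measure M" unfolding M_def by (rule measurable_embed_measure2[OF inj])
  have vim: "?i -` E \<in> sets borel" if "E \<in> sets M" for E
    using measurable_sets[OF iM that] by simp
  have em: "emeasure M E = emeasure unit_measure (?i -` E)" if "E \<in> sets M" for E
    using that unfolding M_def by (simp add: emeasure_embed_measure[OF inj])
  then have me: "measure M E = measure unit_measure (?i -` E)" if "E \<in> sets M" for E
    using that by (simp add: measure_def)
  interpret U: finite_measure unit_measure by (rule finite_measure_unit_measure)
  interpret finite_measure M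
    by (rule finite_measureI) (simp add: em[OF sets.top])
  have fm: "finite_measure M" by unfold_locales
  have dom: "norm (G E) \<le> L * measure M E" if "E \<in> sets M" for E
    unfolding G_def me[OF that] by (rule norm_curve_measure[OF g vim[OF that]])
  have L: "0 \<le> L" by (rule L_nonneg[OF g])
  have cw: "continuous_wrt M G" by (rule dominated_continuous_wrt[OF _ L]) (rule dom)
  have bv: "bounded_variation M G" by (rule dominated_bounded_variation) (rule dom)
  have vm: "vector_measure M G"
    unfolding vector_measure_def
  proof (intro allI impI)
    fix A :: "nat \<Rightarrow> ('v + real) set" assume A: "range A \<subseteq> sets M" "disjoint_family A"
    have "(\<lambda>n. curve_measure g (?i -` A n)) sums curve_measure g (\<Union>n. ?i -` A n)"
    proof (rule vector_measure_sums[OF vector_measure_curve_measure[OF g]])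
      show "disjoint_family (\<lambda>n. ?i -` A n)" using A(2) unfolding disjoint_family_on_def by blast
      show "?i -` A n \<in> sets unit_measure" for n using A(1) vim[of "A n"] by auto
    qed
    then show "(\<lambda>n. G (A n)) sums G (\<Union>n. A n)" by (simp add: G_def vimage_UN)
  qed
  from rnp[unfolded has_RNP_def, rule_format, OF fm vm cw bv]
  obtain h' where "(\<exists>I. has_bochner_integral' M h' I) \<and>
      (\<forall>E\<in>sets M. has_bochner_integral' M (\<lambda>w. indicator E w *\<^sub>R h' w) (G E))" by (elim exE)
  then obtain I where h'I: "has_bochner_integral' M h' I"
    and h'E: "\<forall>E\<in>sets M. has_bochner_integral' M (\<lambda>w. indicator E w *\<^sub>R h' w) (G E)" by (elim conjE exE)
  have h'm: "h' \<in> borel_measurable M" using h'I unfolding has_bochner_integral'_def by (elim conjE)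
  define h where "h t = h' (?i t)" for t
  have hm: "h \<in> borel_measurable borel"
    using measurable_compose[OF iM h'm] by (simp add: h_def[abs_def])
  obtain D where D: "countable D" "AE w in M. \<forall>\<epsilon>>0. \<exists>y\<in>D. norm (h' w - y) < \<epsilon>"
    by (rule has_bochner_integral'_separable[OF fm h'I])
  have D2: "AE t in unit_measure. \<forall>\<epsilon>>0. \<exists>y\<in>D. norm (h t - y) < \<epsilon>"
    using D(2) unfolding M_def by (simp add: AE_embed_measure[OF inj] h_def)
  have fin: "(\<integral>\<^sup>+t. ennreal (norm (h t - y)) \<partial>unit_measure) < \<infinity>" for y
  proof -
    have "(\<lambda>w. ennreal (norm (h' w - y))) \<in> borel_measurable M"
      using measurable_norm_diff_const[OF h'm, of y] by measurable
    then have "(\<integral>\<^sup>+w. ennreal (norm (h' w - y)) \<partial>M) = (\<integral>\<^sup>+t. ennreal (norm (h t - y)) \<partial>unit_measure)"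
      unfolding M_def h_def by (rule nn_integral_embed_measure[OF inj])
    then show ?thesis using has_bochner_integral'_integrable[OF fm h'I, of y] by simp
  qed
  have est: "ennreal (norm (g b - g a - (b - a) *\<^sub>R y)) \<le>
       (\<integral>\<^sup>+t. indicator {a..<b} t * ennreal (norm (h t - y)) \<partial>unit_measure)"
    if ab: "0 \<le> a" "a \<le> b" "b \<le> 1" for a b y
  proof -
    let ?E = "?i ` {a..<b}"
    have E: "?E \<in> sets M" unfolding M_def by (rule in_sets_embed_measure) simp
    have vE: "?i -` ?E = {a..<b}" by auto
    have GE: "G ?E = g b - g a" unfolding G_def vE by (rule curve_measure_interval[OF g ab])
    have "{a..<b} \<inter> {0..<1} = {a..<b}" using ab by auto
    then have mE: "measure M ?E = b - a" using ab by (simp add: me[OF E] vE measure_unit_measure)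
    have m: "(\<lambda>w. indicator ?E w * ennreal (norm (h' w - y))) \<in> borel_measurable M"
      using E measurable_norm_diff_const[OF h'm, of y] by measurable
    have "ennreal (norm (G ?E - measure M ?E *\<^sub>R y)) \<le> (\<integral>\<^sup>+w. indicator ?E w * ennreal (norm (h' w - y)) \<partial>M)"
      by (rule has_bochner_integral'_norm_le[OF fm h'E[rule_format, OF E] h'm E])
    also have "\<dots> = (\<integral>\<^sup>+t. indicator ?E (?i t) * ennreal (norm (h t - y)) \<partial>unit_measure)"
      unfolding h_def M_def by (rule nn_integral_embed_measure[OF inj m[unfolded M_def]])
    also have "\<dots> = (\<integral>\<^sup>+t. indicator {a..<b} t * ennreal (norm (h t - y)) \<partial>unit_measure)"
      by (intro nn_integral_cong) (auto simp: indicator_def)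
    finally show ?thesis unfolding GE mE .
  qed
  show thesis using hm D(1) D2 fin est by (intro that[of h D]) blast+
qed

text \<open>The scalar Lebesgue theorem is applied to norm (h t - y) for every \<open>y\<close> in
  the countable set \<open>D\<close>. Almost every \<open>t\<close> is good for all of them at once,
  and some \<open>y\<close> in \<open>D\<close> is as close to \<open>h t\<close> as
  desired.\<close>

lemma RNP_curve_differentiable:
  fixes g :: "real \<Rightarrow> 'y::banach"
  assumes rnp: "has_RNP TYPE('v + real) TYPE('y)" and g: "\<And>t t'. norm (g t' - g t) \<le> L * \<bar>t' - t\<bar>"
  obtains t z where "0 < t" "t < 1" "(g has_vector_derivative z) (at t)"
proof -
  obtain h D where hm: "h \<in> borel_measurable borel" and D: "countable D"
    "AE t in unit_measure. \<forall>\<epsilon>>0. \<exists>y\<in>D. norm (h t - y) < \<epsilon>"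
    and fin: "\<forall>y. (\<integral>\<^sup>+t. ennreal (norm (h t - y)) \<partial>unit_measure) < \<infinity>"
    and est: "\<forall>a b y. 0 \<le> a \<longrightarrow> a \<le> b \<longrightarrow> b \<le> 1 \<longrightarrow> ennreal (norm (g b - g a - (b - a) *\<^sub>R y)) \<le>
       (\<integral>\<^sup>+t. indicator {a..<b} t * ennreal (norm (h t - y)) \<partial>unit_measure)"
    by (rule RNP_curve_density[OF rnp g])
  define u where "u y t = indicator {0..<1} t * norm (h t - y)" for y t
  have um: "u y \<in> borel_measurable borel" for y
    unfolding u_def[abs_def] using measurable_norm_diff_const[OF hm, of y] by measurable
  have u0: "0 \<le> u y t" for y t by (simp add: u_def)
  have nn: "(\<integral>\<^sup>+t. indicator E t * ennreal (norm (h t - y)) \<partial>unit_measure) = (\<integral>\<^sup>+t. ennreal (indicator E t * u y t) \<partial>lborel)"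
    if E: "E \<in> sets borel" for E y
  proof -
    have "(\<lambda>t. indicator E t * ennreal (norm (h t - y))) \<in> borel_measurable borel"
      using E measurable_norm_diff_const[OF hm, of y] by measurable
    then have "(\<integral>\<^sup>+t. indicator E t * ennreal (norm (h t - y)) \<partial>unit_measure) =
        (\<integral>\<^sup>+t. indicator {0..<1} t * (indicator E t * ennreal (norm (h t - y))) \<partial>lborel)"
      unfolding unit_measure_def by (intro nn_integral_density) auto
    also have "\<dots> = (\<integral>\<^sup>+t. ennreal (indicator E t * u y t) \<partial>lborel)"
      by (intro nn_integral_cong) (auto simp: u_def indicator_def)
    finally show ?thesis .
  qed
  have ui: "integrable lborel (u y)" for y
  proof (rule integrableI_bounded)
    show "u y \<in> borel_measurable lborel" using um by simp
    show "(\<integral>\<^sup>+t. ennreal (norm (u y t)) \<partial>lborel) < \<infinity>"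
      using fin[rule_format, of y] nn[of UNIV y] u0 by simp
  qed
  have uhk: "u y integrable_on S" if "S \<in> sets borel" for y S
  proof -
    have "(\<lambda>t. indicator S t *\<^sub>R u y t) integrable_on UNIV"
      using ui that by (intro integrable_on_lborel integrable_mult_indicator) auto
    moreover have "(\<lambda>t. indicator S t *\<^sub>R u y t) = (\<lambda>t. if t \<in> S then u y t else 0)"
      by (auto simp: indicator_def)
    ultimately show ?thesis by (simp add: integrable_restrict_UNIV)
  qed
  have est_u: "norm (g b - g a - (b - a) *\<^sub>R y) \<le> integral S (u y)"
    if ab: "0 \<le> a" "a \<le> b" "b \<le> 1" and S: "{a..<b} \<subseteq> S" "S \<in> sets borel" for a b y S
  proof -
    have i: "integrable lborel (\<lambda>t. indicator S t * u y t)"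
      using integrable_mult_indicator[of S lborel "u y"] ui S(2) by simp
    have "ennreal (norm (g b - g a - (b - a) *\<^sub>R y)) \<le> (\<integral>\<^sup>+t. ennreal (indicator {a..<b} t * u y t) \<partial>lborel)"
      by (rule order_trans[OF est[rule_format, OF ab]]) (simp add: nn)
    also have "\<dots> \<le> (\<integral>\<^sup>+t. ennreal (indicator S t * u y t) \<partial>lborel)"
      using S(1) u0 by (intro nn_integral_mono ennreal_leI mult_right_mono) (auto simp: indicator_def)
    also have "\<dots> = ennreal (\<integral>t. indicator S t * u y t \<partial>lborel)"
      using u0 by (intro nn_integral_eq_integral i) auto
    finally have "norm (g b - g a - (b - a) *\<^sub>R y) \<le> (\<integral>t. indicator S t * u y t \<partial>lborel)"
      using u0 by (subst (asm) ennreal_le_iff) (auto intro!: integral_nonneg)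
    also have "\<dots> = integral UNIV (\<lambda>t. indicator S t * u y t)"
      by (rule integral_lborel[OF i, symmetric])
    also have "\<dots> = integral S (u y)"
      by (subst integral_restrict_UNIV[symmetric]) (auto intro!: arg_cong[where f = "integral UNIV"] simp: indicator_def)
    finally show ?thesis .
  qed
  have "AE t in lebesgue. \<forall>y\<in>D. t \<in> {0<..<1} \<longrightarrow> (\<forall>\<eta>>0. \<exists>\<delta>>0. \<forall>r. 0 < r \<and> r < \<delta> \<longrightarrow>
      integral (cball t r) (u y) \<le> (u y t + \<eta>) * (2 * r))"
    unfolding AE_ball_countable[OF D(1)] by (intro ballI AE_lebesgue_point uhk) simp
  then have good: "AE t in lebesgue. t \<in> {0<..<1} \<longrightarrow> (\<forall>\<epsilon>>0. \<exists>y\<in>D. norm (h t - y) < \<epsilon>) \<and>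
      (\<forall>y\<in>D. \<forall>\<eta>>0. \<exists>\<delta>>0. \<forall>r. 0 < r \<and> r < \<delta> \<longrightarrow> integral (cball t r) (u y) \<le> (u y t + \<eta>) * (2 * r))"
    using AE_unit_measure_imp_lebesgue[OF D(2)] by eventually_elim auto
  have "\<exists>t\<in>{0<..<1::real}. (\<forall>\<epsilon>>0. \<exists>y\<in>D. norm (h t - y) < \<epsilon>) \<and>
      (\<forall>y\<in>D. \<forall>\<eta>>0. \<exists>\<delta>>0. \<forall>r. 0 < r \<and> r < \<delta> \<longrightarrow> integral (cball t r) (u y) \<le> (u y t + \<eta>) * (2 * r))"
  proof (rule ccontr)
    assume neg: "\<not> ?thesis"
    have "AE t in lebesgue. t \<notin> {0<..<1::real}"
      using good by eventually_elim (use neg in blast)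
    then have "{0<..<1::real} \<in> null_sets lebesgue" by (simp add: AE_iff_null_sets)
    then have "emeasure lebesgue {0<..<1::real} = 0" by (simp add: null_sets_def)
    then show False by simp
  qed
  then obtain t where t: "0 < t" "t < 1" and dense: "\<forall>\<epsilon>>0. \<exists>y\<in>D. norm (h t - y) < \<epsilon>"
    and leb: "\<forall>y\<in>D. \<forall>\<eta>>0. \<exists>\<delta>>0. \<forall>r. 0 < r \<and> r < \<delta> \<longrightarrow> integral (cball t r) (u y) \<le> (u y t + \<eta>) * (2 * r)"
    by auto
  have "(g has_vector_derivative h t) (at t)"
    unfolding has_vector_derivative_def has_derivative_at_alt
  proof (intro conjI allI impI bounded_linear_scaleR_left)
    fix e :: real assume e: "0 < e"
    \<comment> \<open>The average of \<open>u y\<close> near \<open>t\<close> is at most e / 5 + e /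
      5. The ball has twice the length of the interval between \<open>s\<close> and
      \<open>t\<close>, which makes 4 * e / 5; replacing \<open>y\<close> by \<open>h t\<close>
      costs the last e / 5.\<close>
    obtain y where y: "y \<in> D" "norm (h t - y) < e / 5" using dense e by (meson divide_pos_pos zero_less_numeral)
    have ut: "u y t < e / 5" using y(2) t by (simp add: u_def)
    have "0 < e / 5" using e by simp
    from leb[THEN bspec, OF y(1), THEN spec, THEN mp, OF this]
    obtain \<delta> where \<delta>: "0 < \<delta>" "\<forall>r. 0 < r \<and> r < \<delta> \<longrightarrow> integral (cball t r) (u y) \<le> (u y t + e / 5) * (2 * r)"
      by (elim exE conjE)
    define d where "d = min \<delta> (min t (1 - t))"
    have "norm (g s - g t - (s - t) *\<^sub>R h t) \<le> e * norm (s - t)" if s: "norm (s - t) < d" for s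
    proof (cases "s = t")
      case False
      let ?r = "\<bar>s - t\<bar>"
      have r: "0 < ?r" "?r < \<delta>" using s False by (auto simp: d_def)
      have s01: "0 \<le> s" "s \<le> 1" using s by (auto simp: d_def)
      have "norm (g s - g t - (s - t) *\<^sub>R y) \<le> integral (cball t ?r) (u y)"
      proof (cases "t \<le> s")
        case True
        have "{t..<s} \<subseteq> cball t ?r" by (auto simp: dist_real_def)
        then show ?thesis using True t s01 by (intro est_u) auto
      next
        case False
        have "{s..<t} \<subseteq> cball t ?r" by (auto simp: dist_real_def)
        then have "norm (g t - g s - (t - s) *\<^sub>R y) \<le> integral (cball t ?r) (u y)"
          using False t s01 by (intro est_u) auto
        moreover have "g t - g s - (t - s) *\<^sub>R y = - (g s - g t - (s - t) *\<^sub>R y)" by (simp add: algebra_simps)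
        ultimately show ?thesis by (simp only: norm_minus_cancel)
      qed
      also have "\<dots> \<le> (u y t + e / 5) * (2 * ?r)" using \<delta>(2) r by blast
      also have "\<dots> \<le> (2 * e / 5) * (2 * ?r)" using ut by (intro mult_right_mono) auto
      finally have 1: "norm (g s - g t - (s - t) *\<^sub>R y) \<le> 4 * e / 5 * ?r" by simp
      have eq: "g s - g t - (s - t) *\<^sub>R h t = (g s - g t - (s - t) *\<^sub>R y) - (s - t) *\<^sub>R (h t - y)"
        by (simp add: algebra_simps)
      have "norm (g s - g t - (s - t) *\<^sub>R h t) \<le> norm (g s - g t - (s - t) *\<^sub>R y) + ?r * norm (h t - y)"
        unfolding eq by (rule order_trans[OF norm_triangle_ineq4]) simp
      also have "\<dots> \<le> 4 * e / 5 * ?r + ?r * (e / 5)"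
        using 1 y(2) by (intro add_mono mult_left_mono) auto
      also have "\<dots> = e * norm (s - t)" by (simp add: algebra_simps)
      finally show ?thesis .
    qed simp
    moreover have "0 < d" using \<delta>(1) t by (simp add: d_def)
    ultimately show "\<exists>d>0. \<forall>s. norm (s - t) < d \<longrightarrow> norm (g s - g t - (s - t) *\<^sub>R h t) \<le> e * norm (s - t)"
      by blast
  qed
  with t show thesis by (rule that)
qed

section \<open>The Radon-Nikodym property implies attainment of maximal derivatives\<close>

lemma equivalent_normD:
  assumes "equivalent_norm N"
  shows "0 \<le> N y" "N (c *\<^sub>R y) = \<bar>c\<bar> * N y" "N (y + z) \<le> N y + N z"
    "\<bar>N y - N z\<bar> \<le> N (y - z)"
proof -
  have add: "N (y + z) \<le> N y + N z" for y z using assms unfolding equivalent_norm_def by blast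
  have sc: "N (c *\<^sub>R y) = \<bar>c\<bar> * N y" for c y using assms unfolding equivalent_norm_def by blast
  have m: "N (y - z) = N (z - y)" for y z using sc[of "-1" "z - y"] by simp
  show "0 \<le> N y" using assms unfolding equivalent_norm_def by blast
  show "N (c *\<^sub>R y) = \<bar>c\<bar> * N y" by (rule sc)
  show "N (y + z) \<le> N y + N z" by (rule add)
  show "\<bar>N y - N z\<bar> \<le> N (y - z)"
    using add[of "y - z" z] add[of "z - y" y] m[of y z] by simp
qed

lemma lip_norm_bound:
  assumes N: "equivalent_norm N" and f: "f \<in> Lip0 N"
  shows "N (f p - f q) \<le> lip_norm N f * norm (p - q)"
proof (cases "p = q")
  case True
  have "N (0 *\<^sub>R 0) = 0" unfolding equivalent_normD(2)[OF N] by simp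
  then show ?thesis using True by simp
next
  case False
  obtain L where L: "\<forall>p q. N (f p - f q) \<le> L * norm (p - q)" using f unfolding Lip0_def by blast
  have "N (f p - f q) / norm (p - q) \<le> lip_norm N f"
    unfolding lip_norm_def
  proof (rule cSup_upper)
    show "N (f p - f q) / norm (p - q) \<in> {N (f p - f q) / norm (p - q) |p q. p \<noteq> q}" using False by blast
    show "bdd_above {N (f p - f q) / norm (p - q) |p q. p \<noteq> q}"
    proof (rule bdd_aboveI)
      fix x assume "x \<in> {N (f p - f q) / norm (p - q) |p q. p \<noteq> q}"
      then obtain p q where "x = N (f p - f q) / norm (p - q)" "p \<noteq> q" by blast
      then show "x \<le> L" using L by (simp add: pos_divide_le_eq)
    qed
  qed
  then show ?thesis using False by (simp add: pos_divide_le_eq)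
qed

text \<open>On the segment where the norm is attained the triangle inequality leaves no slack, so every
  difference quotient along it has maximal norm; one point of differentiability suffices.\<close>

lemma SNA_subset_Der_of_RNP:
  fixes N :: "'y::banach \<Rightarrow> real"
  assumes rnp: "has_RNP TYPE('v + real) TYPE('y)" and N: "equivalent_norm N"
  shows "(SNA N :: ('x::banach \<Rightarrow> 'y) set) \<subseteq> Der N"
proof
  fix f :: "'x \<Rightarrow> 'y" assume "f \<in> SNA N"
  then have f: "f \<in> Lip0 N" and "\<exists>p q. p \<noteq> q \<and> lip_norm N f = N (f p - f q) / norm (p - q)"
    unfolding SNA_def by simp_all
  then obtain p q where pq: "p \<noteq> q" and att: "lip_norm N f = N (f p - f q) / norm (p - q)" by (elim exE conjE)
  let ?L = "lip_norm N f"
  note Nn = equivalent_normD[OF N]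
  note lip = lip_norm_bound[OF N f]
  define T where "T = norm (p - q)"
  have T: "0 < T" using pq by (simp add: T_def)
  define e where "e = (p - q) /\<^sub>R T"
  have e: "norm e = 1" using T by (simp add: e_def T_def)
  have pe: "p = q + T *\<^sub>R e" using T by (simp add: e_def)
  have L0: "0 \<le> ?L" unfolding att using Nn(1) by simp
  obtain a b where ab: "0 < a" "0 < b" "\<forall>y. a * norm y \<le> N y \<and> N y \<le> b * norm y"
    using N unfolding equivalent_norm_def by blast
  define g where "g t = f (q + (t * T) *\<^sub>R e)" for t
  have gN: "N (g t' - g t) \<le> ?L * T * \<bar>t' - t\<bar>" for t t'
  proof -
    have "N (g t' - g t) \<le> ?L * norm ((q + (t' * T) *\<^sub>R e) - (q + (t * T) *\<^sub>R e))"
      unfolding g_def by (rule lip)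
    also have "(q + (t' * T) *\<^sub>R e) - (q + (t * T) *\<^sub>R e) = ((t' - t) * T) *\<^sub>R e" by (simp add: algebra_simps)
    finally show ?thesis using T e by (simp add: abs_mult mult_ac)
  qed
  have g01: "N (g 1 - g 0) = ?L * T"
    using att T by (simp add: g_def T_def flip: pe[unfolded T_def])
  have exact: "N (g t' - g t) = ?L * T * (t' - t)" if "0 \<le> t" "t \<le> t'" "t' \<le> 1" for t t'
  proof (rule antisym)
    show "N (g t' - g t) \<le> ?L * T * (t' - t)" using gN[of t' t] that by simp
    have "g 1 - g 0 = (g 1 - g t') + ((g t' - g t) + (g t - g 0))" by simp
    then have "?L * T \<le> N (g 1 - g t') + (N (g t' - g t) + N (g t - g 0))"
      using Nn(3)[of "g 1 - g t'" "(g t' - g t) + (g t - g 0)"] Nn(3)[of "g t' - g t" "g t - g 0"] g01 by simp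
    also have "\<dots> \<le> ?L * T * (1 - t') + (N (g t' - g t) + ?L * T * t)"
      using gN[of 1 t'] gN[of t 0] that by simp
    finally show "?L * T * (t' - t) \<le> N (g t' - g t)" by (simp add: algebra_simps)
  qed
  have glip: "norm (g t' - g t) \<le> ?L * T / a * \<bar>t' - t\<bar>" for t t'
  proof -
    have "a * norm (g t' - g t) \<le> ?L * T * \<bar>t' - t\<bar>" using ab(3) gN order_trans by blast
    then show ?thesis using ab(1) by (simp add: field_simps)
  qed
  obtain t z where t: "0 < t" "t < 1" and der: "(g has_vector_derivative z) (at t)"
    by (rule RNP_curve_differentiable[OF rnp glip])
  define w where "w = z /\<^sub>R T"
  define x where "x = q + (t * T) *\<^sub>R e"
  define D where "D s = (f (x + s *\<^sub>R e) - f x) /\<^sub>R s" for s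
  have fx: "f (x + s *\<^sub>R e) - f x = g (t + s / T) - g t" for s
    using T by (simp add: g_def x_def algebra_simps)
  have "((\<lambda>h. norm (g (t + h) - g t - h *\<^sub>R z) / norm h) \<longlongrightarrow> 0) (at 0)"
    using der unfolding has_vector_derivative_def has_derivative_at by blast
  moreover have "filterlim (\<lambda>s. s / T) (at 0) (at 0)"
    unfolding filterlim_at using T by (auto simp: eventually_at_filter intro!: tendsto_eq_intros)
  ultimately have "((\<lambda>s. norm (g (t + s / T) - g t - (s / T) *\<^sub>R z) / norm (s / T)) \<longlongrightarrow> 0) (at 0)"
    by (rule filterlim_compose)
  then have "((\<lambda>s. b * (norm (g (t + s / T) - g t - (s / T) *\<^sub>R z) / norm (s / T) / T)) \<longlongrightarrow> b * (0 / T)) (at 0)"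
    using T by (intro tendsto_mult_left tendsto_divide tendsto_const) auto
  then have lim0: "((\<lambda>s. b * (norm (g (t + s / T) - g t - (s / T) *\<^sub>R z) / norm (s / T) / T)) \<longlongrightarrow> 0) (at 0)"
    by simp
  have lim: "((\<lambda>s. N (D s - w)) \<longlongrightarrow> 0) (at 0)"
  proof (rule Lim_null_comparison[OF _ lim0])
    show "\<forall>\<^sub>F s in at 0. norm (N (D s - w)) \<le> b * (norm (g (t + s / T) - g t - (s / T) *\<^sub>R z) / norm (s / T) / T)"
      unfolding eventually_at_filter
    proof (rule always_eventually, intro allI impI)
      fix s :: real assume s: "s \<noteq> 0"
      let ?v = "g (t + s / T) - g t"
      have "D s - w = (?v - (s / T) *\<^sub>R z) /\<^sub>R s"
        using s by (simp add: D_def fx w_def scaleR_diff_right inverse_eq_divide)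
      then have "norm (D s - w) = norm (?v - (s / T) *\<^sub>R z) / norm (s / T) / T"
        using T s by (simp add: divide_inverse abs_mult)
      moreover have "norm (N (D s - w)) \<le> b * norm (D s - w)" using ab(3) Nn(1) by simp
      ultimately show "norm (N (D s - w)) \<le> b * (norm (?v - (s / T) *\<^sub>R z) / norm (s / T) / T)" by simp
    qed
  qed
  \<comment> \<open>Small positive \<open>s\<close> keep t + s / T on the segment. The one-sided
    limit determines \<open>N w\<close> because the two-sided limit is already known to
    exist.\<close>
  have ND: "N (D s) = ?L" if s: "0 < s" "s < (1 - t) * T" for s
  proof -
    have "s / T < 1 - t" using s T by (simp add: pos_divide_less_eq)
    then have "N (g (t + s / T) - g t) = ?L * T * (t + s / T - t)"
      using t s T by (intro exact) auto
    then show ?thesis unfolding D_def fx Nn(2) using s T by simp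
  qed
  have "\<bar>N w - ?L\<bar> \<le> 0"
  proof (rule tendsto_lowerbound)
    show "((\<lambda>s. N (D s - w)) \<longlongrightarrow> 0) (at_right 0)" using lim by (rule tendsto_mono[rotated]) (simp add: at_le)
    show "\<forall>\<^sub>F s in at_right 0. \<bar>N w - ?L\<bar> \<le> N (D s - w)"
    proof (rule eventually_at_rightI)
      show "0 < (1 - t) * T" using t T by simp
      fix s assume "s \<in> {0<..<(1 - t) * T}"
      then have "N (D s) = ?L" by (intro ND) auto
      then show "\<bar>N w - ?L\<bar> \<le> N (D s - w)" using Nn(4)[of "D s" w] by (simp add: abs_minus_commute)
    qed
  qed simp
  then have "N w = ?L" by simp
  then show "f \<in> Der N"
    unfolding Der_def using f e lim[unfolded D_def] by blast
qed

theorem corollary2p9: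
  assumes "\<exists>x :: 'x::banach. x \<noteq> 0"
    and "\<exists>y :: 'y::banach. y \<noteq> 0"
  shows "has_RNP TYPE('v + real) TYPE('y) \<longleftrightarrow>
    (\<forall>N :: 'y \<Rightarrow> real. equivalent_norm N \<longrightarrow> (SNA N :: ('x \<Rightarrow> 'y) set) \<subseteq> Der N)"
  using RNP_of_SNA_subset_Der[OF assms] SNA_subset_Der_of_RNP by blast

end
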